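(* Let $(N^6,\check g,\mathrm{J},\omega,\Omega)$ be a nearly Kähler 6-manifold and let $M^7=(0,\infty)\times N$ be equipped with the torsion-free $\mathrm{G}_2$-structure $\overline{\varphi}=\operatorname{Re}(r^3\Omega)-r^2\,dr\wedge\omega$, which induces the cone metric $g=dr^2+r^2\check g$. Let $\varphi=\varphi(f,X)$ be an isometric $\mathrm{G}_2$-structure and let $(\varphi,Y,c)$ be an isometric soliton, where $$X=a(r)\frac{\partial}{\partial r},\qquad Y=b(r)\frac{\partial}{\partial r}.$$ Then $b(r)=cr$, and $a(r)$ is a solution of the ODE $$a''+\frac{a}{f^2}(a')^2+(6-cr^2)\frac{a'}{r}=6\,\frac{f^2}{r^2}\,a .$$ Moreover the torsion $T$ of $\varphi$ satisfies $$\tfrac14|T|^2=\frac{(a')^2}{f^2}+6\,\frac{a^2}{r^2}.$$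
   Context: Nearly Kähler 6-manifold: an $\mathrm{SU}(3)$-structure $(\check g,\mathrm{J},\omega,\Omega)$ on $N^6$, i.e. $\mathrm{J}$ a $\check g$-compatible almost complex structure, $\omega(\cdot,\cdot)=\check g(\mathrm{J}\cdot,\cdot)$, $\Omega$ a nowhere vanishing $(3,0)$-form with $\mathrm{vol}_{\check g}=\frac16\omega^3=\frac{i}{8}\Omega\wedge\overline{\Omega}$, satisfying $d\omega=-3\operatorname{Re}(\Omega)$ and $d\operatorname{Im}(\Omega)=2\omega^2$. A $\mathrm{G}_2$-structure $\varphi$ on a 7-manifold induces a Riemannian metric $g$, an orientation, and $\psi=\star\varphi$; the sign convention is $\varphi_{ijk}\varphi_{abk}=\delta_{ia}\delta_{jb}-\delta_{ib}\delta_{ja}-\psi_{ijab}$ in local orthonormal frames (repeated indices summed). With $\nabla$ the Levi-Civita connection, the torsion $T_{pq}$ is defined by $\nabla_p\varphi_{ijk}=T_{pq}\psi_{qijk}$, and $|T|^2=T_{pq}T_{pq}$. Set $(\operatorname{div}T)_k=\nabla_iT_{ik}$, $(Y\lrcorner T)_k=Y_pT_{pk}$, $(\operatorname{curl}_\varphi Y)_k=\nabla_iY_j\varphi_{ijk}$. For a smooth function $f$ and a smooth vector field $X$ with $f^2+|X|^2=1$, $$\varphi(f,X)=(f^2-|X|^2)\overline{\varphi}-2f\,X\lrcorner\overline{\psi}+2X^\flat\wedge(X\lrcorner\overline{\varphi}),\qquad\overline{\psi}=\star\overline{\varphi}.$$ Here $f=f(r)$ and $f^2=1-a^2$; expressions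 with $f^2$ in a denominator are understood where $f\neq0$. An isometric soliton is a triple $(\varphi,Y,c)$, $c\in\mathbb{R}$, with $\mathcal{L}_Yg=2c\,g$ and $\operatorname{div}T=-\frac12\operatorname{curl}_\varphi Y+Y\lrcorner T$. *)

theory Defs
  imports "HOL-Analysis.Analysis"
begin

section \<open>Smooth maps and manifolds\<close>

primrec Ck_on :: "nat \<Rightarrow> 'e::real_normed_vector set \<Rightarrow> ('e \<Rightarrow> 'f::real_normed_vector) \<Rightarrow> bool" where
  "Ck_on 0 S f \<longleftrightarrow> continuous_on S f"
| "Ck_on (Suc k) S f \<longleftrightarrow>
     f differentiable_on S \<and> (\<forall>v. Ck_on k S (\<lambda>x. frechet_derivative f (at x) v))"

text \<open>Only used on open sets.\<close>
definition smooth_on :: "'e::real_normed_vector set \<Rightarrow> ('e \<Rightarrow> 'f::real_normed_vector) \<Rightarrow> bool" where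
  "smooth_on S f \<longleftrightarrow> (\<forall>k. Ck_on k S f)"

text \<open>
  An atlas is a family of charts. The manifold is the union of the chart domains, an open
  subset of a Hausdorff, second countable type; its dimension is that of the Euclidean space \<open>'e\<close>.
\<close>
record ('i, 'p, 'e) atlas =
  index :: "'i set"
  dom :: "'i \<Rightarrow> 'p set"
  coord :: "'i \<Rightarrow> 'p \<Rightarrow> 'e"

definition chart_image :: "('i, 'p, 'e) atlas \<Rightarrow> 'i \<Rightarrow> 'e set" where
  "chart_image A i = coord A i ` dom A i"

definition transition :: "('i, 'p, 'e) atlas \<Rightarrow> 'i \<Rightarrow> 'i \<Rightarrow> 'e \<Rightarrow> 'e" where
  "transition A i j x = coord A j (inv_into (dom A i) (coord A i) x)"

definition smooth_manifold ::
  "('i, 'p::{t2_space,second_countable_topology}, 'e::euclidean_space) atlas \<Rightarrow> bool" where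
  "smooth_manifold A \<longleftrightarrow>
     (\<Union>i\<in>index A. dom A i) \<noteq> {} \<and>
     (\<forall>i\<in>index A. open (dom A i) \<and> open (chart_image A i) \<and>
        (\<exists>h. homeomorphism (dom A i) (chart_image A i) (coord A i) h)) \<and>
     (\<forall>i\<in>index A. \<forall>j\<in>index A. smooth_on (coord A i ` (dom A i \<inter> dom A j)) (transition A i j))"

section \<open>Tensors\<close>

text \<open>
  A covariant \<open>k\<close>-tensor is a function of the list of its \<open>k\<close> arguments; its values on lists of
  any other length carry no meaning. A field assigns to every chart and every coordinate vector
  the tensor expressed in that chart.
\<close>
type_synonym ('e, 'a) tensor = "'e list \<Rightarrow> 'a"
type_synonym ('i, 'e, 'a) field = "'i \<Rightarrow> 'e \<Rightarrow> ('e, 'a) tensor"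

definition multilinear :: "nat \<Rightarrow> ('e::real_vector, 'a::real_vector) tensor \<Rightarrow> bool" where
  "multilinear k t \<longleftrightarrow> (\<forall>vs i. length vs = k \<and> i < k \<longrightarrow> linear (\<lambda>v. t (vs[i := v])))"

definition alternating :: "nat \<Rightarrow> ('e, 'a::zero) tensor \<Rightarrow> bool" where
  "alternating k t \<longleftrightarrow>
     (\<forall>vs i j. length vs = k \<and> i < j \<and> j < k \<and> vs ! i = vs ! j \<longrightarrow> t vs = 0)"

definition tensor_field ::
  "('i, 'p, 'e::euclidean_space) atlas \<Rightarrow> nat \<Rightarrow> ('i, 'e, 'a::real_normed_vector) field \<Rightarrow> bool" where
  "tensor_field A k t \<longleftrightarrow>
     (\<forall>i\<in>index A. \<forall>x\<in>chart_image A i. multilinear k (t i x)) \<and>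
     (\<forall>i\<in>index A. \<forall>vs. length vs = k \<longrightarrow> smooth_on (chart_image A i) (\<lambda>x. t i x vs)) \<and>
     (\<forall>i\<in>index A. \<forall>j\<in>index A. \<forall>p\<in>dom A i \<inter> dom A j. \<forall>vs. length vs = k \<longrightarrow>
        t i (coord A i p) vs =
        t j (coord A j p) (map (frechet_derivative (transition A i j) (at (coord A i p))) vs))"

definition form_field ::
  "('i, 'p, 'e::euclidean_space) atlas \<Rightarrow> nat \<Rightarrow> ('i, 'e, 'a::real_normed_vector) field \<Rightarrow> bool" where
  "form_field A k t \<longleftrightarrow>
     tensor_field A k t \<and> (\<forall>i\<in>index A. \<forall>x\<in>chart_image A i. alternating k (t i x))"

definition vector_field ::
  "('i, 'p, 'e::euclidean_space) atlas \<Rightarrow> ('i \<Rightarrow> 'e \<Rightarrow> 'e) \<Rightarrow> bool" where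
  "vector_field A X \<longleftrightarrow>
     (\<forall>i\<in>index A. smooth_on (chart_image A i) (X i)) \<and>
     (\<forall>i\<in>index A. \<forall>j\<in>index A. \<forall>p\<in>dom A i \<inter> dom A j.
        frechet_derivative (transition A i j) (at (coord A i p)) (X i (coord A i p)) =
        X j (coord A j p))"

definition endo_field ::
  "('i, 'p, 'e::euclidean_space) atlas \<Rightarrow> ('i \<Rightarrow> 'e \<Rightarrow> 'e \<Rightarrow> 'e) \<Rightarrow> bool" where
  "endo_field A J \<longleftrightarrow>
     (\<forall>i\<in>index A. \<forall>x\<in>chart_image A i. linear (J i x)) \<and>
     (\<forall>i\<in>index A. \<forall>v. smooth_on (chart_image A i) (\<lambda>x. J i x v)) \<and>
     (\<forall>i\<in>index A. \<forall>j\<in>index A. \<forall>p\<in>dom A i \<inter> dom A j. \<forall>v.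
        frechet_derivative (transition A i j) (at (coord A i p)) (J i (coord A i p) v) =
        J j (coord A j p) (frechet_derivative (transition A i j) (at (coord A i p)) v))"

text \<open>Normalised so that \<open>\<alpha> \<and> \<beta>\<close> of two 1-forms is \<open>\<alpha>(u) \<beta>(v) - \<alpha>(v) \<beta>(u)\<close>.\<close>
definition wedge ::
  "nat \<Rightarrow> nat \<Rightarrow> ('e, 'a::real_normed_field) tensor \<Rightarrow> ('e, 'a) tensor \<Rightarrow> ('e, 'a) tensor" where
  "wedge k l \<alpha> \<beta> vs =
     (\<Sum>p | p permutes {..<k + l}. of_int (sign p) *
        \<alpha> (map (\<lambda>n. vs ! p n) [0..<k]) * \<beta> (map (\<lambda>n. vs ! p n) [k..<k + l]))
     / (fact k * fact l)"

definition interior :: "'e \<Rightarrow> ('e, 'a) tensor \<Rightarrow> ('e, 'a) tensor" where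
  "interior v t vs = t (v # vs)"

definition flat :: "('e, real) tensor \<Rightarrow> 'e \<Rightarrow> ('e, real) tensor" where
  "flat m u vs = m (u # vs)"

text \<open>Exterior derivative of a \<open>k\<close>-form, given in one chart.\<close>
definition ext_d ::
  "nat \<Rightarrow> ('e::real_normed_vector \<Rightarrow> ('e, 'a::real_normed_field) tensor) \<Rightarrow> 'e \<Rightarrow> ('e, 'a) tensor" where
  "ext_d k \<alpha> x vs =
     (\<Sum>n<Suc k. (-1) ^ n *
        frechet_derivative (\<lambda>y. \<alpha> y (take n vs @ drop (Suc n) vs)) (at x) (vs ! n))"

text \<open>Lie derivative of a covariant \<open>k\<close>-tensor along \<open>Y\<close>, given in one chart.\<close>
definition lie_derivative ::
  "nat \<Rightarrow> ('e::real_normed_vector \<Rightarrow> 'e) \<Rightarrow> ('e \<Rightarrow> ('e, real) tensor) \<Rightarrow> 'e \<Rightarrow> ('e, real) tensor" where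
  "lie_derivative k Y t x vs =
     frechet_derivative (\<lambda>y. t y vs) (at x) (Y x) +
     (\<Sum>n<k. t x (vs[n := frechet_derivative Y (at x) (vs ! n)]))"

section \<open>Riemannian metrics\<close>

definition inner_product :: "('e::real_vector, real) tensor \<Rightarrow> bool" where
  "inner_product m \<longleftrightarrow>
     multilinear 2 m \<and> (\<forall>u v. m [u, v] = m [v, u]) \<and> (\<forall>v. v \<noteq> 0 \<longrightarrow> m [v, v] > 0)"

definition riemannian_metric ::
  "('i, 'p, 'e::euclidean_space) atlas \<Rightarrow> ('i, 'e, real) field \<Rightarrow> bool" where
  "riemannian_metric A g \<longleftrightarrow>
     tensor_field A 2 g \<and> (\<forall>i\<in>index A. \<forall>x\<in>chart_image A i. inner_product (g i x))"

definition orthonormal_frame :: "('e::euclidean_space, real) tensor \<Rightarrow> 'e list \<Rightarrow> bool" where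
  "orthonormal_frame m E \<longleftrightarrow> length E = DIM('e) \<and>
     (\<forall>i<DIM('e). \<forall>j<DIM('e). m [E ! i, E ! j] = (if i = j then 1 else 0))"

text \<open>
  Summation over \<open>k\<close> pairs of repeated indices in an orthonormal frame: the argument \<open>B\<close> receives
  the list of the \<open>k\<close> frame vectors and uses it twice. The value does not depend on the frame when
  \<open>B\<close> is multilinear in both occurrences.
\<close>
definition contract ::
  "('e::euclidean_space, real) tensor \<Rightarrow> nat \<Rightarrow> ('e list \<Rightarrow> real) \<Rightarrow> real" where
  "contract m k B =
     (let E = (SOME E. orthonormal_frame m E)
      in \<Sum>is | length is = k \<and> set is \<subseteq> {..<DIM('e)}. B (map ((!) E) is))"

text \<open>\<open>(\<star>\<alpha>)(v\<^sub>1, \<dots>) = 1/k! \<alpha>(e\<^sub>i, e\<^sub>j, \<dots>) \<mu>(e\<^sub>i, e\<^sub>j, \<dots>, v\<^sub>1, \<dots>)\<close>, so that \<open>\<alpha> \<and> \<star>\<alpha> = |\<alpha>|\<^sup>2 \<mu>\<close>.\<close>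
definition hodge_star ::
  "('e::euclidean_space, real) tensor \<Rightarrow> ('e, real) tensor \<Rightarrow> nat \<Rightarrow> ('e, real) tensor
     \<Rightarrow> ('e, real) tensor" where
  "hodge_star m \<mu> k \<alpha> vs = contract m k (\<lambda>e. \<alpha> e * \<mu> (e @ vs)) / fact k"

text \<open>\<open>levi_civita g x u v\<close> is \<open>\<nabla>\<^sub>u v\<close> at \<open>x\<close> for coordinate-constant fields \<open>u\<close> and \<open>v\<close>.\<close>
definition levi_civita ::
  "('e::euclidean_space \<Rightarrow> ('e, real) tensor) \<Rightarrow> 'e \<Rightarrow> 'e \<Rightarrow> 'e \<Rightarrow> 'e" where
  "levi_civita g x =
     (THE \<Gamma>. bilinear \<Gamma> \<and> (\<forall>u v. \<Gamma> u v = \<Gamma> v u) \<and>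
        (\<forall>u v w. frechet_derivative (\<lambda>y. g y [u, v]) (at x) w =
           g x [\<Gamma> w u, v] + g x [u, \<Gamma> w v]))"

text \<open>The direction of differentiation is the first argument of the resulting tensor.\<close>
definition cov_deriv ::
  "('e::euclidean_space \<Rightarrow> ('e, real) tensor) \<Rightarrow> ('e \<Rightarrow> ('e, real) tensor) \<Rightarrow> 'e
     \<Rightarrow> ('e, real) tensor" where
  "cov_deriv g t x pvs =
     (let p = hd pvs; vs = tl pvs
      in frechet_derivative (\<lambda>y. t y vs) (at x) p -
         (\<Sum>n<length vs. t x (vs[n := levi_civita g x p (vs ! n)])))"

section \<open>Nearly Kaehler 6-manifolds\<close>

definition omega_cubed :: "('e, real) tensor \<Rightarrow> ('e, real) tensor" where
  "omega_cubed w = wedge 4 2 (wedge 2 2 w w) w"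

text \<open>
  Type (3,0) is expressed by complex linearity in the first slot, hence, \<open>\<Omega>\<close> being alternating,
  in every slot. The volume form of \<open>g\<close> is the one for the orientation given by \<open>\<omega>\<^sup>3\<close>.
\<close>
definition SU3_structure ::
  "('i, 'p::{t2_space,second_countable_topology}, real ^ 6) atlas \<Rightarrow> ('i, real ^ 6, real) field
     \<Rightarrow> ('i \<Rightarrow> real ^ 6 \<Rightarrow> real ^ 6 \<Rightarrow> real ^ 6) \<Rightarrow> ('i, real ^ 6, real) field
     \<Rightarrow> ('i, real ^ 6, complex) field \<Rightarrow> bool" where
  "SU3_structure A g J \<omega> \<Omega> \<longleftrightarrow>
     riemannian_metric A g \<and> endo_field A J \<and> form_field A 2 \<omega> \<and> form_field A 3 \<Omega> \<and>
     (\<forall>i\<in>index A. \<forall>x\<in>chart_image A i.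
        (\<forall>v. J i x (J i x v) = - v) \<and>
        (\<forall>u v. g i x [J i x u, J i x v] = g i x [u, v]) \<and>
        (\<forall>u v. \<omega> i x [u, v] = g i x [J i x u, v]) \<and>
        (\<forall>u v w. \<Omega> i x [J i x u, v, w] = \<i> * \<Omega> i x [u, v, w]) \<and>
        (\<exists>u v w. \<Omega> i x [u, v, w] \<noteq> 0) \<and>
        (\<forall>E. orthonormal_frame (g i x) E \<longrightarrow> \<bar>1 / 6 * omega_cubed (\<omega> i x) E\<bar> = 1) \<and>
        (\<forall>vs. length vs = 6 \<longrightarrow>
           complex_of_real (1 / 6 * omega_cubed (\<omega> i x) vs) =
           \<i> / 8 * wedge 3 3 (\<Omega> i x) (\<lambda>us. cnj (\<Omega> i x us)) vs))"

definition nearly_Kaehler ::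
  "('i, 'p::{t2_space,second_countable_topology}, real ^ 6) atlas \<Rightarrow> ('i, real ^ 6, real) field
     \<Rightarrow> ('i \<Rightarrow> real ^ 6 \<Rightarrow> real ^ 6 \<Rightarrow> real ^ 6) \<Rightarrow> ('i, real ^ 6, real) field
     \<Rightarrow> ('i, real ^ 6, complex) field \<Rightarrow> bool" where
  "nearly_Kaehler A g J \<omega> \<Omega> \<longleftrightarrow>
     smooth_manifold A \<and> SU3_structure A g J \<omega> \<Omega> \<and>
     (\<forall>i\<in>index A. \<forall>x\<in>chart_image A i.
        (\<forall>vs. length vs = 3 \<longrightarrow> ext_d 2 (\<omega> i) x vs = - 3 * Re (\<Omega> i x vs)) \<and>
        (\<forall>vs. length vs = 4 \<longrightarrow>
           ext_d 3 (\<lambda>y us. Im (\<Omega> i y us)) x vs = 2 * wedge 2 2 (\<omega> i x) (\<omega> i x) vs))"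

section \<open>\<open>G\<^sub>2\<close>-structures\<close>

text \<open>
  Components, for increasing indices counted from 0, of the model 3-form
  \<open>-e\<^sup>0\<^sup>1\<^sup>2 - e\<^sup>0\<^sup>3\<^sup>4 - e\<^sup>0\<^sup>5\<^sup>6 + e\<^sup>1\<^sup>3\<^sup>5 - e\<^sup>1\<^sup>4\<^sup>6 - e\<^sup>2\<^sup>3\<^sup>6 - e\<^sup>2\<^sup>4\<^sup>5\<close>.
  The orientation induced by a 3-form is the one for which the sign convention
  \<open>\<phi>\<^sub>i\<^sub>j\<^sub>k \<phi>\<^sub>a\<^sub>b\<^sub>k = \<delta>\<^sub>i\<^sub>a \<delta>\<^sub>j\<^sub>b - \<delta>\<^sub>i\<^sub>b \<delta>\<^sub>j\<^sub>a - \<psi>\<^sub>i\<^sub>j\<^sub>a\<^sub>b\<close> holds. For this model it is that of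
  \<open>e\<^sup>0\<^sup>1\<^sup>2\<^sup>3\<^sup>4\<^sup>5\<^sup>6\<close>; the model \<open>e\<^sup>0\<^sup>1\<^sup>2 + e\<^sup>0\<^sup>3\<^sup>4 + e\<^sup>0\<^sup>5\<^sup>6 + e\<^sup>1\<^sup>3\<^sup>5 - \<dots>\<close>, obtained by \<open>e\<^sup>0 \<mapsto> -e\<^sup>0\<close>,
  would need the opposite one.
\<close>
definition phi0 :: "nat \<Rightarrow> nat \<Rightarrow> nat \<Rightarrow> real" where
  "phi0 i j k =
     (if (i, j, k) = (1, 3, 5) then 1
      else if (i, j, k) \<in> {(0, 1, 2), (0, 3, 4), (0, 5, 6), (1, 4, 6), (2, 3, 6), (2, 4, 5)} then - 1
      else 0)"

definition G2_frame :: "('e::euclidean_space, real) tensor \<Rightarrow> 'e list \<Rightarrow> bool" where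
  "G2_frame t E \<longleftrightarrow> length E = 7 \<and> independent (set E) \<and> distinct E \<and>
     (\<forall>i j k. i < j \<and> j < k \<and> k < 7 \<longrightarrow> t [E ! i, E ! j, E ! k] = phi0 i j k)"

definition G2_structure ::
  "('i, 'p, 'e::euclidean_space) atlas \<Rightarrow> ('i, 'e, real) field \<Rightarrow> bool" where
  "G2_structure A \<phi> \<longleftrightarrow> DIM('e) = 7 \<and> form_field A 3 \<phi> \<and>
     (\<forall>i\<in>index A. \<forall>x\<in>chart_image A i. \<exists>E. G2_frame (\<phi> i x) E)"

text \<open>
  The induced objects are given in one chart. They are unique on lists of the right length
  (any two frames of the same 3-form differ by an element of \<open>G\<^sub>2 \<subseteq> SO(7)\<close>), but not as functions
  on all lists; hence \<open>SOME\<close> instead of \<open>THE\<close>.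
\<close>
definition G2_metric ::
  "('e::euclidean_space \<Rightarrow> ('e, real) tensor) \<Rightarrow> 'e \<Rightarrow> ('e, real) tensor" where
  "G2_metric \<phi> x =
     (SOME m. multilinear 2 m \<and> (\<exists>E. G2_frame (\<phi> x) E \<and> orthonormal_frame m E))"

definition G2_volume ::
  "('e::euclidean_space \<Rightarrow> ('e, real) tensor) \<Rightarrow> 'e \<Rightarrow> ('e, real) tensor" where
  "G2_volume \<phi> x =
     (SOME \<mu>. multilinear 7 \<mu> \<and> alternating 7 \<mu> \<and> (\<exists>E. G2_frame (\<phi> x) E \<and> \<mu> E = 1))"

definition G2_psi ::
  "('e::euclidean_space \<Rightarrow> ('e, real) tensor) \<Rightarrow> 'e \<Rightarrow> ('e, real) tensor" where
  "G2_psi \<phi> x = hodge_star (G2_metric \<phi> x) (G2_volume \<phi> x) 3 (\<phi> x)"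

definition G2_torsion ::
  "('e::euclidean_space \<Rightarrow> ('e, real) tensor) \<Rightarrow> 'e \<Rightarrow> ('e, real) tensor" where
  "G2_torsion \<phi> x =
     (SOME T. multilinear 2 T \<and>
        (\<forall>p i j k. cov_deriv (G2_metric \<phi>) \<phi> x [p, i, j, k] =
           contract (G2_metric \<phi> x) 1 (\<lambda>q. T (p # q) * G2_psi \<phi> x (q @ [i, j, k]))))"

definition torsion_free ::
  "('i, 'p, 'e::euclidean_space) atlas \<Rightarrow> ('i, 'e, real) field \<Rightarrow> bool" where
  "torsion_free A \<phi> \<longleftrightarrow>
     (\<forall>i\<in>index A. \<forall>x\<in>chart_image A i. \<forall>u v. G2_torsion (\<phi> i) x [u, v] = 0)"

definition induces_metric ::
  "('i, 'p, 'e::euclidean_space) atlas \<Rightarrow> ('i, 'e, real) field \<Rightarrow> ('i, 'e, real) field \<Rightarrow> bool" where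
  "induces_metric A \<phi> g \<longleftrightarrow>
     (\<forall>i\<in>index A. \<forall>x\<in>chart_image A i. \<forall>u v. G2_metric (\<phi> i) x [u, v] = g i x [u, v])"

definition torsion_norm_sq ::
  "('e::euclidean_space \<Rightarrow> ('e, real) tensor) \<Rightarrow> 'e \<Rightarrow> real" where
  "torsion_norm_sq \<phi> x = contract (G2_metric \<phi> x) 2 (\<lambda>pq. G2_torsion \<phi> x pq * G2_torsion \<phi> x pq)"

text \<open>\<open>(div T)\<^sub>k = \<nabla>\<^sub>i T\<^sub>i\<^sub>k\<close>\<close>
definition div_torsion ::
  "('e::euclidean_space \<Rightarrow> ('e, real) tensor) \<Rightarrow> 'e \<Rightarrow> 'e \<Rightarrow> real" where
  "div_torsion \<phi> x v =
     contract (G2_metric \<phi> x) 1 (\<lambda>i. cov_deriv (G2_metric \<phi>) (G2_torsion \<phi>) x (i @ i @ [v]))"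

text \<open>\<open>(curl Y)\<^sub>k = \<nabla>\<^sub>i Y\<^sub>j \<phi>\<^sub>i\<^sub>j\<^sub>k\<close>\<close>
definition curl ::
  "('e::euclidean_space \<Rightarrow> ('e, real) tensor) \<Rightarrow> ('e \<Rightarrow> 'e) \<Rightarrow> 'e \<Rightarrow> 'e \<Rightarrow> real" where
  "curl \<phi> Y x v =
     contract (G2_metric \<phi> x) 2
       (\<lambda>ij. cov_deriv (G2_metric \<phi>) (\<lambda>y. flat (G2_metric \<phi> y) (Y y)) x ij * \<phi> x (ij @ [v]))"

definition isometric_soliton ::
  "('i, 'p, 'e::euclidean_space) atlas \<Rightarrow> ('i, 'e, real) field \<Rightarrow> ('i \<Rightarrow> 'e \<Rightarrow> 'e) \<Rightarrow> real \<Rightarrow> bool" where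
  "isometric_soliton A \<phi> Y c \<longleftrightarrow>
     G2_structure A \<phi> \<and> vector_field A Y \<and>
     (\<forall>i\<in>index A. \<forall>x\<in>chart_image A i.
        (\<forall>u v. lie_derivative 2 (Y i) (G2_metric (\<phi> i)) x [u, v] =
           2 * c * G2_metric (\<phi> i) x [u, v]) \<and>
        (\<forall>v. div_torsion (\<phi> i) x v =
           - (1 / 2) * curl (\<phi> i) (Y i) x v + G2_torsion (\<phi> i) x [Y i x, v]))"

text \<open>The \<open>G\<^sub>2\<close>-structure \<open>\<phi>(f, X)\<close> built from \<open>\<phi>\<close>.\<close>
definition isometric_G2 ::
  "('i \<Rightarrow> 'e \<Rightarrow> real) \<Rightarrow> ('i \<Rightarrow> 'e \<Rightarrow> 'e) \<Rightarrow> ('i, 'e::euclidean_space, real) field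
     \<Rightarrow> ('i, 'e, real) field" where
  "isometric_G2 f X \<phi> i x vs =
     (let m = G2_metric (\<phi> i) x; h = f i x; u = X i x
      in (h\<^sup>2 - m [u, u]) * \<phi> i x vs
         - 2 * h * interior u (G2_psi (\<phi> i) x) vs
         + 2 * wedge 1 2 (flat m u) (interior u (\<phi> i x)) vs)"

section \<open>The cone over a 6-manifold\<close>

text \<open>
  The manifold \<open>(0, \<infinity>) \<times> N\<close> carries the product charts, indexed like the charts of \<open>N\<close>; in them
  the projection to \<open>N\<close> is \<open>snd\<close>, the radial coordinate is \<open>fst\<close>, and \<open>\<partial>\<^sub>r\<close> is \<open>(1, 0)\<close>.
\<close>
definition cone_atlas :: "('i, 'p, 'e) atlas \<Rightarrow> ('i, real \<times> 'p, real \<times> 'e) atlas" where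
  "cone_atlas A = \<lparr>index = index A, dom = (\<lambda>i. {0<..} \<times> dom A i),
                   coord = (\<lambda>i (r, p). (r, coord A i p))\<rparr>"

definition pullback :: "('i, 'e, 'a) field \<Rightarrow> ('i, real \<times> 'e, 'a) field" where
  "pullback t i y vs = t i (snd y) (map snd vs)"

definition dr :: "(real \<times> 'e, real) tensor" where
  "dr vs = fst (hd vs)"

definition cone_metric :: "('i, 'e, real) field \<Rightarrow> ('i, real \<times> 'e, real) field" where
  "cone_metric g i y vs =
     fst (vs ! 0) * fst (vs ! 1) + (fst y)\<^sup>2 * pullback g i y vs"

definition cone_phi ::
  "('i, 'e, real) field \<Rightarrow> ('i, 'e, complex) field \<Rightarrow> ('i, real \<times> 'e, real) field" where
  "cone_phi \<omega> \<Omega> i y vs =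
     Re (complex_of_real (fst y ^ 3) * pullback \<Omega> i y vs)
     - (fst y)\<^sup>2 * wedge 1 2 dr (pullback \<omega> i y) vs"

definition radial_function :: "(real \<Rightarrow> real) \<Rightarrow> 'i \<Rightarrow> real \<times> 'e \<Rightarrow> real" where
  "radial_function h i y = h (fst y)"

definition radial_field :: "(real \<Rightarrow> real) \<Rightarrow> 'i \<Rightarrow> real \<times> 'e::zero \<Rightarrow> real \<times> 'e" where
  "radial_field h i y = (h (fst y), 0)"

end

theory Submission
  imports Defs "HOL-Combinatorics.Multiset_Permutations"
begin

text \<open>
  Since \<open>f\<^sup>2 + a\<^sup>2 = 1\<close>, the form \<open>\<phi>(f, X)\<close> equals
  \<open>- r\<^sup>2 dr \<and> \<omega> + r\<^sup>3 Re ((f - \<i> a)\<^sup>2 \<Omega>)\<close>: only the phase of \<open>\<Omega>\<close> is rotated.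
  The structure equations, together with \<open>d Re \<Omega> = 0\<close>, which follows from \<open>dd\<omega> = 0\<close>, form a
  linear system for the components of \<open>\<nabla>\<omega>\<close> and \<open>\<nabla>\<Omega>\<close> in a unitary frame, and its only solution is
  \<open>\<nabla>\<^sub>v \<omega> = - v \<lrcorner> Re \<Omega>\<close> and \<open>\<nabla>\<^sub>v \<Omega> = (v\<^sup>\<flat> + \<i> (J v)\<^sup>\<flat>) \<and> \<omega>\<close>.
  With the explicit Levi-Civita connection of the cone, the torsion of \<open>- r\<^sup>2 dr \<and> \<omega> + r\<^sup>3 Re (z \<Omega>)\<close> for
  a phase \<open>z = p + \<i> q\<close> whose argument has derivative \<open>\<alpha>\<close> is a combination of \<open>dr\<^sup>2\<close>, \<open>g\<close> and \<open>\<omega>\<close> with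
  coefficients in \<open>\<alpha>\<close>, \<open>q / r\<close> and \<open>(p - 1) / r\<close>; its radial divergence gives the differential equation.
  That the induced metric and volume do not depend on the frame is read off from the form
  \<open>(u \<lrcorner> \<phi>) \<and> (v \<lrcorner> \<phi>) \<and> \<phi>\<close> of degree 7.
\<close>

section \<open>Skew functions on lists\<close>

text \<open>The induced metric, volume form, dual 4-form and torsion rest on \<open>SOME\<close>
  choices, and tensors carry meaning only on lists of the right length, so nothing can be read off
  from their definitions directly. At each point one frame is exhibited in which the 3-form has the
  model components; a uniqueness lemma then identifies every chosen object on lists of the right
  length. Tensor identities are compared on frame vectors, skew ones on increasing indices only,
  which leaves finite checks. To treat \<open>\<phi>b\<close> and \<open>\<phi>\<close> by one
  computation, the cone is studied for an arbitrary unit phase z(r); \<open>\<phi>b\<close> is the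
  phase 1. The phase is absorbed into the frame: turning its last complex direction makes z \<Omega>
  equal to 1 on the three even frame vectors, so every phase leads to the same components. For
  \<open>\<phi>\<close> the derivative \<alpha> = -2 (f a' - a f') contains no division; f \<noteq>
  0 enters only when f a' - a f' is rewritten as a' / f.\<close>

definition skew :: "nat \<Rightarrow> ('a list \<Rightarrow> 'b::real_vector) \<Rightarrow> bool" where
  "skew k F \<longleftrightarrow>
     (\<forall>xs x y zs. length (xs @ x # y # zs) = k \<longrightarrow> F (xs @ x # y # zs) = - F (xs @ y # x # zs))"

lemma skewD: "skew k F \<Longrightarrow> length (xs @ x # y # zs) = k \<Longrightarrow> F (xs @ x # y # zs) = - F (xs @ y # x # zs)"
  unfolding skew_def by blast

lemma skew_move:
  assumes "skew k F" "length (xs @ x # ys @ zs) = k"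
  shows "F (xs @ x # ys @ zs) = (- 1) ^ length ys *\<^sub>R F (xs @ ys @ x # zs)"
  using assms(2)
proof (induction ys arbitrary: xs)
  case (Cons y ys)
  have "F (xs @ x # y # ys @ zs) = - F ((xs @ [y]) @ x # ys @ zs)"
    using skewD[OF assms(1), of xs x y "ys @ zs"] Cons.prems by simp
  also have "F ((xs @ [y]) @ x # ys @ zs) = (- 1) ^ length ys *\<^sub>R F ((xs @ [y]) @ ys @ x # zs)"
    by (rule Cons.IH) (use Cons.prems in simp)
  finally show ?case by simp
qed simp

lemma skew_swap:
  assumes "skew k F" "length (xs @ x # ys @ y # zs) = k"
  shows "F (xs @ x # ys @ y # zs) = - F (xs @ y # ys @ x # zs)"
proof -
  have "F (xs @ x # ys @ y # zs) = (- 1) ^ length (ys @ [y]) *\<^sub>R F (xs @ (ys @ [y]) @ x # zs)"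
    using skew_move[OF assms(1), of xs x "ys @ [y]" zs] assms(2) by simp
  moreover have "F (xs @ y # ys @ x # zs) = (- 1) ^ length ys *\<^sub>R F (xs @ ys @ y # x # zs)"
    using skew_move[OF assms(1), of xs y "ys" "x # zs"] assms(2) by simp
  ultimately show ?thesis by simp
qed

lemma skew_not_distinct:
  assumes "skew k F" "length vs = k" "\<not> distinct vs"
  shows "F vs = 0"
proof -
  obtain xs y ys zs where "vs = xs @ [y] @ ys @ [y] @ zs"
    using not_distinct_decomp[OF assms(3)] by blast
  with skew_swap[OF assms(1), of xs y ys y zs] assms(2) have "F vs = - F vs" by simp
  then have "F vs + F vs = 0" by (metis add.left_inverse)
  then have "(2::real) *\<^sub>R F vs = 0" by (simp only: scaleR_2)
  then show ?thesis by simp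
qed

text \<open>Sorting the arguments changes both functions by the same sign, and a repeated argument
  makes both vanish, so only strictly increasing lists remain to be compared.\<close>

lemma skew_eqI:
  fixes F G :: "'a::linorder list \<Rightarrow> 'b::real_vector"
  assumes "skew k F" "skew k G"
    and "\<And>vs. length vs = k \<Longrightarrow> set vs \<subseteq> A \<Longrightarrow> sorted vs \<Longrightarrow> distinct vs \<Longrightarrow> F vs = G vs"
    and "length vs = k" "set vs \<subseteq> A"
  shows "F vs = G vs"
proof (cases "distinct vs")
  case False
  then show ?thesis using skew_not_distinct assms by metis
next
  case True
  \<comment> \<open>Sorting is undone from the front: the head \<open>w\<close> is pulled out of its
    place in the sorted list, joins the prefix \<open>xs\<close>, and the induction hypothesis
    unsorts the tail.\<close>
  have sort: "F (xs @ ws) = G (xs @ ws)"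
    if "F (xs @ sort ws) = G (xs @ sort ws)" "length (xs @ ws) = k" for xs ws
    using that
  proof (induction ws arbitrary: xs)
    case (Cons w ws)
    obtain ys zs where s: "sort ws = ys @ zs" "insort w (sort ws) = ys @ w # zs"
    proof -
      have "insort w l = takeWhile (\<lambda>x. \<not> w \<le> x) l @ w # dropWhile (\<lambda>x. \<not> w \<le> x) l" for l :: "'a list"
        by (induction l) auto
      then show ?thesis
        using that[of "takeWhile (\<lambda>x. \<not> w \<le> x) (sort ws)" "dropWhile (\<lambda>x. \<not> w \<le> x) (sort ws)"] by simp
    qed
    have len: "length (xs @ w # ys @ zs) = k"
      using Cons.prems(2) s(1) by (metis length_Cons length_append length_sort)
    have "F (xs @ w # ys @ zs) = G (xs @ w # ys @ zs)"
      using skew_move[OF assms(1) len] skew_move[OF assms(2) len] Cons.prems(1) s(2) by simp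
    then have "F ((xs @ [w]) @ sort ws) = G ((xs @ [w]) @ sort ws)"
      using s(1) by simp
    then have "F ((xs @ [w]) @ ws) = G ((xs @ [w]) @ ws)"
      by (rule Cons.IH) (use Cons.prems in simp)
    then show ?case by simp
  qed simp
  have "F (sort vs) = G (sort vs)"
    using assms(3)[of "sort vs"] assms(4,5) True by simp
  then show ?thesis using sort[of "[]" vs] assms(4) by simp
qed

lemma sorted_distinct_full:
  fixes vs :: "nat list"
  assumes "length vs = n" "set vs \<subseteq> {..<n}" "sorted vs" "distinct vs"
  shows "vs = [0..<n]"
proof (rule sorted_distinct_set_unique)
  show "set vs = set [0..<n]"
    using assms card_subset_eq[of "{..<n}" "set vs"] distinct_card[of vs] by (auto simp: atLeast0LessThan)
qed (use assms in auto)

subsection \<open>The sign of a list of indices\<close>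

text \<open>The Levi-Civita symbol as a recursion on lists: 1 on increasing lists, 0 as soon as an
  entry repeats. Unlike \<open>sign\<close> it can be evaluated and is defined on arbitrary index
  lists, not only on permutations.\<close>

primrec eps :: "nat list \<Rightarrow> int" where
  "eps [] = 1"
| "eps (x # xs) = prod_list (map (\<lambda>y. sgn (int y - int x)) xs) * eps xs"

lemma eps_swap: "eps (xs @ x # y # zs) = - eps (xs @ y # x # zs)"
proof (induction xs)
  case Nil
  have "sgn (int y - int x) = - sgn (int x - int y)"
    by (simp add: sgn_if)
  then show ?case by (simp add: algebra_simps)
qed (simp add: algebra_simps)

lemma skew_eps: "skew k (\<lambda>js. of_int (eps js) :: 'a::real_algebra_1)"
  unfolding skew_def using eps_swap by (metis of_int_minus)

text \<open>Exchanging two blocks costs one transposition for each pair of entries taken from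
  different blocks.\<close>

lemma eps_append: "eps (xs @ ys) = (- 1) ^ (length xs * length ys) * eps (ys @ xs)"
proof (induction xs arbitrary: ys)
  case (Cons x xs)
  have "real_of_int (eps (x # xs @ ys)) = (- 1) ^ length (xs @ ys) * real_of_int (eps ((xs @ ys) @ [x]))"
    using skew_move[OF skew_eps[where 'a=real], of "[]" x "xs @ ys" "[]"] by simp
  then have "real_of_int (eps (x # xs @ ys)) = real_of_int ((- 1) ^ length (xs @ ys) * eps (xs @ ys @ [x]))"
    by simp
  then have "eps (x # xs @ ys) = (- 1) ^ length (xs @ ys) * eps (xs @ ys @ [x])"
    by (simp only: of_int_eq_iff)
  also have "eps (xs @ ys @ [x]) = (- 1) ^ (length xs * length (ys @ [x])) * eps (ys @ x # xs)"
    using Cons[of "ys @ [x]"] by simp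
  finally show ?case
    by (simp add: power_add[symmetric] mult.assoc[symmetric] minus_one_power_iff)
qed simp

lemma eps_not_distinct: "\<not> distinct js \<Longrightarrow> eps js = 0"
  using skew_not_distinct[OF skew_eps[where 'a=real], of js] by simp

lemma eps_upt: "eps [a..<b] = 1"
proof (induction "b - a" arbitrary: a)
  case (Suc d)
  then have "[a..<b] = a # [Suc a..<b]" by (simp add: upt_conv_Cons)
  moreover have "prod_list (map (\<lambda>y. sgn (int y - int a)) [Suc a..<b]) = 1"
  proof -
    have "map (\<lambda>y. sgn (int y - int a)) [Suc a..<b] = map (\<lambda>y. 1) [Suc a..<b]" by simp
    moreover have "prod_list (map (\<lambda>y. 1::int) l) = 1" for l :: "nat list" by (induction l) auto
    ultimately show ?thesis by metis
  qed
  ultimately show ?case using Suc by simp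
qed simp

text \<open>Composing \<open>p\<close> on the right with a transposition makes two entries of the
  list trade places, so both sides change sign; the identity gives the increasing list.\<close>

lemma eps_permutes:
  assumes "p permutes {..<n}"
  shows "eps (map p [0..<n]) = sign p"
  using finite_lessThan assms
proof (induction rule: permutes_rev_induct)
  case id
  then show ?case using eps_upt by simp
next
  case (swap a b p)
  have *: "eps (map (p \<circ> Transposition.transpose a b) [0..<n]) = - eps (map p [0..<n])"
    if "a < b" "b < n" for a b
  proof -
    let ?A = "map p [0..<a]" and ?B = "map p [Suc a..<b]" and ?C = "map p [Suc b..<n]"
    let ?t = "Transposition.transpose a b"
    have e: "[0..<n] = [0..<a] @ a # [Suc a..<b] @ b # [Suc b..<n]"
    proof -
      have "[0..<n] = [0..<a] @ [a..<n]" using upt_add_eq_append[of 0 a "n - a"] that by simp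
      also have "[a..<n] = a # [Suc a..<n]" using that by (intro upt_conv_Cons) simp
      also have "[Suc a..<n] = [Suc a..<b] @ [b..<n]" using upt_add_eq_append[of "Suc a" b "n - b"] that by simp
      also have "[b..<n] = b # [Suc b..<n]" using that by (intro upt_conv_Cons) simp
      finally show ?thesis .
    qed
    have "map (p \<circ> ?t) [0..<a] = ?A" "map (p \<circ> ?t) [Suc a..<b] = ?B" "map (p \<circ> ?t) [Suc b..<n] = ?C"
      using that by (auto simp: Transposition.transpose_def)
    then have "map (p \<circ> ?t) [0..<n] = ?A @ p b # ?B @ p a # ?C"
      unfolding e by simp
    moreover have "map p [0..<n] = ?A @ p a # ?B @ p b # ?C" unfolding e by simp
    ultimately show ?thesis
      using skew_swap[OF skew_eps[where 'a=real], of ?A "p b" ?B "p a" ?C] by simp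
  qed
  have "eps (map (p \<circ> Transposition.transpose a b) [0..<n]) = - eps (map p [0..<n])"
    using *[of a b] *[of b a] swap.hyps by (cases "a < b") (auto simp: transpose_commute)
  moreover have "sign (p \<circ> Transposition.transpose a b) = - sign p"
    using swap.hyps by (subst sign_compose)
      (auto simp: sign_swap_id permutation_swap_id permutes_imp_permutation[OF finite_lessThan])
  ultimately show ?case by (simp only: swap.IH)
qed

lemma sum_permutes:
  fixes G :: "nat list \<Rightarrow> 'a::ring_1"
  shows "(\<Sum>p | p permutes {..<n}. of_int (sign p) * G (map p [0..<n])) =
    (\<Sum>js\<in>permutations_of_set {..<n}. of_int (eps js) * G js)"
proof -
  have bij: "bij_betw (\<lambda>p. map p [0..<n]) {p. p permutes {..<n}} (permutations_of_set {..<n})"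
  proof (rule bij_betw_byWitness[where f' = "\<lambda>js i. if i < n then js ! i else i"])
    show "\<forall>p\<in>{p. p permutes {..<n}}. (\<lambda>i. if i < n then map p [0..<n] ! i else i) = p"
      by (auto simp: fun_eq_iff permutes_not_in)
    show "\<forall>js\<in>permutations_of_set {..<n}. map (\<lambda>i. if i < n then js ! i else i) [0..<n] = js"
      by (intro ballI nth_equalityI) (auto dest: length_finite_permutations_of_set)
    show "(\<lambda>p. map p [0..<n]) ` {p. p permutes {..<n}} \<subseteq> permutations_of_set {..<n}"
    proof safe
      fix p assume p: "p permutes {..<n}"
      have "set (map p [0..<n]) = {..<n}" using permutes_image[OF p] by (simp add: atLeast0LessThan)
      moreover have "distinct (map p [0..<n])" using permutes_inj_on[OF p] by (simp add: distinct_map)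
      ultimately show "map p [0..<n] \<in> permutations_of_set {..<n}" by (rule permutations_of_setI)
    qed
    show "(\<lambda>js i. if i < n then js ! i else i) ` permutations_of_set {..<n} \<subseteq> {p. p permutes {..<n}}"
    proof safe
      fix js assume js: "js \<in> permutations_of_set {..<n}"
      have l: "length js = n" using js length_finite_permutations_of_set by force
      have s: "set js = {..<n}" "distinct js" using js by (auto simp: permutations_of_set_def)
      have b: "bij_betw ((!) js) {..<n} {..<n}"
        by (rule bij_betw_nth) (use s l in auto)
      have "bij_betw (\<lambda>i. if i < n then js ! i else i) {..<n} {..<n} = bij_betw ((!) js) {..<n} {..<n}"
        by (rule bij_betw_cong) simp
      with b have "bij_betw (\<lambda>i. if i < n then js ! i else i) {..<n} {..<n}" by blast
      then show "(\<lambda>i. if i < n then js ! i else i) permutes {..<n}"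
        by (rule bij_imp_permutes) auto
    qed
  qed
  have "(\<Sum>p | p permutes {..<n}. of_int (sign p) * G (map p [0..<n])) =
    (\<Sum>p | p permutes {..<n}. of_int (eps (map p [0..<n])) * G (map p [0..<n]))"
    by (rule sum.cong) (auto simp: eps_permutes)
  also have "\<dots> = (\<Sum>js\<in>permutations_of_set {..<n}. of_int (eps js) * G js)"
    by (rule sum.reindex_bij_betw[OF bij])
  finally show ?thesis .
qed

text \<open>Replaces a sum over functions by a sum over an explicit list of permutations, which
  rewriting and evaluation can run through.\<close>

lemma sum_permutes_list:
  fixes G :: "nat list \<Rightarrow> 'a::ring_1"
  shows "(\<Sum>p | p permutes {..<n}. of_int (sign p) * G (map p [0..<n])) =
    sum_list (map (\<lambda>js. of_int (eps js) * G js) (permutations_of_set_list [0..<n]))"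
proof -
  have "permutations_of_set {..<n} = set (permutations_of_set_list [0..<n])"
    using permutations_of_list[of "[0..<n]"] by (simp add: atLeast0LessThan distinct_remdups_id)
  then show ?thesis
    by (simp add: sum_permutes sum_list_distinct_conv_sum_set distinct_permutations_of_set_list)
qed

lemma wedge_list:
  "wedge k l \<alpha> \<beta> vs =
     sum_list (map (\<lambda>js. of_int (eps js) * (\<alpha> (map ((!) vs) (take k js)) * \<beta> (map ((!) vs) (drop k js))))
       (permutations_of_set_list [0..<k + l])) / (fact k * fact l)"
proof -
  have 1: "map ((!) vs) (take k (map p [0..<k + l])) = map (\<lambda>n. vs ! p n) [0..<k]"
    "map ((!) vs) (drop k (map p [0..<k + l])) = map (\<lambda>n. vs ! p n) [k..<k + l]" for p
    by (auto simp: take_map drop_map)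
  show ?thesis
    unfolding wedge_def
    by (subst sum_permutes_list[symmetric]) (simp only: 1 mult.assoc)
qed

text \<open>The six permutations agree in pairs because \<beta> is skew; the division by 2! removes
  this doubling.\<close>

lemma wedge_1_2:
  assumes "\<And>u v. \<beta> [v, u] = - \<beta> [u, v]"
  shows "wedge 1 2 \<alpha> \<beta> [u, v, w] = \<alpha> [u] * \<beta> [v, w] + \<alpha> [v] * \<beta> [w, u] + \<alpha> [w] * \<beta> [u, v]"
  unfolding wedge_list
  using assms[of w v] assms[of u w] assms[of v u]
  by (simp add: permutations_of_set_list_def permutations_of_set_aux_list.simps upt_rec eval_nat_numeral field_simps)

text \<open>After division by 2! 2! six of the 24 terms remain. Exchanging the two factors
  identifies them in pairs, whence three terms and the factor 2.\<close>

lemma wedge_2_2: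
  assumes "\<And>u v. \<omega> [v, u] = - \<omega> [u, v]"
  shows "wedge 2 2 \<omega> \<omega> [u, v, w, z] =
    2 * (\<omega> [u, v] * \<omega> [w, z] - \<omega> [u, w] * \<omega> [v, z] + \<omega> [u, z] * \<omega> [v, w])"
  unfolding wedge_list
  using assms[of v u] assms[of w u] assms[of z u] assms[of w v] assms[of z v] assms[of z w]
  by (simp add: permutations_of_set_list_def permutations_of_set_aux_list.simps upt_rec eval_nat_numeral field_simps)

section \<open>Multilinear algebra\<close>

lemma multilinear_linear:
  assumes "multilinear k t" "length (xs @ v # ys) = k"
  shows "linear (\<lambda>v. t (xs @ v # ys))"
proof -
  have "linear (\<lambda>v. t ((xs @ undefined # ys)[length xs := v]))"
    using assms(1)[unfolded multilinear_def, rule_format, of "xs @ undefined # ys" "length xs"] assms(2) by simp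
  then show ?thesis by simp
qed

lemma multilinearI:
  assumes "\<And>xs ys. Suc (length xs + length ys) = k \<Longrightarrow> linear (\<lambda>v. t (xs @ v # ys))"
  shows "multilinear k t"
  unfolding multilinear_def
proof safe
  fix vs :: "'a list" and i assume i: "i < length vs" "k = length vs"
  have "vs[i := v] = take i vs @ v # drop (Suc i) vs" for v
    by (rule upd_conv_take_nth_drop[OF i(1)])
  then show "linear (\<lambda>v. t (vs[i := v]))"
    using assms[of "take i vs" "drop (Suc i) vs"] i by simp
qed

lemma multilinear_2: "multilinear 2 t \<longleftrightarrow> (\<forall>v. linear (\<lambda>u. t [u, v])) \<and> (\<forall>u. linear (\<lambda>v. t [u, v]))"
proof safe
  assume *: "(\<forall>v. linear (\<lambda>u. t [u, v]))" "(\<forall>u. linear (\<lambda>v. t [u, v]))"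
  show "multilinear 2 t"
  proof (rule multilinearI)
    fix xs ys :: "'a list" assume "Suc (length xs + length ys) = 2"
    then consider a where "xs = []" "ys = [a]" | a where "xs = [a]" "ys = []"
      by (cases xs; cases ys) (auto simp: length_Suc_conv)
    then show "linear (\<lambda>v. t (xs @ v # ys))" by cases (simp_all add: *)
  qed
next
  assume *: "multilinear 2 t"
  show "linear (\<lambda>u. t [u, v])" for v using multilinear_linear[OF *, of "[]" _ "[v]"] by simp
  show "linear (\<lambda>v. t [u, v])" for u using multilinear_linear[OF *, of "[u]" _ "[]"] by simp
qed

lemma multilinear_3: "multilinear 3 t \<longleftrightarrow>
  (\<forall>v w. linear (\<lambda>u. t [u, v, w])) \<and> (\<forall>u w. linear (\<lambda>v. t [u, v, w])) \<and> (\<forall>u v. linear (\<lambda>w. t [u, v, w]))"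
proof safe
  assume *: "(\<forall>v w. linear (\<lambda>u. t [u, v, w]))" "(\<forall>u w. linear (\<lambda>v. t [u, v, w]))" "(\<forall>u v. linear (\<lambda>w. t [u, v, w]))"
  show "multilinear 3 t"
  proof (rule multilinearI)
    fix xs ys :: "'a list" assume "Suc (length xs + length ys) = 3"
    then consider a b where "xs = []" "ys = [a, b]" | a b where "xs = [a]" "ys = [b]" | a b where "xs = [a, b]" "ys = []"
      by (cases xs; cases ys; cases "tl xs"; cases "tl ys") simp_all
    then show "linear (\<lambda>v. t (xs @ v # ys))" by cases (simp_all add: *)
  qed
next
  assume *: "multilinear 3 t"
  show "linear (\<lambda>u. t [u, v, w])" for v w using multilinear_linear[OF *, of "[]" _ "[v, w]"] by simp
  show "linear (\<lambda>v. t [u, v, w])" for u w using multilinear_linear[OF *, of "[u]" _ "[w]"] by simp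
  show "linear (\<lambda>w. t [u, v, w])" for u v using multilinear_linear[OF *, of "[u, v]" _ "[]"] by simp
qed

lemma multilinear_Cons: "multilinear (Suc k) t \<Longrightarrow> multilinear k (\<lambda>vs. t (v # vs))"
proof (rule multilinearI)
  fix xs ys :: "'a list" assume "multilinear (Suc k) t" "Suc (length xs + length ys) = k"
  then show "linear (\<lambda>w. t (v # xs @ w # ys))"
    using multilinear_linear[of "Suc k" t "v # xs" _ ys] by simp
qed

lemma multilinear_hd: "multilinear (Suc k) t \<Longrightarrow> length vs = k \<Longrightarrow> linear (\<lambda>v. t (v # vs))"
  using multilinear_linear[of "Suc k" t "[]" _ vs] by simp

lemma multilinear_scaleR: "multilinear k t \<Longrightarrow> multilinear k (\<lambda>vs. c *\<^sub>R t vs)"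
  by (rule multilinearI, rule linear_compose_scale_right, rule multilinear_linear, assumption, simp)

lemma multilinear_mult: "multilinear k (t :: ('e::real_vector, real) tensor) \<Longrightarrow> multilinear k (\<lambda>vs. c * t vs)"
  using multilinear_scaleR[of k t c] by simp

lemma alternating_skew:
  fixes t :: "('e::real_vector, 'a::real_vector) tensor"
  assumes "multilinear k t" "alternating k t"
  shows "skew k t"
  unfolding skew_def
proof safe
  fix xs zs :: "'e list" and x y assume len: "k = length (xs @ x # y # zs)"
  have alt: "t (xs @ v # v # zs) = 0" for v
  proof -
    have "(xs @ v # v # zs) ! length xs = (xs @ v # v # zs) ! Suc (length xs)"
      by (simp add: nth_append)
    then show ?thesis
      using assms(2)[unfolded alternating_def, rule_format, of "xs @ v # v # zs" "length xs" "Suc (length xs)"] len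
      by simp
  qed
  have lin1: "linear (\<lambda>u. t (xs @ u # v # zs))" for v
    using multilinear_linear[OF assms(1), of xs _ "v # zs"] len by simp
  have lin2: "linear (\<lambda>v. t (xs @ u # v # zs))" for u
    using multilinear_linear[OF assms(1), of "xs @ [u]" _ "zs"] len by simp
  have "0 = t (xs @ (x + y) # (x + y) # zs)" using alt by simp
  also have "\<dots> = t (xs @ x # y # zs) + t (xs @ y # x # zs)"
    unfolding linear_add[OF lin1] linear_add[OF lin2] using alt by simp
  finally show "t (xs @ x # y # zs) = - t (xs @ y # x # zs)"
    by (metis add_eq_0_iff2)
qed

lemma skew_alternating:
  fixes t :: "('e, 'a::real_vector) tensor"
  assumes "skew k t" shows "alternating k t"
  unfolding alternating_def
proof safe
  fix vs :: "'e list" and i j assume "k = length vs" "i < j" "j < length vs" "vs ! i = vs ! j"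
  moreover from this have "\<not> distinct vs" by (metis nth_eq_iff_index_eq less_irrefl order.strict_trans)
  ultimately show "t vs = 0" using skew_not_distinct[OF assms] by blast
qed

lemma skew_map:
  fixes h :: "'b \<Rightarrow> 'a"
  assumes "skew k F" shows "skew k (\<lambda>js. F (map h js))"
  unfolding skew_def
proof (intro allI impI)
  fix xs zs :: "'b list" and x y assume "length (xs @ x # y # zs) = k"
  then show "F (map h (xs @ x # y # zs)) = - F (map h (xs @ y # x # zs))"
    using skewD[OF assms, of "map h xs" "h x" "h y" "map h zs"] by simp
qed

text \<open>The arguments are replaced by frame vectors one slot at a time, from the front, by
  linearity in the first slot. This turns tensor identities into identities between
  components.\<close>

lemma multilinear_eqI:
  fixes s t :: "('e::real_vector, 'a::real_vector) tensor"
  assumes "multilinear k s" "multilinear k t" "span (set E) = UNIV"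
    and "\<And>js. length js = k \<Longrightarrow> set js \<subseteq> {..<length E} \<Longrightarrow> s (map ((!) E) js) = t (map ((!) E) js)"
    and "length vs = k"
  shows "s vs = t vs"
  using assms(1,2,4,5)
proof (induction k arbitrary: s t vs)
  case (Suc k)
  obtain v ws where vs: "vs = v # ws" "length ws = k" using Suc.prems(4) by (cases vs) auto
  have on_frame: "s (e # ws) = t (e # ws)" if e: "e \<in> set E" for e
  proof -
    obtain i where i: "i < length E" "e = E ! i" using e by (metis in_set_conv_nth)
    show ?thesis
    proof (rule Suc.IH[of "\<lambda>vs. s (e # vs)" "\<lambda>vs. t (e # vs)",
          OF multilinear_Cons[OF Suc.prems(1)] multilinear_Cons[OF Suc.prems(2)] _ vs(2)])
      fix js assume "length js = k" "set js \<subseteq> {..<length E}"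
      then have "s (map ((!) E) (i # js)) = t (map ((!) E) (i # js))"
        using i(1) by (intro Suc.prems(3)) simp_all
      then show "s (e # map ((!) E) js) = t (e # map ((!) E) js)"
        unfolding i(2) by simp
    qed
  qed
  have "v \<in> span (set E)" using assms(3) by blast
  from linear_eq_on_span[OF multilinear_hd[OF Suc.prems(1) vs(2)] multilinear_hd[OF Suc.prems(2) vs(2)] on_frame this]
  show ?case unfolding vs(1) by simp
qed simp

lemma alternating_eqI:
  fixes s t :: "('e::real_vector, 'a::real_vector) tensor"
  assumes "multilinear k s" "multilinear k t" "skew k s" "skew k t" "span (set E) = UNIV"
    and "\<And>js. length js = k \<Longrightarrow> set js \<subseteq> {..<length E} \<Longrightarrow> sorted js \<Longrightarrow> distinct js \<Longrightarrow>
           s (map ((!) E) js) = t (map ((!) E) js)"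
    and "length vs = k"
  shows "s vs = t vs"
  by (rule multilinear_eqI[OF assms(1,2,5) _ assms(7)])
    (rule skew_eqI[where A = "{..<length E}", OF skew_map[OF assms(3)] skew_map[OF assms(4)]]; use assms(6) in blast)

text \<open>The antisymmetrizer without the factor 1/k!. It produces the volume form and the
  invariant of degree 7 that recovers the metric.\<close>

definition alternation :: "nat \<Rightarrow> ('e, real) tensor \<Rightarrow> ('e, real) tensor" where
  "alternation k t vs = (\<Sum>p | p permutes {..<k}. of_int (sign p) * t (map ((!) vs) (map p [0..<k])))"

text \<open>Composing every permutation with the transposition of the two equal slots only reorders
  the sum; it reverses each sign and leaves the arguments unchanged, so the sum equals its
  negative.\<close>

lemma alternation_alternating: "alternating k (alternation k t)"
  unfolding alternating_def
proof (intro allI impI, elim conjE)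
  fix vs :: "'a list" and i j assume ij: "length vs = k" "i < j" "j < k" "vs ! i = vs ! j"
  let ?s = "Transposition.transpose i j"
  let ?f = "\<lambda>p. of_int (sign p) * t (map ((!) vs) (map p [0..<k]))"
  have s: "?s permutes {..<k}" by (rule permutes_swap_id) (use ij in auto)
  have "alternation k t vs = (\<Sum>p | p permutes {..<k}. ?f (?s \<circ> p))"
    unfolding alternation_def by (rule setum_permutations_compose_left[OF s])
  also have "\<dots> = (\<Sum>p | p permutes {..<k}. - ?f p)"
  proof (rule sum.cong, simp)
    fix p assume "p \<in> {p. p permutes {..<k}}"
    then have p: "p permutes {..<k}" by simp
    have "sign (?s \<circ> p) = - sign p"
      using p ij(2) by (subst sign_compose)
        (auto simp: sign_swap_id permutation_swap_id permutes_imp_permutation[OF finite_lessThan])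
    moreover have "(!) vs \<circ> (?s \<circ> p) = (!) vs \<circ> p"
      using ij(4) by (auto simp: Transposition.transpose_def)
    ultimately show "?f (?s \<circ> p) = - ?f p" by simp
  qed
  also have "\<dots> = - alternation k t vs" unfolding alternation_def by (rule sum_negf)
  finally show "alternation k t vs = 0" by simp
qed

lemma alternation_multilinear:
  assumes "multilinear k t" shows "multilinear k (alternation k t)"
  unfolding multilinear_def
proof (intro allI impI, elim conjE)
  fix vs :: "'a list" and i assume i: "length vs = k" "i < k"
  have "linear (\<lambda>v. of_int (sign p) * t (map ((!) (vs[i := v])) (map p [0..<k])))" if p: "p permutes {..<k}" for p
  proof -
    have q: "inv p permutes {..<k}" using permutes_inv[OF p] .
    have "map ((!) (vs[i := v])) (map p [0..<k]) = (map ((!) vs) (map p [0..<k]))[inv p i := v]" for v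
    proof (rule nth_equalityI)
      fix n assume "n < length (map ((!) (vs[i := v])) (map p [0..<k]))"
      then have n: "n < k" by simp
      have "(p n = i) = (n = inv p i)" using permutes_inverses[OF p] by metis
      then show "map ((!) (vs[i := v])) (map p [0..<k]) ! n = (map ((!) vs) (map p [0..<k]))[inv p i := v] ! n"
        using n i by (auto simp: nth_list_update)
    qed simp
    moreover have "linear (\<lambda>v. t ((map ((!) vs) (map p [0..<k]))[inv p i := v]))"
      using assms[unfolded multilinear_def, rule_format, of "map ((!) vs) (map p [0..<k])" "inv p i"]
        i permutes_in_image[OF q, of i] by simp
    ultimately have "linear (\<lambda>v. t (map ((!) (vs[i := v])) (map p [0..<k])))" by simp
    from linear_compose_scale_right[OF this, of "of_int (sign p)"] show ?thesis by simp
  qed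
  then show "linear (\<lambda>v. alternation k t (vs[i := v]))"
    unfolding alternation_def by (intro linear_compose_sum) auto
qed

section \<open>Inner products and orthonormal frames\<close>

definition orthonormal_list :: "('e, real) tensor \<Rightarrow> 'e list \<Rightarrow> bool" where
  "orthonormal_list m E \<longleftrightarrow> (\<forall>i<length E. \<forall>j<length E. m [E ! i, E ! j] = (if i = j then 1 else 0))"

lemma orthonormal_frame_iff:
  "orthonormal_frame m E \<longleftrightarrow> length E = DIM('e::euclidean_space) \<and> orthonormal_list m (E :: 'e list)"
  unfolding orthonormal_frame_def orthonormal_list_def by auto

lemma orthonormal_distinct: "orthonormal_list m E \<Longrightarrow> distinct E"
  unfolding orthonormal_list_def distinct_conv_nth by (metis zero_neq_one)

lemma orthonormal_independent:
  assumes "multilinear 2 m" "orthonormal_list m E"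
  shows "independent (set E)"
proof
  assume "dependent (set E)"
  then obtain u v where uv: "v \<in> set E" "u v \<noteq> 0" "(\<Sum>v\<in>set E. u v *\<^sub>R v) = 0"
    using dependent_finite[of "set E"] by auto
  obtain i where i: "i < length E" "v = E ! i" using uv(1) by (metis in_set_conv_nth)
  have lin: "linear (\<lambda>w. m [v, w])" using assms(1) multilinear_2 by blast
  have "0 = m [v, \<Sum>v\<in>set E. u v *\<^sub>R v]" using linear_0[OF lin] uv(3) by simp
  also have "\<dots> = (\<Sum>w\<in>set E. u w * m [v, w])"
    by (simp add: linear_sum[OF lin] linear_cmul[OF lin])
  also have "\<dots> = (\<Sum>w\<in>set E. if w = v then u v else 0)"
  proof (rule sum.cong)
    fix w assume "w \<in> set E"
    then obtain j where "j < length E" "w = E ! j" by (metis in_set_conv_nth)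
    then show "u w * m [v, w] = (if w = v then u v else 0)"
      using assms(2) orthonormal_distinct[OF assms(2)] i
      by (auto simp: orthonormal_list_def nth_eq_iff_index_eq)
  qed simp
  also have "\<dots> = u v" using uv(1) by simp
  finally show False using uv(2) by simp
qed

lemma orthonormal_frame_span:
  fixes E :: "'e::euclidean_space list"
  assumes "multilinear 2 m" "orthonormal_frame m E"
  shows "span (set E) = UNIV"
proof -
  have o: "orthonormal_list m E" "length E = DIM('e)" using assms(2) orthonormal_frame_iff by auto
  have "card (set E) = DIM('e)" using distinct_card[OF orthonormal_distinct[OF o(1)]] o(2) by simp
  then show ?thesis
    using card_ge_dim_independent[of "set E" UNIV] orthonormal_independent[OF assms(1) o(1)] by auto
qed

lemma linear_scaleR_left: "linear l \<Longrightarrow> linear (\<lambda>v. l v *\<^sub>R c)"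
  by (rule linearI) (simp_all add: linear_add linear_cmul scaleR_add_left)

lemma orthonormal_frame_expand:
  fixes E :: "'e::euclidean_space list"
  assumes "multilinear 2 m" "orthonormal_frame m E"
  shows "v = (\<Sum>i<DIM('e). m [E ! i, v] *\<^sub>R E ! i)"
proof -
  have lin: "linear (\<lambda>v. m [e, v])" for e using assms(1) multilinear_2 by blast
  have "linear (\<lambda>v. \<Sum>i<DIM('e). m [E ! i, v] *\<^sub>R E ! i)"
    by (intro linear_compose_sum ballI linear_scaleR_left lin)
  moreover have "id e = (\<Sum>i<DIM('e). m [E ! i, e] *\<^sub>R E ! i)" if e: "e \<in> set E" for e
  proof -
    obtain j where j: "j < DIM('e)" "e = E ! j"
      using e assms(2) unfolding orthonormal_frame_def in_set_conv_nth by metis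
    have "(\<Sum>i<DIM('e). m [E ! i, e] *\<^sub>R E ! i) = (\<Sum>i<DIM('e). if i = j then E ! j else 0)"
      by (rule sum.cong) (use assms(2) j(1) in \<open>auto simp: orthonormal_frame_def j(2)\<close>)
    also have "\<dots> = E ! j" using j(1) by simp
    finally show ?thesis unfolding j(2) by simp
  qed
  moreover have "v \<in> span (set E)" using orthonormal_frame_span[OF assms] by blast
  ultimately have "id v = (\<Sum>i<DIM('e). m [E ! i, v] *\<^sub>R E ! i)"
    by (rule linear_eq_on_span[OF linear_id])
  then show ?thesis by simp
qed

lemma orthonormal_frame_inner_product:
  fixes E :: "'e::euclidean_space list"
  assumes "multilinear 2 m" "orthonormal_frame m E"
  shows "inner_product m" "m [u, v] = (\<Sum>i<DIM('e). m [E ! i, u] * m [E ! i, v])"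
proof -
  have lin: "linear (\<lambda>u. m [u, e])" for e using assms(1) multilinear_2 by blast
  have *: "m [u, v] = (\<Sum>i<DIM('e). m [E ! i, u] * m [E ! i, v])" for u v
    by (subst orthonormal_frame_expand[OF assms, of u])
      (simp add: linear_sum[OF lin] linear_cmul[OF lin])
  then show "m [u, v] = (\<Sum>i<DIM('e). m [E ! i, u] * m [E ! i, v])" .
  have "m [v, v] > 0" if "v \<noteq> 0" for v
  proof -
    have "\<exists>i<DIM('e). m [E ! i, v] \<noteq> 0"
      using orthonormal_frame_expand[OF assms, of v] that by (metis (no_types, lifting) lessThan_iff scale_zero_left sum.neutral)
    then show ?thesis
      by (subst *) (auto intro!: sum_pos2 simp: zero_less_mult_iff)
  qed
  moreover have "m [u, v] = m [v, u]" for u v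
    by (subst *[of u], subst *[of v]) (simp add: mult.commute)
  ultimately show "inner_product m" unfolding inner_product_def using assms(1) by blast
qed

lemma inner_product_linear:
  assumes "inner_product m"
  shows "linear (\<lambda>u. m [u, v])" "linear (\<lambda>v. m [u, v])"
  using assms multilinear_2 unfolding inner_product_def by blast+

lemma inner_product_sym: "inner_product m \<Longrightarrow> m [u, v] = m [v, u]"
  unfolding inner_product_def by blast

lemma inner_product_eqI:
  assumes "inner_product m" "\<And>w. m [u, w] = m [v, w]"
  shows "u = v"
proof (rule ccontr)
  assume "u \<noteq> v"
  then have "m [u - v, u - v] > 0" using assms(1) unfolding inner_product_def by simp
  moreover have "m [u - v, u - v] = 0"
    using linear_diff[OF inner_product_linear(1)[OF assms(1)], of u v] assms(2) by simp
  ultimately show False by simp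
qed

text \<open>One Gram-Schmidt step: a list shorter than the dimension does not span, so a vector
  outside its span minus its projection is nonzero and can be normalised.\<close>

lemma orthonormal_extend:
  fixes E :: "'e::euclidean_space list"
  assumes "inner_product m" "orthonormal_list m E" "length E < DIM('e)"
  obtains v where "m [v, v] = 1" "\<And>e. e \<in> set E \<Longrightarrow> m [e, v] = 0"
proof -
  note lin = inner_product_linear[OF assms(1)]
  have "span (set E) \<noteq> UNIV"
    using dim_le_card[of UNIV "set E"] card_length[of E] assms(3) by auto
  then obtain w where w: "w \<notin> span (set E)" by blast
  define v where "v = w - (\<Sum>e\<in>set E. m [e, w] *\<^sub>R e)"
  have "(\<Sum>e\<in>set E. m [e, w] *\<^sub>R e) \<in> span (set E)"
    by (intro span_sum span_scale span_base)
  then have "v \<noteq> 0" using w unfolding v_def by auto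
  then have pos: "m [v, v] > 0" using assms(1) unfolding inner_product_def by blast
  have orth: "m [e, v] = 0" if e: "e \<in> set E" for e
  proof -
    obtain i where i: "i < length E" "e = E ! i" using e by (metis in_set_conv_nth)
    have "m [e, v] = m [e, w] - (\<Sum>d\<in>set E. m [d, w] * m [e, d])"
      unfolding v_def by (simp add: linear_diff[OF lin(2)] linear_sum[OF lin(2)] linear_cmul[OF lin(2)])
    also have "(\<Sum>d\<in>set E. m [d, w] * m [e, d]) = (\<Sum>d\<in>set E. if d = e then m [e, w] else 0)"
    proof (rule sum.cong)
      fix d assume "d \<in> set E"
      then obtain j where "j < length E" "d = E ! j" by (metis in_set_conv_nth)
      then show "m [d, w] * m [e, d] = (if d = e then m [e, w] else 0)"
        using assms(2) orthonormal_distinct[OF assms(2)] i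
        by (auto simp: orthonormal_list_def nth_eq_iff_index_eq)
    qed simp
    finally show ?thesis using e by simp
  qed
  show thesis
  proof (rule that[of "(1 / sqrt (m [v, v])) *\<^sub>R v"])
    show "m [(1 / sqrt (m [v, v])) *\<^sub>R v, (1 / sqrt (m [v, v])) *\<^sub>R v] = 1"
      using pos by (simp add: linear_cmul[OF lin(1)] linear_cmul[OF lin(2)] field_simps)
    show "m [e, (1 / sqrt (m [v, v])) *\<^sub>R v] = 0" if "e \<in> set E" for e
      using orth[OF that] by (simp add: linear_cmul[OF lin(2)])
  qed
qed

lemma orthonormal_snoc:
  assumes "inner_product m" "orthonormal_list m E" "m [v, v] = 1" "\<And>e. e \<in> set E \<Longrightarrow> m [e, v] = 0"
  shows "orthonormal_list m (E @ [v])"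
proof -
  have "m [E ! i, v] = 0" "m [v, E ! i] = 0" if "i < length E" for i
    using assms(4)[OF nth_mem[OF that]] inner_product_sym[OF assms(1), of v "E ! i"] by auto
  then show ?thesis
    using assms(2,3) unfolding orthonormal_list_def by (auto simp: nth_append less_Suc_eq)
qed

lemma orthonormal_frame_exists:
  assumes "inner_product (m :: ('e::euclidean_space, real) tensor)"
  shows "\<exists>E. orthonormal_frame m E"
proof -
  have "\<exists>E. length E = k \<and> orthonormal_list m E" if "k \<le> DIM('e)" for k
    using that
  proof (induction k)
    case 0
    then show ?case by (auto simp: orthonormal_list_def)
  next
    case (Suc k)
    then obtain E where E: "length E = k" "orthonormal_list m E" by auto
    then obtain v where "m [v, v] = 1" "\<And>e. e \<in> set E \<Longrightarrow> m [e, v] = 0"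
      using orthonormal_extend[OF assms E(2)] Suc.prems by auto
    then show ?case using orthonormal_snoc[OF assms E(2)] E(1) by (intro exI[of _ "E @ [v]"]) auto
  qed
  then show ?thesis unfolding orthonormal_frame_iff by blast
qed

subsection \<open>Sums over index lists\<close>

definition index_lists :: "nat \<Rightarrow> nat \<Rightarrow> nat list set" where
  "index_lists n k = {is. length is = k \<and> set is \<subseteq> {..<n}}"

lemma finite_index_lists: "finite (index_lists n k)"
  unfolding index_lists_def using finite_lists_length_eq[of "{..<n}" k] by (simp add: conj_commute)

lemma sum_index_lists_0: "(\<Sum>is\<in>index_lists n 0. f is) = f []"
proof -
  have "index_lists n 0 = {[]}" by (auto simp: index_lists_def)
  then show ?thesis by simp
qed

lemma sum_index_lists_Suc:
  "(\<Sum>is\<in>index_lists n (Suc k). f is) = (\<Sum>i<n. \<Sum>is\<in>index_lists n k. f (i # is))"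
proof -
  have "bij_betw (\<lambda>(i, is). i # is) ({..<n} \<times> index_lists n k) (index_lists n (Suc k))"
    by (rule bij_betw_byWitness[where f' = "\<lambda>is. (hd is, tl is)"])
      (auto simp: length_Suc_conv index_lists_def)
  then have "(\<Sum>is\<in>index_lists n (Suc k). f is) = (\<Sum>(i, is)\<in>{..<n} \<times> index_lists n k. f (i # is))"
    by (subst sum.reindex_bij_betw[symmetric]) (auto simp: case_prod_unfold)
  then show ?thesis by (simp add: sum.cartesian_product)
qed

lemma sum_index_lists_append:
  "(\<Sum>is\<in>index_lists n (j + k). f is) = (\<Sum>as\<in>index_lists n j. \<Sum>bs\<in>index_lists n k. f (as @ bs))"
proof (induction j arbitrary: f)
  case 0
  show ?case by (simp add: sum_index_lists_0)
next
  case (Suc j)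
  then show ?case by (simp add: sum_index_lists_Suc)
qed

text \<open>An index list that is not a permutation repeats an entry and has \<open>eps\<close>
  equal to 0. The enlarged range is a product set and can therefore be split into blocks of
  indices.\<close>

lemma sum_permutes_index_lists:
  fixes G :: "nat list \<Rightarrow> 'a::ring_1"
  shows "(\<Sum>p | p permutes {..<n}. of_int (sign p) * G (map p [0..<n])) =
    (\<Sum>js\<in>index_lists n n. of_int (eps js) * G js)"
  unfolding sum_permutes
proof (rule sum.mono_neutral_left)
  show "permutations_of_set {..<n} \<subseteq> index_lists n n"
    using length_finite_permutations_of_set by (force simp: permutations_of_set_def index_lists_def)
  show "\<forall>js\<in>index_lists n n - permutations_of_set {..<n}. of_int (eps js) * G js = 0"
  proof
    fix js assume js: "js \<in> index_lists n n - permutations_of_set {..<n}"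
    have "\<not> distinct js"
    proof
      assume d: "distinct js"
      have "set js = {..<n}"
        by (rule card_subset_eq) (use js distinct_card[OF d] in \<open>auto simp: index_lists_def\<close>)
      with d js show False by (auto simp: permutations_of_set_def)
    qed
    then show "of_int (eps js) * G js = 0" by (simp add: eps_not_distinct)
  qed
qed (rule finite_index_lists)

subsection \<open>Contractions\<close>

definition contract_frame :: "'e list \<Rightarrow> nat \<Rightarrow> ('e::euclidean_space list \<Rightarrow> real) \<Rightarrow> real" where
  "contract_frame E k B = (\<Sum>is\<in>index_lists DIM('e) k. B (map ((!) E) is))"

lemma contract_frame_0: "contract_frame E 0 B = B []"
  unfolding contract_frame_def sum_index_lists_0 by simp

lemma contract_frame_Suc:
  "contract_frame (E :: 'e::euclidean_space list) (Suc k) B =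
     (\<Sum>i<DIM('e). contract_frame E k (\<lambda>e. B (E ! i # e)))"
  unfolding contract_frame_def sum_index_lists_Suc by simp

text \<open>The coefficients of one orthonormal frame in another form an orthogonal matrix, which
  cancels after exchanging the order of summation.\<close>

lemma bilinear_trace_frame:
  fixes E E' :: "'e::euclidean_space list"
  assumes "multilinear 2 m" "orthonormal_frame m E" "orthonormal_frame m E'"
    and "\<And>v. linear (\<lambda>u. Q u v)" "\<And>u. linear (\<lambda>v. Q u v :: real)"
  shows "(\<Sum>i<DIM('e). Q (E ! i) (E ! i)) = (\<Sum>i<DIM('e). Q (E' ! i) (E' ! i))"
proof -
  let ?I = "{..<DIM('e)}"
  note ip = orthonormal_frame_inner_product[OF assms(1,2)]
  have ex: "Q u v = (\<Sum>j\<in>?I. \<Sum>k\<in>?I. m [E' ! j, u] * m [E' ! k, v] * Q (E' ! j) (E' ! k))" for u v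
  proof -
    have "Q u v = (\<Sum>j\<in>?I. m [E' ! j, u] * Q (E' ! j) v)"
      by (subst orthonormal_frame_expand[OF assms(1,3), of u])
        (simp add: linear_sum[OF assms(4)] linear_cmul[OF assms(4)])
    also have "\<dots> = (\<Sum>j\<in>?I. m [E' ! j, u] * (\<Sum>k\<in>?I. m [E' ! k, v] * Q (E' ! j) (E' ! k)))"
      by (subst orthonormal_frame_expand[OF assms(1,3), of v])
        (simp add: linear_sum[OF assms(5)] linear_cmul[OF assms(5)])
    finally show ?thesis by (simp add: sum_distrib_left mult.assoc)
  qed
  have "(\<Sum>i\<in>?I. Q (E ! i) (E ! i)) =
      (\<Sum>i\<in>?I. \<Sum>j\<in>?I. \<Sum>k\<in>?I. m [E' ! j, E ! i] * m [E' ! k, E ! i] * Q (E' ! j) (E' ! k))"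
    by (rule sum.cong[OF refl]) (rule ex)
  also have "\<dots> = (\<Sum>j\<in>?I. \<Sum>i\<in>?I. \<Sum>k\<in>?I. m [E' ! j, E ! i] * m [E' ! k, E ! i] * Q (E' ! j) (E' ! k))"
    by (rule sum.swap)
  also have "\<dots> = (\<Sum>j\<in>?I. \<Sum>k\<in>?I. \<Sum>i\<in>?I. m [E' ! j, E ! i] * m [E' ! k, E ! i] * Q (E' ! j) (E' ! k))"
    by (intro sum.cong[OF refl] sum.swap)
  also have "\<dots> = (\<Sum>j\<in>?I. \<Sum>k\<in>?I. (\<Sum>i\<in>?I. m [E ! i, E' ! j] * m [E ! i, E' ! k]) * Q (E' ! j) (E' ! k))"
    by (simp add: sum_distrib_right inner_product_sym[OF ip(1), of "E' ! _"])
  also have "\<dots> = (\<Sum>j\<in>?I. \<Sum>k\<in>?I. m [E' ! j, E' ! k] * Q (E' ! j) (E' ! k))"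
    by (simp only: ip(2)[symmetric])
  also have "\<dots> = (\<Sum>j\<in>?I. \<Sum>k\<in>?I. if k = j then Q (E' ! j) (E' ! k) else 0)"
    by (intro sum.cong[OF refl]) (use assms(3) in \<open>auto simp: orthonormal_frame_def\<close>)
  also have "\<dots> = (\<Sum>j\<in>?I. Q (E' ! j) (E' ! j))" by simp
  finally show ?thesis .
qed

text \<open>The two occurrences of the frame vectors are separated into two arguments of
  \<open>C\<close>, since only then can multilinearity in each be stated. The tail of the list is
  changed by induction, the head by the trace lemma.\<close>

lemma contract_frame_independent:
  fixes E E' :: "'e::euclidean_space list"
  assumes "multilinear 2 m" "orthonormal_frame m E" "orthonormal_frame m E'"
    and "\<And>f. length f = k \<Longrightarrow> multilinear k (\<lambda>e. C e f)"
    and "\<And>e. length e = k \<Longrightarrow> multilinear k (\<lambda>f. C e f)"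
  shows "contract_frame E k (\<lambda>e. C e e) = contract_frame E' k (\<lambda>e. C e e)"
  using assms(4,5)
proof (induction k arbitrary: C)
  case 0
  then show ?case by (simp add: contract_frame_0)
next
  case (Suc k)
  have IH: "contract_frame E k (\<lambda>e. C (v # e) (v # e)) = contract_frame E' k (\<lambda>e. C (v # e) (v # e))" for v
  proof (rule Suc.IH[of "\<lambda>e f. C (v # e) (v # f)"])
    fix f :: "'e list" assume "length f = k"
    then show "multilinear k (\<lambda>e. C (v # e) (v # f))" "multilinear k (\<lambda>e. C (v # f) (v # e))"
      using multilinear_Cons[OF Suc.prems(1)[of "v # f"]] multilinear_Cons[OF Suc.prems(2)[of "v # f"]] by auto
  qed
  have tr: "(\<Sum>i<DIM('e). C (E ! i # e) (E ! i # e)) = (\<Sum>i<DIM('e). C (E' ! i # e) (E' ! i # e))"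
    if "length e = k" for e
  proof (rule bilinear_trace_frame[OF assms(1-3), of "\<lambda>u v. C (u # e) (v # e)"])
    show "linear (\<lambda>u. C (u # e) (v # e))" "linear (\<lambda>u. C (v # e) (u # e))" for v
      using multilinear_hd[OF Suc.prems(1)[of "v # e"] that] multilinear_hd[OF Suc.prems(2)[of "v # e"] that] that
      by auto
  qed
  have "contract_frame E (Suc k) (\<lambda>e. C e e) = (\<Sum>i<DIM('e). contract_frame E' k (\<lambda>e. C (E ! i # e) (E ! i # e)))"
    by (simp add: contract_frame_Suc IH)
  also have "\<dots> = contract_frame E' k (\<lambda>e. \<Sum>i<DIM('e). C (E ! i # e) (E ! i # e))"
    unfolding contract_frame_def by (rule sum.swap)
  also have "\<dots> = contract_frame E' k (\<lambda>e. \<Sum>i<DIM('e). C (E' ! i # e) (E' ! i # e))"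
    unfolding contract_frame_def by (rule sum.cong[OF refl], rule tr) (auto simp: index_lists_def)
  also have "\<dots> = (\<Sum>i<DIM('e). contract_frame E' k (\<lambda>e. C (E' ! i # e) (E' ! i # e)))"
    unfolding contract_frame_def by (rule sum.swap)
  finally show ?case by (simp add: contract_frame_Suc)
qed

lemma contract_eq:
  fixes E :: "'e::euclidean_space list"
  assumes "multilinear 2 m" "orthonormal_frame m E"
    and "\<And>f. length f = k \<Longrightarrow> multilinear k (\<lambda>e. C e f)"
    and "\<And>e. length e = k \<Longrightarrow> multilinear k (\<lambda>f. C e f)"
    and "\<And>e. length e = k \<Longrightarrow> B e = C e e"
  shows "contract m k B = contract_frame E k B"
proof -
  have "orthonormal_frame m (SOME E. orthonormal_frame m E)" using assms(2) by (rule someI)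
  from contract_frame_independent[OF assms(1) this assms(2), of k C, OF assms(3,4)]
  have "contract m k (\<lambda>e. C e e) = contract_frame E k (\<lambda>e. C e e)"
    by (simp add: contract_def contract_frame_def index_lists_def Let_def)
  moreover have "contract m k B = contract m k (\<lambda>e. C e e)"
    unfolding contract_def Let_def by (rule sum.cong) (auto simp: assms(5))
  moreover have "contract_frame E k B = contract_frame E k (\<lambda>e. C e e)"
    unfolding contract_frame_def by (rule sum.cong) (auto simp: assms(5) index_lists_def)
  ultimately show ?thesis by simp
qed

lemma contract_1:
  fixes E :: "'e::euclidean_space list"
  assumes "multilinear 2 m" "orthonormal_frame m E"
    and "\<And>v. linear (\<lambda>u. Q u v)" "\<And>u. linear (\<lambda>v. Q u v)" "\<And>e. B [e] = Q e e"
  shows "contract m 1 B = (\<Sum>i<DIM('e). Q (E ! i) (E ! i))"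
proof -
  have 1: "multilinear 1 (\<lambda>e. t (hd e))" if "linear (t :: 'e \<Rightarrow> real)" for t
    by (rule multilinearI) (use that in auto)
  have "contract m 1 B = contract_frame E 1 B"
  proof (rule contract_eq[OF assms(1,2), where C = "\<lambda>e f. Q (hd e) (hd f)"])
    show "B e = Q (hd e) (hd e)" if "length e = 1" for e
      using that assms(5) by (auto simp: length_Suc_conv)
  qed (rule 1, rule assms)+
  then show ?thesis by (simp add: contract_frame_Suc contract_frame_0 assms(5))
qed

lemma contract_2:
  fixes E :: "'e::euclidean_space list"
  assumes "multilinear 2 m" "orthonormal_frame m E" "multilinear 2 S" "multilinear 2 T"
    and "\<And>u v. B [u, v] = S [u, v] * T [u, v]"
  shows "contract m 2 B = (\<Sum>i<DIM('e). \<Sum>j<DIM('e). S [E ! i, E ! j] * T [E ! i, E ! j])"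
proof -
  have "contract m 2 B = contract_frame E 2 B"
  proof (rule contract_eq[OF assms(1,2), where C = "\<lambda>e f. S e * T f"])
    show "multilinear 2 (\<lambda>e. S e * T f)" for f
      using multilinear_mult[OF assms(3), of "T f"] by (simp add: mult.commute)
    show "multilinear 2 (\<lambda>f. S e * T f)" for e by (rule multilinear_mult[OF assms(4)])
    show "B e = S e * T e" if "length e = 2" for e
      using that assms(5) by (auto simp: length_Suc_conv numeral_2_eq_2)
  qed
  then show ?thesis by (simp add: contract_frame_Suc contract_frame_0 assms(5) numeral_2_eq_2)
qed

section \<open>The model \<open>G\<^sub>2\<close>-structure\<close>

text \<open>Extends \<open>phi0\<close> from increasing indices to all index lists by skewness.
  Integer values keep the checks below executable.\<close>

definition phi_model :: "nat list \<Rightarrow> int" where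
  "phi_model js = eps js * (let s = sort js in
     if s = [1,3,5] then 1
     else if s = [0,1,2] \<or> s = [0,3,4] \<or> s = [0,5,6] \<or> s = [1,4,6] \<or> s = [2,3,6] \<or> s = [2,4,5] then - 1
     else 0)"

text \<open>The Hodge dual of the model 3-form: its quadruples are the complements of the seven
  triples in \<open>phi_model\<close>.\<close>

definition psi_model :: "nat list \<Rightarrow> int" where
  "psi_model js = eps js * (let s = sort js in
     if s = [0,2,4,6] then 1
     else if s = [0,1,3,6] \<or> s = [0,1,4,5] \<or> s = [0,2,3,5] \<or> s = [1,2,3,4] \<or> s = [1,2,5,6] \<or> s = [3,4,5,6] then - 1
     else 0)"

text \<open>Row \<open>a\<close> lists the nonzero components with first index \<open>a\<close>, one
  ordering of each pair. Only 3 of the 21 pairs survive, which keeps contractions small enough for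
  evaluation.\<close>

definition phi_support :: "(nat \<times> nat \<times> int) list list" where
  "phi_support = [
    [(2, 1, 1), (4, 3, 1), (6, 5, 1)],
    [(2, 0, - 1), (5, 3, - 1), (6, 4, 1)],
    [(1, 0, 1), (5, 4, 1), (6, 3, 1)],
    [(4, 0, - 1), (5, 1, 1), (6, 2, - 1)],
    [(3, 0, 1), (5, 2, - 1), (6, 1, - 1)],
    [(3, 1, - 1), (4, 2, 1), (6, 0, - 1)],
    [(3, 2, 1), (4, 1, 1), (5, 0, 1)]]"

definition quadruples :: "nat list list" where
  "quadruples = [
  [0,1,2,3],[0,1,2,4],[0,1,2,5],[0,1,2,6],[0,1,3,4],[0,1,3,5],[0,1,3,6],[0,1,4,5],[0,1,4,6],[0,1,5,6],[0,2,3,4],[0,2,3,5],[0,2,3,6],[0,2,4,5],[0,2,4,6],[0,2,5,6],[0,3,4,5],[0,3,4,6],[0,3,5,6],[0,4,5,6],[1,2,3,4],[1,2,3,5],[1,2,3,6],[1,2,4,5],[1,2,4,6],[1,2,5,6],[1,3,4,5],[1,3,4,6],[1,3,5,6],[1,4,5,6],[2,3,4,5],[2,3,4,6],[2,3,5,6],[2,4,5,6],[3,4,5,6]]"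

text \<open>Two different quadruples in the support of the dual 4-form share exactly two indices, so
  three indices of a quadruple determine the fourth. Entry \<open>q\<close> is such a triple
  completed by \<open>q\<close>, ordered so that the component is +1.\<close>

definition psi_witness :: "(nat \<times> nat \<times> nat) list" where
  "psi_witness = [(1, 5, 4), (0, 3, 6), (0, 3, 5), (0, 5, 2), (0, 2, 6), (0, 1, 4), (0, 1, 3)]"

lemma phi_support: "list_all (\<lambda>a. concat (map (\<lambda>i. concat (map (\<lambda>j.
    let p = phi_model [a, i, j] in if p = 0 then [] else [(i, j, p)]) [0..<i])) [0..<7]) = phi_support ! a) [0..<7]"
  by code_simp
text \<open>The contraction of two 3-forms with the dual 4-form is -24 on the diagonal. Here each
  pair is counted in one of its two orders, in both factors, which leaves -24 / 4 = -6.\<close>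

lemma phi_phi_psi_model: "list_all (\<lambda>a. list_all (\<lambda>b.
   (\<Sum>(i, j, s)\<leftarrow>phi_support ! a. \<Sum>(k, l, t)\<leftarrow>phi_support ! b. s * t * psi_model [i, j, k, l])
    = (if a = b then - 6 else 0)) [0..<7]) [0..<7]"
  by code_simp
text \<open>The triple complementary to \<open>js\<close> is met once for each choice of its first
  index \<open>i\<close>, with the other two in one order only; hence 3 in place of 3!.\<close>

lemma star_phi_model: "list_all (\<lambda>js.
   (\<Sum>i\<leftarrow>[0..<7]. \<Sum>(j, k, s)\<leftarrow>phi_support ! i. s * eps (js @ [i, j, k])) = 3 * psi_model js) quadruples"
  by code_simp
lemma phi_model_norm: "(\<Sum>i\<leftarrow>[0..<7]. \<Sum>(j, k, s)\<leftarrow>phi_support ! i. s * phi_model [i, j, k]) = 21"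
  by code_simp
lemma psi_witness: "list_all (\<lambda>q. case psi_witness ! q of (i, j, k) \<Rightarrow> i < 7 \<and> j < 7 \<and> k < 7 \<and>
    list_all (\<lambda>r. psi_model [r, i, j, k] = (if r = q then 1 else 0)) [0..<7]) [0..<7]"
  by code_simp
lemma sorted_quadruple:
  assumes "length js = 4" "set js \<subseteq> {..<7}" "sorted js" "distinct js"
  shows "js \<in> set quadruples"
proof -
  obtain a b c d where js: "js = [a, b, c, d]"
    using assms(1) by (auto simp: length_Suc_conv eval_nat_numeral)
  have "list_all (\<lambda>d. list_all (\<lambda>c. list_all (\<lambda>b. list_all (\<lambda>a.
      [a, b, c, d] \<in> set quadruples) [0..<b]) [0..<c]) [0..<d]) [0..<7]"
    by code_simp
  moreover have "a < b" "b < c" "c < d" "d < 7" using assms(2-4) unfolding js by auto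
  ultimately show ?thesis unfolding js by (simp add: list_all_iff)
qed

lemma skew_eps_sort: "skew k (\<lambda>js. of_int (eps js * F (sort js)) :: 'a::real_algebra_1)"
  unfolding skew_def
proof (intro allI impI)
  fix xs zs :: "nat list" and x y
  have "sort (xs @ x # y # zs) = sort (xs @ y # x # zs)"
    by (rule properties_for_sort) simp_all
  then show "(of_int (eps (xs @ x # y # zs) * F (sort (xs @ x # y # zs))) :: 'a) =
      - of_int (eps (xs @ y # x # zs) * F (sort (xs @ y # x # zs)))"
    by (simp add: eps_swap[of xs x y])
qed

lemma skew_phi_model: "skew k (\<lambda>js. of_int (phi_model js) :: 'a::real_algebra_1)"
  unfolding phi_model_def Let_def by (rule skew_eps_sort)

lemma skew_psi_model: "skew k (\<lambda>js. of_int (psi_model js) :: 'a::real_algebra_1)"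
  unfolding psi_model_def Let_def by (rule skew_eps_sort)

lemma phi_model_phi0:
  assumes "i < j" "j < k" shows "of_int (phi_model [i, j, k]) = phi0 i j k"
proof -
  have "sort [i, j, k] = [i, j, k]" "eps [i, j, k] = 1" using assms by auto
  then show ?thesis unfolding phi_model_def phi0_def Let_def by simp
qed

lemma sum_square_sym:
  fixes T :: "nat \<Rightarrow> nat \<Rightarrow> real"
  assumes "\<And>i j. T i j = T j i" "\<And>i. T i i = 0"
  shows "(\<Sum>i<n. \<Sum>j<n. T i j) = 2 * (\<Sum>i<n. \<Sum>j<i. T i j)"
proof (induction n)
  case (Suc n)
  have "(\<Sum>i<Suc n. \<Sum>j<Suc n. T i j) = (\<Sum>i<n. \<Sum>j<n. T i j) + (\<Sum>i<n. T i n) + (\<Sum>j<n. T n j)"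
    by (simp add: sum.distrib assms(2))
  moreover have "(\<Sum>i<n. T i n) = (\<Sum>j<n. T n j)" by (rule sum.cong[OF refl]) (rule assms(1))
  ultimately show ?case using Suc.IH by simp
qed simp

text \<open>A product of two factors skew in i and j is symmetric, so the sum is twice the part with
  j < i, and of that only the recorded support is nonzero.\<close>

lemma sum_phi_model:
  fixes G :: "nat \<Rightarrow> nat \<Rightarrow> real"
  assumes "\<And>i j. G j i = - G i j" "a < 7"
  shows "(\<Sum>i<7. \<Sum>j<7. of_int (phi_model [a, i, j]) * G i j) =
    2 * (\<Sum>(i, j, s)\<leftarrow>phi_support ! a. of_int s * G i j)"
proof -
  have sw: "phi_model [a, j, i] = - phi_model [a, i, j]" for i j
    using skewD[OF skew_phi_model[where 'a=real and k=3], of "[a]" j i "[]"] by simp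
  have G0: "G i i = 0" for i using assms(1)[of i i] by simp
  have "(\<Sum>i<7. \<Sum>j<7. of_int (phi_model [a, i, j]) * G i j) =
      2 * (\<Sum>i<7. \<Sum>j<i. of_int (phi_model [a, i, j]) * G i j)"
  proof (rule sum_square_sym)
    show "of_int (phi_model [a, i, j]) * G i j = of_int (phi_model [a, j, i]) * G j i" for i j
      using assms(1)[of j i] sw[of i j] by simp
  qed (simp add: G0)
  also have "(\<Sum>i<7. \<Sum>j<i. of_int (phi_model [a, i, j]) * G i j) =
     (\<Sum>i\<leftarrow>[0..<7]. \<Sum>j\<leftarrow>[0..<i]. of_int (phi_model [a, i, j]) * G i j)"
    by (simp add: interv_sum_list_conv_sum_set_nat atLeast0LessThan)
  also have "\<dots> = (\<Sum>(i, j, s)\<leftarrow>concat (map (\<lambda>i. concat (map (\<lambda>j.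
    let p = phi_model [a, i, j] in if p = 0 then [] else [(i, j, p)]) [0..<i])) [0..<7]). of_int s * G i j)"
  proof -
    have 1: "(\<Sum>(i, j, s)\<leftarrow>concat (map (\<lambda>j. let p = phi_model [a, i, j] in if p = 0 then [] else [(i, j, p)]) js). of_int s * G i j)
       = (\<Sum>j\<leftarrow>js. of_int (phi_model [a, i, j]) * G i j)" for i js
      by (induction js) (auto simp: Let_def)
    have 2: "(\<Sum>(i, j, s)\<leftarrow>concat (map (\<lambda>i. concat (map (\<lambda>j. let p = phi_model [a, i, j] in if p = 0 then [] else [(i, j, p)]) [0..<i])) is). of_int s * G i j)
       = (\<Sum>i\<leftarrow>is. \<Sum>j\<leftarrow>[0..<i]. of_int (phi_model [a, i, j]) * G i j)" for "is"
      by (induction "is") (auto simp: 1)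
    show ?thesis by (rule 2[symmetric])
  qed
  finally show ?thesis using phi_support assms(2) by (simp add: list_all_iff)
qed

lemma of_int_sum_list: "of_int (sum_list xs) = sum_list (map of_int xs)"
  by (induction xs) auto

lemma phi_model_psi_model:
  assumes "a < 7" "b < 7"
  shows "(\<Sum>i<7. \<Sum>j<7. \<Sum>k<7. \<Sum>l<7. of_int (phi_model [a, i, j]) * of_int (phi_model [b, k, l]) * of_int (psi_model [i, j, k, l])) =
    (if a = b then - 24 else 0 :: real)"
proof -
  note sk = skew_psi_model[where 'a=real and k=4]
  have s1: "(of_int (psi_model [j, i, k, l]) :: real) = - of_int (psi_model [i, j, k, l])" for i j k l
    using skewD[OF sk, of "[]" j i "[k, l]"] by simp
  have s2: "(of_int (psi_model [i, j, l, k]) :: real) = - of_int (psi_model [i, j, k, l])" for i j k l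
    using skewD[OF sk, of "[i, j]" l k "[]"] by simp
  have 1: "(\<Sum>k<7. \<Sum>l<7. of_int (phi_model [b, k, l]) * (of_int (psi_model [i, j, k, l]) :: real)) =
      2 * (\<Sum>(k, l, t)\<leftarrow>phi_support ! b. of_int t * of_int (psi_model [i, j, k, l]))" for i j
    by (rule sum_phi_model[where G = "\<lambda>k l. of_int (psi_model [i, j, k, l])"]) (rule s2, rule assms)
  have "(\<Sum>i<7. \<Sum>j<7. \<Sum>k<7. \<Sum>l<7. of_int (phi_model [a, i, j]) * of_int (phi_model [b, k, l]) * (of_int (psi_model [i, j, k, l]) :: real)) =
     (\<Sum>i<7. \<Sum>j<7. of_int (phi_model [a, i, j]) * (\<Sum>k<7. \<Sum>l<7. of_int (phi_model [b, k, l]) * of_int (psi_model [i, j, k, l])))"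
    by (simp only: sum_distrib_left mult.assoc)
  also have "\<dots> = 2 * (\<Sum>(i, j, s)\<leftarrow>phi_support ! a. of_int s * (\<Sum>k<7. \<Sum>l<7. of_int (phi_model [b, k, l]) * of_int (psi_model [i, j, k, l])))"
  proof (rule sum_phi_model[where G = "\<lambda>i j. \<Sum>k<7. \<Sum>l<7. of_int (phi_model [b, k, l]) * of_int (psi_model [i, j, k, l])"])
    show "(\<Sum>k<7. \<Sum>l<7. of_int (phi_model [b, k, l]) * of_int (psi_model [j, i, k, l])) =
      - (\<Sum>k<7. \<Sum>l<7. of_int (phi_model [b, k, l]) * (of_int (psi_model [i, j, k, l]) :: real))" for i j
      by (simp only: s1[of j i] sum_negf mult_minus_right)
  qed (rule assms)
  also have "\<dots> = 4 * (\<Sum>(i, j, s)\<leftarrow>phi_support ! a. \<Sum>(k, l, t)\<leftarrow>phi_support ! b. of_int s * of_int t * of_int (psi_model [i, j, k, l]))"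
    by (simp add: 1 sum_list_const_mult[symmetric] case_prod_unfold mult_ac)
  also have "\<dots> = 4 * of_int (\<Sum>(i, j, s)\<leftarrow>phi_support ! a. \<Sum>(k, l, t)\<leftarrow>phi_support ! b. s * t * psi_model [i, j, k, l])"
    by (simp add: of_int_sum_list case_prod_unfold o_def)
  also have "\<dots> = 4 * of_int (if a = b then - 6 else 0)"
    using phi_phi_psi_model assms by (simp add: list_all_iff)
  finally show ?thesis by simp
qed

lemma star_phi_psi_model:
  assumes "js \<in> index_lists 7 4"
  shows "(\<Sum>ks\<in>index_lists 7 3. of_int (phi_model ks) * of_int (eps (js @ ks))) = (6 * of_int (psi_model js) :: real)"
proof -
  let ?L = "\<lambda>js. \<Sum>ks\<in>index_lists 7 3. of_int (phi_model ks) * (of_int (eps (js @ ks)) :: real)"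
  have "skew 4 ?L" unfolding skew_def
  proof (intro allI impI)
    fix xs zs x y
    show "?L (xs @ x # y # zs) = - ?L (xs @ y # x # zs)"
      by (simp add: eps_swap[of xs x y] sum_negf)
  qed
  moreover have "skew 4 (\<lambda>js. 6 * of_int (psi_model js) :: real)"
    using skewD[OF skew_psi_model[where 'a=real]] unfolding skew_def by (metis mult_minus_right)
  moreover have "?L vs = 6 * of_int (psi_model vs)"
    if "length vs = 4" "set vs \<subseteq> {..<7}" "sorted vs" "distinct vs" for vs
  proof -
    have e: "(of_int (eps (vs @ [i, k, j])) :: real) = - of_int (eps (vs @ [i, j, k]))" for i j k
      using skewD[OF skew_eps[where 'a=real], of "vs @ [i]" k j "[]"] by simp
    have "?L vs = (\<Sum>i<7. \<Sum>j<7. \<Sum>k<7. of_int (phi_model [i, j, k]) * of_int (eps (vs @ [i, j, k])))"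
      by (simp add: eval_nat_numeral(2,3) sum_index_lists_Suc sum_index_lists_0)
    also have "\<dots> = (\<Sum>i<7. 2 * (\<Sum>(j, k, s)\<leftarrow>phi_support ! i. of_int s * of_int (eps (vs @ [i, j, k]))))"
      by (rule sum.cong[OF refl], rule sum_phi_model[where G = "\<lambda>j k. of_int (eps (vs @ [_, j, k]))"], rule e, simp)
    also have "\<dots> = of_int (2 * (\<Sum>i\<leftarrow>[0..<7]. \<Sum>(j, k, s)\<leftarrow>phi_support ! i. s * eps (vs @ [i, j, k])))"
      by (simp add: interv_sum_list_conv_sum_set_nat atLeast0LessThan sum_distrib_left of_int_sum_list case_prod_unfold o_def)
    also have "\<dots> = 6 * of_int (psi_model vs)"
      using star_phi_model sorted_quadruple[OF that] by (simp add: list_all_iff)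
    finally show ?thesis .
  qed
  ultimately show ?thesis
    by (rule skew_eqI[where A = "{..<7}"]) (use assms in \<open>auto simp: index_lists_def\<close>)
qed

text \<open>Seven components of absolute value 1, each met in 3! orders.\<close>

lemma phi_model_norm_42: "(\<Sum>ks\<in>index_lists 7 3. of_int (phi_model ks) * of_int (phi_model ks)) = (42 :: real)"
proof -
  have e: "(of_int (phi_model [i, k, j]) :: real) = - of_int (phi_model [i, j, k])" for i j k
    using skewD[OF skew_phi_model[where 'a=real], of "[i]" k j "[]"] by simp
  have "(\<Sum>ks\<in>index_lists 7 3. of_int (phi_model ks) * of_int (phi_model ks)) =
      (\<Sum>i<7. \<Sum>j<7. \<Sum>k<7. of_int (phi_model [i, j, k]) * (of_int (phi_model [i, j, k]) :: real))"
    by (simp add: eval_nat_numeral(2,3) sum_index_lists_Suc sum_index_lists_0)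
  also have "\<dots> = (\<Sum>i<7. 2 * (\<Sum>(j, k, s)\<leftarrow>phi_support ! i. of_int s * of_int (phi_model [i, j, k])))"
    by (rule sum.cong[OF refl], rule sum_phi_model[where G = "\<lambda>j k. of_int (phi_model [_, j, k])"], rule e, simp)
  also have "\<dots> = of_int (2 * (\<Sum>i\<leftarrow>[0..<7]. \<Sum>(j, k, s)\<leftarrow>phi_support ! i. s * phi_model [i, j, k]))"
    by (simp add: interv_sum_list_conv_sum_set_nat atLeast0LessThan sum_distrib_left of_int_sum_list case_prod_unfold o_def)
  also have "\<dots> = 42" using phi_model_norm by simp
  finally show ?thesis .
qed

section \<open>Pointwise \<open>G\<^sub>2\<close>-geometry\<close>

text \<open>Declares the frame orthonormal by means of its dual basis, so that every adapted frame
  gives an instance of \<open>framed_G2\<close>.\<close>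

lemma G2_frame_inner_product:
  fixes E :: "'e::euclidean_space list"
  assumes "G2_frame t E" "DIM('e) = 7"
  shows "\<exists>m. multilinear 2 m \<and> orthonormal_frame m E"
proof -
  have E: "length E = 7" "independent (set E)" "distinct E"
    using assms(1) unfolding G2_frame_def by auto
  have "\<exists>f. linear f \<and> (\<forall>j<7. f (E ! j) = (if i = j then 1 else 0 :: real))" if "i < 7" for i
  proof -
    obtain f :: "'e \<Rightarrow> real" where f: "linear f" "\<forall>x\<in>set E. f x = (if x = E ! i then 1 else 0)"
      using linear_independent_extend[OF E(2), of "\<lambda>x. if x = E ! i then 1 else 0"] by blast
    have "f (E ! j) = (if i = j then 1 else 0)" if "j < 7" for j
      using f(2) that \<open>i < 7\<close> E nth_eq_iff_index_eq[OF E(3), of j i] by auto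
    then show ?thesis using f(1) by blast
  qed
  then obtain f where f: "\<And>i. i < 7 \<Longrightarrow> linear (f i)"
    "\<And>i j. i < 7 \<Longrightarrow> j < 7 \<Longrightarrow> f i (E ! j) = (if i = j then 1 else 0 :: real)"
    by metis
  define m where "m vs = (\<Sum>i<7. f i (vs ! 0) * f i (vs ! 1))" for vs
  have "multilinear 2 m" unfolding multilinear_2
  proof (intro conjI allI)
    fix v
    have "linear (\<lambda>u. \<Sum>i<7. f i u * f i v)"
      by (intro linear_compose_sum ballI) (use linear_scaleR_left[OF f(1), of _ "f _ v"] in auto)
    then show "linear (\<lambda>u. m [u, v])" by (simp add: m_def)
    have "linear (\<lambda>u. \<Sum>i<7. f i v * f i u)"
      by (intro linear_compose_sum ballI) (use linear_compose_scale_right[OF f(1), of _ "f _ v"] in auto)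
    then show "linear (\<lambda>u. m [v, u])" by (simp add: m_def)
  qed
  moreover have "m [E ! i, E ! j] = (if i = j then 1 else 0)" if "i < 7" "j < 7" for i j
  proof -
    have "m [E ! i, E ! j] = (\<Sum>k<7. if k = i then (if k = j then 1 else 0) else 0)"
      unfolding m_def by (rule sum.cong) (use f(2) that in auto)
    then show ?thesis using that by simp
  qed
  ultimately show ?thesis unfolding orthonormal_frame_def using E(1) assms(2) by auto
qed

text \<open>Antisymmetrising the product of the frame coordinates works: on the frame itself every
  permutation other than the identity meets a vanishing factor.\<close>

lemma volume_form_exists:
  fixes E :: "'e::euclidean_space list"
  assumes "multilinear 2 m" "orthonormal_frame m E"
  shows "\<exists>\<mu>. multilinear DIM('e) \<mu> \<and> alternating DIM('e) \<mu> \<and> \<mu> E = (1::real)"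
proof -
  let ?n = "DIM('e)"
  define t where "t vs = (\<Prod>n<?n. m [E ! n, vs ! n])" for vs
  have "multilinear ?n t" unfolding multilinear_def
  proof (intro allI impI, elim conjE)
    fix vs :: "'e list" and i assume i: "length vs = ?n" "i < ?n"
    have "t (vs[i := v]) = (\<Prod>n\<in>{..<?n} - {i}. m [E ! n, vs ! n]) * m [E ! i, v]" for v
    proof -
      have "t (vs[i := v]) = m [E ! i, vs[i := v] ! i] * (\<Prod>n\<in>{..<?n} - {i}. m [E ! n, vs[i := v] ! n])"
        unfolding t_def by (rule prod.remove) (use i in auto)
      also have "(\<Prod>n\<in>{..<?n} - {i}. m [E ! n, vs[i := v] ! n]) = (\<Prod>n\<in>{..<?n} - {i}. m [E ! n, vs ! n])"
        by (rule prod.cong) auto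
      finally show ?thesis using i by simp
    qed
    moreover have "linear (\<lambda>v. m [E ! i, v])" using assms(1) multilinear_2 by blast
    ultimately show "linear (\<lambda>v. t (vs[i := v]))"
      using linear_compose_scale_right[of "\<lambda>v. m [E ! i, v]" "\<Prod>n\<in>{..<?n} - {i}. m [E ! n, vs ! n]"] by simp
  qed
  from alternation_multilinear[OF this]
  have "multilinear ?n (alternation ?n t)" .
  moreover have "alternating ?n (alternation ?n t)" by (rule alternation_alternating)
  moreover have "alternation ?n t E = 1"
  proof -
    have "of_int (sign p) * t (map ((!) E) (map p [0..<?n])) = (if p = id then 1 else 0)"
      if p: "p permutes {..<?n}" for p
    proof (cases "p = id")
      case True
      have "t (map ((!) E) (map id [0..<?n])) = (\<Prod>n<?n. 1)"
        unfolding t_def by (rule prod.cong) (use assms(2) in \<open>auto simp: orthonormal_frame_def\<close>)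
      then show ?thesis using True by simp
    next
      case False
      then obtain n where n: "p n \<noteq> n" by (auto simp: fun_eq_iff)
      then have "n < ?n" using p permutes_not_in by fastforce
      moreover have "p n < ?n" using permutes_in_image[OF p, of n] \<open>n < ?n\<close> by simp
      ultimately have "t (map ((!) E) (map p [0..<?n])) = 0"
        unfolding t_def using assms(2) n
        by (intro prod_zero bexI[of _ n]) (auto simp: orthonormal_frame_def)
      then show ?thesis using False by simp
    qed
    then have "alternation ?n t E = (\<Sum>p | p permutes {..<?n}. if p = id then 1 else 0)"
      unfolding alternation_def by (intro sum.cong) auto
    then show ?thesis using finite_permutations[of "{..<?n}"] by (simp add: permutes_id)
  qed
  ultimately show ?thesis by blast
qed

lemma top_form_unique:
  fixes E :: "'e::euclidean_space list"
  assumes "multilinear 2 m" "orthonormal_frame m E"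
    and "multilinear DIM('e) \<mu>" "alternating DIM('e) \<mu>" "\<mu> E = (1::real)"
    and "multilinear DIM('e) F" "alternating DIM('e) F" "length vs = DIM('e)"
  shows "F vs = F E * \<mu> vs"
proof (rule alternating_eqI[where k = "DIM('e)" and E = E])
  note mu = multilinear_mult[OF assms(3), of "F E"]
  show "multilinear DIM('e) (\<lambda>vs. F E * \<mu> vs)" by (rule mu)
  show "skew DIM('e) F" by (rule alternating_skew[OF assms(6,7)])
  show "skew DIM('e) (\<lambda>vs. F E * \<mu> vs)"
    by (rule alternating_skew[OF mu]) (use assms(4) in \<open>auto simp: alternating_def\<close>)
  show "span (set E) = UNIV" by (rule orthonormal_frame_span[OF assms(1,2)])
  fix js assume js: "length js = DIM('e)" "set js \<subseteq> {..<length E}" "sorted js" "distinct js"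
  have len: "length E = DIM('e)" using assms(2) by (simp add: orthonormal_frame_def)
  have "js = [0..<DIM('e)]" by (rule sorted_distinct_full) (use js len in auto)
  then have "map ((!) E) js = E" using len map_nth[of E] by simp
  then show "F (map ((!) E) js) = F E * \<mu> (map ((!) E) js)" using assms(5) by simp
qed (rule assms)+

text \<open>Here \<open>m\<close> is not yet known to be the induced metric; it is any bilinear form
  for which some adapted frame is orthonormal. Its independence of the frame is
  \<open>framed_G2_unique\<close>.\<close>

locale framed_G2 =
  fixes \<phi> m :: "('e::euclidean_space, real) tensor" and E :: "'e list"
  assumes phi_multilinear: "multilinear 3 \<phi>" and phi_alternating: "alternating 3 \<phi>"
    and m_multilinear: "multilinear 2 m" and frame: "G2_frame \<phi> E" and orthonormal: "orthonormal_frame m E"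
begin

lemma dim: "DIM('e) = 7" and length_frame: "length E = 7"
  using frame orthonormal unfolding G2_frame_def orthonormal_frame_def by auto

lemma frame_span: "span (set E) = UNIV"
  by (rule orthonormal_frame_span[OF m_multilinear orthonormal])

lemma phi_skew: "skew 3 \<phi>"
  by (rule alternating_skew[OF phi_multilinear phi_alternating])

lemma phi_frame:
  assumes "js \<in> index_lists 7 3"
  shows "\<phi> (map ((!) E) js) = of_int (phi_model js)"
proof (rule skew_eqI[OF skew_map[OF phi_skew] skew_phi_model, where A = "{..<7}"])
  fix vs :: "nat list" assume vs: "length vs = 3" "set vs \<subseteq> {..<7}" "sorted vs" "distinct vs"
  then obtain i j k where ijk: "vs = [i, j, k]" by (auto simp: length_Suc_conv eval_nat_numeral)
  then have lt: "i < j" "j < k" "k < 7" using vs by auto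
  have "\<phi> [E ! i, E ! j, E ! k] = phi0 i j k" using frame lt unfolding G2_frame_def by blast
  then show "\<phi> (map ((!) E) vs) = real_of_int (phi_model vs)"
    using phi_model_phi0[OF lt(1,2)] ijk by simp
qed (use assms in \<open>auto simp: index_lists_def\<close>)

lemma phi_frame3: "i < 7 \<Longrightarrow> j < 7 \<Longrightarrow> k < 7 \<Longrightarrow> \<phi> [E ! i, E ! j, E ! k] = of_int (phi_model [i, j, k])"
  using phi_frame[of "[i, j, k]"] by (simp add: index_lists_def)

text \<open>The invariant \<open>(u \<lrcorner> \<phi>) \<and> (v \<lrcorner> \<phi>) \<and> \<phi>\<close>, up to a constant factor.\<close>
definition phi_cubed :: "'e \<Rightarrow> 'e \<Rightarrow> 'e list \<Rightarrow> real" where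
  "phi_cubed u v = alternation 7 (\<lambda>vs. \<phi> [u, vs ! 0, vs ! 1] * \<phi> [v, vs ! 2, vs ! 3] * \<phi> [vs ! 4, vs ! 5, vs ! 6])"

lemma linear_phi: "linear (\<lambda>u. \<phi> [u, v, w])" "linear (\<lambda>u. \<phi> [v, u, w])" "linear (\<lambda>u. \<phi> [v, w, u])"
  using phi_multilinear multilinear_3 by blast+

lemma phi_cubed_multilinear: "multilinear 7 (phi_cubed u v)"
  unfolding phi_cubed_def
proof (rule alternation_multilinear, unfold multilinear_def, intro allI impI, elim conjE)
  fix vs :: "'e list" and i :: nat assume i: "length vs = 7" "i < 7"
  have R: "linear (\<lambda>v. f v * c)" "linear (\<lambda>v. c * f v)" if "linear f" for f :: "'e \<Rightarrow> real" and c
    using linear_scaleR_left[OF that, of c] linear_compose_scale_right[OF that, of c] by auto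
  have "i = 0 \<or> i = 1 \<or> i = 2 \<or> i = 3 \<or> i = 4 \<or> i = 5 \<or> i = 6" using i by arith
  then show "linear (\<lambda>w. \<phi> [u, vs[i := w] ! 0, vs[i := w] ! 1] * \<phi> [v, vs[i := w] ! 2, vs[i := w] ! 3] *
      \<phi> [vs[i := w] ! 4, vs[i := w] ! 5, vs[i := w] ! 6])"
    using i(1) by (elim disjE; simp) (intro R linear_phi)+
qed

text \<open>The last three permuted indices contract \<phi> against the volume symbol, which gives 6
  times the dual 4-form; the first four then give the contraction -24 \<delta>. Hence -144 = 6 *
  (-24).\<close>

lemma phi_cubed_frame: "phi_cubed u v E = - 144 * m [u, v]"
proof -
  let ?X = "\<lambda>u v js. \<phi> [u, E ! (js ! 0), E ! (js ! 1)] * \<phi> [v, E ! (js ! 2), E ! (js ! 3)]"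
  have ex: "phi_cubed u v E = (\<Sum>as\<in>index_lists 7 4. ?X u v as * (6 * of_int (psi_model as)))" for u v
  proof -
    have "phi_cubed u v E = (\<Sum>p | p permutes {..<7}. of_int (sign p) *
        (\<lambda>js. ?X u v js * \<phi> [E ! (js ! 4), E ! (js ! 5), E ! (js ! 6)]) (map p [0..<7]))"
      unfolding phi_cubed_def alternation_def by simp
    also have "\<dots> = (\<Sum>js\<in>index_lists 7 (4 + 3). of_int (eps js) * (?X u v js * \<phi> [E ! (js ! 4), E ! (js ! 5), E ! (js ! 6)]))"
      by (subst sum_permutes_index_lists) simp
    also have "\<dots> = (\<Sum>as\<in>index_lists 7 4. \<Sum>bs\<in>index_lists 7 3. ?X u v as * (of_int (phi_model bs) * of_int (eps (as @ bs))))"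
      unfolding sum_index_lists_append
    proof (intro sum.cong refl)
      fix as bs assume ab: "as \<in> index_lists 7 4" "bs \<in> index_lists 7 3"
      then obtain a0 a1 a2 a3 b0 b1 b2 where "as = [a0, a1, a2, a3]" "bs = [b0, b1, b2]"
        by (auto simp: index_lists_def length_Suc_conv eval_nat_numeral)
      then show "of_int (eps (as @ bs)) * (?X u v (as @ bs) * \<phi> [E ! ((as @ bs) ! 4), E ! ((as @ bs) ! 5), E ! ((as @ bs) ! 6)]) =
          ?X u v as * (of_int (phi_model bs) * of_int (eps (as @ bs)))"
        using phi_frame[OF ab(2)] by simp
    qed
    also have "\<dots> = (\<Sum>as\<in>index_lists 7 4. ?X u v as * (6 * of_int (psi_model as)))"
      by (simp only: sum_distrib_left[symmetric]) (rule sum.cong[OF refl], simp only: star_phi_psi_model)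
    finally show ?thesis .
  qed
  have "(\<lambda>vs. phi_cubed (vs ! 0) (vs ! 1) E) [u, v] = (\<lambda>vs. - 144 * m vs) [u, v]"
  proof (rule multilinear_eqI[where k = 2 and E = E])
    have R: "linear (\<lambda>v. f v * c)" "linear (\<lambda>v. c * f v)" if "linear f" for f :: "'e \<Rightarrow> real" and c
      using linear_scaleR_left[OF that, of c] linear_compose_scale_right[OF that, of c] by auto
    show "multilinear 2 (\<lambda>vs. phi_cubed (vs ! 0) (vs ! 1) E)"
      unfolding multilinear_2 ex
      by (intro conjI allI linear_compose_sum ballI; simp) (intro R linear_phi)+
    show "multilinear 2 (\<lambda>vs. - 144 * m vs)" by (rule multilinear_mult[OF m_multilinear])
    show "span (set E) = UNIV" by (rule frame_span)
    fix js :: "nat list" assume js: "length js = 2" "set js \<subseteq> {..<length E}"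
    then obtain a b where ab: "js = [a, b]" "a < 7" "b < 7"
      using length_frame by (auto simp: length_Suc_conv eval_nat_numeral)
    have "phi_cubed (E ! a) (E ! b) E = 6 * (\<Sum>i<7. \<Sum>j<7. \<Sum>k<7. \<Sum>l<7.
        of_int (phi_model [a, i, j]) * of_int (phi_model [b, k, l]) * of_int (psi_model [i, j, k, l]))"
      unfolding ex using ab(2,3)
      by (simp add: eval_nat_numeral(2,3) sum_index_lists_Suc sum_index_lists_0 phi_frame3[simplified eval_nat_numeral(2,3)] sum_distrib_left mult_ac)
    also have "\<dots> = (if a = b then - 144 else 0)"
      unfolding phi_model_psi_model[OF ab(2,3)] by simp
    also have "\<dots> = - 144 * m [E ! a, E ! b]"
      using orthonormal ab(2,3) dim by (auto simp: orthonormal_frame_def)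
    finally show "phi_cubed (map ((!) E) js ! 0) (map ((!) E) js ! 1) E = - 144 * m (map ((!) E) js)"
      using ab(1) by simp
  qed simp
  then show ?thesis by simp
qed

lemma contract_phi_phi: "contract_frame E 3 (\<lambda>e. \<phi> e * \<phi> e) = 42"
proof -
  have "contract_frame E 3 (\<lambda>e. \<phi> e * \<phi> e) = (\<Sum>ks\<in>index_lists 7 3. of_int (phi_model ks) * of_int (phi_model ks))"
    unfolding contract_frame_def dim by (rule sum.cong) (simp_all only: phi_frame)
  then show ?thesis using phi_model_norm_42 by simp
qed

end

text \<open>The 7-form \<open>phi_cubed u v\<close> depends on \<phi> only. On \<open>E'\<close> it
  is -144 m'(u, v) by one frame, and -144 m(u, v) times \<mu>(E') by the other, so m' = d m with d =
  \<mu>(E') > 0. Comparing the norm of \<phi>, which is the same number 42 for both frames, forces d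
  = 1.\<close>

lemma framed_G2_unique:
  fixes E E' :: "'e::euclidean_space list" and \<mu> :: "('e, real) tensor"
  assumes "framed_G2 \<phi> m E" "framed_G2 \<phi> m' E'"
    and "multilinear 7 \<mu>" "alternating 7 \<mu>" "\<mu> E = 1"
  shows "m' [u, v] = m [u, v]" "\<mu> E' = 1"
proof -
  interpret A: framed_G2 \<phi> m E by fact
  interpret B: framed_G2 \<phi> m' E' by fact
  let ?d = "\<mu> E'"
  have m': "m' [u, v] = ?d * m [u, v]" for u v
  proof -
    have "A.phi_cubed u v E' = A.phi_cubed u v E * \<mu> E'"
    proof (rule top_form_unique[OF A.m_multilinear A.orthonormal])
      show "multilinear DIM('e) (A.phi_cubed u v)" using A.phi_cubed_multilinear A.dim by simp
      show "alternating DIM('e) (A.phi_cubed u v)"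
        unfolding A.phi_cubed_def A.dim by (rule alternation_alternating)
    qed (use assms(3-5) A.dim B.length_frame in auto)
    then show ?thesis using A.phi_cubed_frame B.phi_cubed_frame by simp
  qed
  have on: "m' [E' ! i, E' ! j] = (if i = j then 1 else 0)" if "i < 7" "j < 7" for i j
    using B.orthonormal that B.dim by (auto simp: orthonormal_frame_def)
  have ip: "inner_product m" by (rule orthonormal_frame_inner_product(1)[OF A.m_multilinear A.orthonormal])
  have "1 = ?d * m [E' ! 0, E' ! 0]" using on[of 0 0] m' by simp
  moreover have "m [E' ! 0, E' ! 0] \<ge> 0"
    using ip linear_0[OF inner_product_linear(1)[OF ip]] unfolding inner_product_def
    by (metis less_eq_real_def)
  ultimately have d: "?d > 0" by (metis zero_less_one zero_less_mult_pos2 less_eq_real_def mult_zero_right zero_neq_one)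
  \<comment> \<open>\<open>E'\<close> is orthonormal for d m, so its multiple by the square root of
    d is orthonormal for m.\<close>
  define E'' where "E'' = map (\<lambda>e. sqrt ?d *\<^sub>R e) E'"
  note lin = inner_product_linear[OF ip]
  have nth: "E'' ! i = sqrt ?d *\<^sub>R E' ! i" if "i < 7" for i
    using that B.length_frame unfolding E''_def by simp
  have on'': "orthonormal_frame m E''"
    unfolding orthonormal_frame_def A.dim
  proof (intro conjI allI impI)
    show "length E'' = 7" using B.length_frame E''_def by simp
    fix i j :: nat assume ij: "i < 7" "j < 7"
    have "m [E'' ! i, E'' ! j] = m' [E' ! i, E' ! j]"
      using d nth[OF ij(1)] nth[OF ij(2)] m' by (simp add: linear_cmul[OF lin(1)] linear_cmul[OF lin(2)])
    then show "m [E'' ! i, E'' ! j] = (if i = j then 1 else 0)" using on[OF ij] by simp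
  qed
  have "contract_frame E 3 (\<lambda>e. \<phi> e * \<phi> e) = contract_frame E'' 3 (\<lambda>e. \<phi> e * \<phi> e)"
  proof (rule contract_frame_independent[OF A.m_multilinear A.orthonormal on'', where C = "\<lambda>e f. \<phi> e * \<phi> f"])
    show "multilinear 3 (\<lambda>e. \<phi> f * \<phi> e)" for f by (rule multilinear_mult[OF A.phi_multilinear])
    show "multilinear 3 (\<lambda>e. \<phi> e * \<phi> f)" for f
      using multilinear_mult[OF A.phi_multilinear, of "\<phi> f"] by (simp add: mult.commute)
  qed
  \<comment> \<open>Two factors with three slots each contribute six square roots of d.\<close>
  also have "\<dots> = ?d ^ 3 * contract_frame E' 3 (\<lambda>e. \<phi> e * \<phi> e)"
    unfolding contract_frame_def index_lists_def sum_distrib_left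
  proof (rule sum.cong[OF refl])
    fix "is" :: "nat list" assume i: "is \<in> {is. length is = 3 \<and> set is \<subseteq> {..<DIM('e)}}"
    then obtain a b c where abc: "is = [a, b, c]" "a < 7" "b < 7" "c < 7"
      using A.dim by (auto simp: length_Suc_conv eval_nat_numeral)
    show "\<phi> (map ((!) E'') is) * \<phi> (map ((!) E'') is) = ?d ^ 3 * (\<phi> (map ((!) E') is) * \<phi> (map ((!) E') is))"
      using d by (simp add: abc nth linear_cmul[OF A.linear_phi(1)] linear_cmul[OF A.linear_phi(2)]
          linear_cmul[OF A.linear_phi(3)] power3_eq_cube)
  qed
  finally have "?d ^ 3 = 1" using A.contract_phi_phi B.contract_phi_phi by simp
  then show "\<mu> E' = 1" using d power_eq_1_iff[of ?d 3] by simp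
  then show "m' [u, v] = m [u, v]" using m' by simp
qed

section \<open>Induced metric, volume form, dual 4-form and torsion in an adapted frame\<close>

context
  fixes \<phi> :: "'e::euclidean_space \<Rightarrow> ('e, real) tensor" and x m E
  assumes fr: "framed_G2 (\<phi> x) m E"
begin

interpretation A: framed_G2 "\<phi> x" m E by (rule fr)

text \<open>The chosen metric comes with an adapted frame of its own; uniqueness compares it with
  the given frame. Equality can be asserted only on lists of length 2.\<close>

lemma G2_metric_framed:
  shows "multilinear 2 (G2_metric \<phi> x)" and "G2_metric \<phi> x [u, v] = m [u, v]"
    and "orthonormal_frame (G2_metric \<phi> x) E" and "inner_product (G2_metric \<phi> x)"
proof -
  let ?P = "\<lambda>m. multilinear 2 m \<and> (\<exists>E. G2_frame (\<phi> x) E \<and> orthonormal_frame m E)"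
  have "?P m" using A.m_multilinear A.frame A.orthonormal by blast
  then have P: "?P (G2_metric \<phi> x)" unfolding G2_metric_def by (rule someI[of ?P])
  then show ml: "multilinear 2 (G2_metric \<phi> x)" by blast
  from P obtain E' where "framed_G2 (\<phi> x) (G2_metric \<phi> x) E'"
    using A.phi_multilinear A.phi_alternating unfolding framed_G2_def by blast
  moreover obtain \<mu> where "multilinear 7 \<mu>" "alternating 7 \<mu>" "\<mu> E = (1::real)"
    using volume_form_exists[OF A.m_multilinear A.orthonormal] A.dim by auto
  ultimately have eq: "G2_metric \<phi> x [u, v] = m [u, v]" for u v using framed_G2_unique(1)[OF fr] by blast
  then show "G2_metric \<phi> x [u, v] = m [u, v]" .
  show on: "orthonormal_frame (G2_metric \<phi> x) E"
    using A.orthonormal unfolding orthonormal_frame_def by (simp add: eq)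
  show "inner_product (G2_metric \<phi> x)" by (rule orthonormal_frame_inner_product(1)[OF ml on])
qed

lemma G2_volume_framed:
  shows "multilinear 7 (G2_volume \<phi> x)" and "alternating 7 (G2_volume \<phi> x)" and "G2_volume \<phi> x E = 1"
proof -
  let ?P = "\<lambda>\<mu>. multilinear 7 \<mu> \<and> alternating 7 \<mu> \<and> (\<exists>E. G2_frame (\<phi> x) E \<and> \<mu> E = 1)"
  obtain \<mu> where mu: "multilinear 7 \<mu>" "alternating 7 \<mu>" "\<mu> E = (1::real)"
    using volume_form_exists[OF A.m_multilinear A.orthonormal] A.dim by auto
  then have "?P \<mu>" using A.frame by blast
  then have P: "?P (G2_volume \<phi> x)" unfolding G2_volume_def by (rule someI[of ?P])
  then show ml: "multilinear 7 (G2_volume \<phi> x)" and al: "alternating 7 (G2_volume \<phi> x)" by blast+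
  from P obtain E' where E': "G2_frame (\<phi> x) E'" "G2_volume \<phi> x E' = 1" by blast
  obtain m' where "framed_G2 (\<phi> x) m' E'"
    using G2_frame_inner_product[OF E'(1) A.dim] E'(1) A.phi_multilinear A.phi_alternating
    unfolding framed_G2_def by blast
  \<comment> \<open>The roles of the frames are exchanged: the chosen form is normalised on
    \<open>E'\<close>, and uniqueness carries this over to \<open>E\<close>.\<close>
  from framed_G2_unique(2)[OF this fr ml al E'(2)] show "G2_volume \<phi> x E = 1" .
qed

lemma G2_volume_frame:
  assumes "js \<in> index_lists 7 7"
  shows "G2_volume \<phi> x (map ((!) E) js) = of_int (eps js)"
proof (rule skew_eqI[where A = "{..<7}"])
  show "skew 7 (\<lambda>js. G2_volume \<phi> x (map ((!) E) js))"
    by (rule skew_map[OF alternating_skew[OF G2_volume_framed(1,2)]])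
  fix vs :: "nat list" assume "length vs = 7" "set vs \<subseteq> {..<7}" "sorted vs" "distinct vs"
  then have vs: "vs = [0..<7]" by (rule sorted_distinct_full)
  have "map ((!) E) [0..<7] = E" using map_nth[of E] A.length_frame by simp
  then show "G2_volume \<phi> x (map ((!) E) vs) = of_int (eps vs)"
    unfolding vs eps_upt using G2_volume_framed(3) by simp
qed (use assms skew_eps in \<open>auto simp: index_lists_def\<close>)

lemma G2_psi_contract_frame:
  assumes "length vs = 4"
  shows "G2_psi \<phi> x vs = contract_frame E 3 (\<lambda>e. \<phi> x e * G2_volume \<phi> x (e @ vs)) / 6"
proof -
  have "contract (G2_metric \<phi> x) 3 (\<lambda>e. \<phi> x e * G2_volume \<phi> x (e @ vs)) = contract_frame E 3 (\<lambda>e. \<phi> x e * G2_volume \<phi> x (e @ vs))"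
  proof (rule contract_eq[OF G2_metric_framed(1,3), where C = "\<lambda>e f. \<phi> x e * G2_volume \<phi> x (f @ vs)"])
    show "multilinear 3 (\<lambda>e. \<phi> x e * G2_volume \<phi> x (f @ vs))" for f
      using multilinear_mult[OF A.phi_multilinear, of "G2_volume \<phi> x (f @ vs)"] by (simp add: mult.commute)
    show "multilinear 3 (\<lambda>f. \<phi> x e * G2_volume \<phi> x (f @ vs))" for e
    proof (rule multilinear_mult, rule multilinearI)
      fix xs ys :: "'e list" assume "Suc (length xs + length ys) = 3"
      then show "linear (\<lambda>v. G2_volume \<phi> x ((xs @ v # ys) @ vs))"
        using multilinear_linear[OF G2_volume_framed(1), of xs _ "ys @ vs"] assms by simp
    qed
  qed simp
  then show ?thesis unfolding G2_psi_def hodge_star_def by (simp add: fact_numeral)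
qed

lemma G2_psi_multilinear: "multilinear 4 (G2_psi \<phi> x)"
proof (rule multilinearI)
  fix xs ys :: "'e list" assume len: "Suc (length xs + length ys) = 4"
  have "linear (\<lambda>v. contract_frame E 3 (\<lambda>e. \<phi> x e * G2_volume \<phi> x (e @ xs @ v # ys)))"
    unfolding contract_frame_def index_lists_def
  proof (rule linear_compose_sum, rule ballI)
    fix "is" assume "is \<in> {is. length is = 3 \<and> set is \<subseteq> {..<DIM('e)}}"
    then have "linear (\<lambda>v. G2_volume \<phi> x (map ((!) E) is @ xs @ v # ys))"
      using multilinear_linear[OF G2_volume_framed(1), of "map ((!) E) is @ xs" _ ys] len by simp
    from linear_compose_scale_right[OF this, of "\<phi> x (map ((!) E) is)"]
    show "linear (\<lambda>v. \<phi> x (map ((!) E) is) * G2_volume \<phi> x (map ((!) E) is @ xs @ v # ys))" by simp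
  qed
  from linear_compose_scale_right[OF this, of "1/6"]
  show "linear (\<lambda>v. G2_psi \<phi> x (xs @ v # ys))"
    using len by (simp add: G2_psi_contract_frame)
qed

lemma G2_psi_skew: "skew 4 (G2_psi \<phi> x)"
  unfolding skew_def
proof (intro allI impI)
  fix xs zs :: "'e list" and u v assume len: "length (xs @ u # v # zs) = 4"
  have "contract_frame E 3 (\<lambda>e. \<phi> x e * G2_volume \<phi> x (e @ xs @ u # v # zs)) =
      - contract_frame E 3 (\<lambda>e. \<phi> x e * G2_volume \<phi> x (e @ xs @ v # u # zs))"
    unfolding contract_frame_def index_lists_def sum_negf[symmetric]
  proof (rule sum.cong[OF refl])
    fix "is" assume "is \<in> {is. length is = 3 \<and> set is \<subseteq> {..<DIM('e)}}"
    then have l: "length ((map ((!) E) is @ xs) @ u # v # zs) = 7" using len by simp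
    show "\<phi> x (map ((!) E) is) * G2_volume \<phi> x (map ((!) E) is @ xs @ u # v # zs) =
       - (\<phi> x (map ((!) E) is) * G2_volume \<phi> x (map ((!) E) is @ xs @ v # u # zs))"
      using skewD[OF alternating_skew[OF G2_volume_framed(1,2)] l] by simp
  qed
  then show "G2_psi \<phi> x (xs @ u # v # zs) = - G2_psi \<phi> x (xs @ v # u # zs)"
    using len by (simp add: G2_psi_contract_frame)
qed

lemma G2_psi_frame:
  assumes "js \<in> index_lists 7 4"
  shows "G2_psi \<phi> x (map ((!) E) js) = of_int (psi_model js)"
proof -
  have "contract_frame E 3 (\<lambda>e. \<phi> x e * G2_volume \<phi> x (e @ map ((!) E) js)) =
      (\<Sum>ks\<in>index_lists 7 3. of_int (phi_model ks) * of_int (eps (js @ ks)))"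
    unfolding contract_frame_def A.dim
  proof (rule sum.cong[OF refl])
    fix ks assume ks: "ks \<in> index_lists 7 3"
    have "ks @ js \<in> index_lists 7 7" using ks assms by (auto simp: index_lists_def)
    \<comment> \<open>The Hodge star puts the three indices of \<phi> first, the model check puts
      them last; moving them past four indices takes 12 transpositions, so no sign appears.\<close>
    from G2_volume_frame[OF this] A.phi_frame[OF ks] eps_append[of ks js] ks assms
    show "\<phi> x (map ((!) E) ks) * G2_volume \<phi> x (map ((!) E) ks @ map ((!) E) js) =
        of_int (phi_model ks) * of_int (eps (js @ ks))"
      by (simp add: index_lists_def)
  qed
  then show ?thesis
    using star_phi_psi_model[OF assms] assms by (simp add: G2_psi_contract_frame index_lists_def)
qed

lemma G2_psi_eqI:
  assumes "multilinear 4 \<psi>" "skew 4 \<psi>"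
    and "\<And>js. js \<in> set quadruples \<Longrightarrow> \<psi> (map ((!) E) js) = of_int (psi_model js)" "length vs = 4"
  shows "G2_psi \<phi> x vs = \<psi> vs"
proof (rule alternating_eqI[OF G2_psi_multilinear assms(1) G2_psi_skew assms(2) A.frame_span])
  fix js :: "nat list" assume js: "length js = 4" "set js \<subseteq> {..<length E}" "sorted js" "distinct js"
  then have "G2_psi \<phi> x (map ((!) E) js) = of_int (psi_model js)"
    by (intro G2_psi_frame) (auto simp: index_lists_def A.length_frame)
  moreover have "js \<in> set quadruples" by (rule sorted_quadruple) (use js A.length_frame in auto)
  ultimately show "G2_psi \<phi> x (map ((!) E) js) = \<psi> (map ((!) E) js)" using assms(3) by simp
qed (rule assms)

text \<open>Every index \<open>q\<close> has a triple \<open>ijk\<close> with \<open>\<psi>\<^sub>r\<^sub>i\<^sub>j\<^sub>k = \<delta>\<^sub>r\<^sub>q\<close>, so that \<open>T\<^sub>p\<^sub>q \<psi>\<^sub>q\<^sub>i\<^sub>j\<^sub>k\<close> determines \<open>T\<close>.\<close>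
lemma G2_torsion_eqI:
  assumes "multilinear 2 T"
    and T: "\<And>p i j k. cov_deriv (G2_metric \<phi>) \<phi> x [p, i, j, k] =
           (\<Sum>q<7. T [p, E ! q] * G2_psi \<phi> x [E ! q, i, j, k])"
  shows "G2_torsion \<phi> x [u, v] = T [u, v]" "multilinear 2 (G2_torsion \<phi> x)"
proof -
  let ?P = "\<lambda>T. multilinear 2 T \<and> (\<forall>p i j k. cov_deriv (G2_metric \<phi>) \<phi> x [p, i, j, k] =
           contract (G2_metric \<phi> x) 1 (\<lambda>q. T (p # q) * G2_psi \<phi> x (q @ [i, j, k])))"
  have con: "contract (G2_metric \<phi> x) 1 (\<lambda>q. T (p # q) * G2_psi \<phi> x (q @ [i, j, k])) =
      (\<Sum>q<7. T [p, E ! q] * G2_psi \<phi> x [E ! q, i, j, k])" if "multilinear 2 T" for T p i j k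
  proof -
    have R: "linear (\<lambda>v. f v * c)" "linear (\<lambda>v. c * f v)" if "linear f" for f :: "'e \<Rightarrow> real" and c
      using linear_scaleR_left[OF that, of c] linear_compose_scale_right[OF that, of c] by auto
    have 1: "linear (\<lambda>v. T [p, v])" using that multilinear_2 by blast
    have 2: "linear (\<lambda>v. G2_psi \<phi> x [v, i, j, k])"
      using multilinear_linear[OF G2_psi_multilinear, of "[]" _ "[i, j, k]"] by simp
    show ?thesis
      using contract_1[OF G2_metric_framed(1,3), of "\<lambda>u v. T [p, u] * G2_psi \<phi> x [v, i, j, k]"
          "\<lambda>q. T (p # q) * G2_psi \<phi> x (q @ [i, j, k])"] R[OF 1] R[OF 2] A.dim by simp
  qed
  have "?P T" using con[OF assms(1)] T assms(1) by simp
  then have P: "?P (G2_torsion \<phi> x)" unfolding G2_torsion_def by (rule someI[of ?P])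
  then show ml: "multilinear 2 (G2_torsion \<phi> x)" by blast
  have eq: "(\<Sum>q<7. G2_torsion \<phi> x [p, E ! q] * G2_psi \<phi> x [E ! q, i, j, k]) =
      (\<Sum>q<7. T [p, E ! q] * G2_psi \<phi> x [E ! q, i, j, k])" for p i j k
    using P con[OF ml] T by simp
  have on_frame: "G2_torsion \<phi> x [p, E ! q] = T [p, E ! q]" if q: "q < 7" for p q
  proof -
    obtain i j k where w: "psi_witness ! q = (i, j, k)" by (cases "psi_witness ! q") auto
    have "case psi_witness ! q of (i, j, k) \<Rightarrow> i < 7 \<and> j < 7 \<and> k < 7 \<and>
        list_all (\<lambda>r. psi_model [r, i, j, k] = (if r = q then 1 else 0)) [0..<7]"
      using psi_witness q by (simp add: list_all_iff)
    then have ijk: "i < 7" "j < 7" "k < 7" and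
      d: "\<And>r. r < 7 \<Longrightarrow> psi_model [r, i, j, k] = (if r = q then 1 else 0)"
      unfolding w by (auto simp: list_all_iff)
    have "G2_psi \<phi> x [E ! r, E ! i, E ! j, E ! k] = (if r = q then 1 else 0)" if "r < 7" for r
      using G2_psi_frame[of "[r, i, j, k]"] d[OF that] that ijk by (simp add: index_lists_def)
    then have "(\<Sum>r<7. S [p, E ! r] * G2_psi \<phi> x [E ! r, E ! i, E ! j, E ! k]) = S [p, E ! q]" for S :: "'e list \<Rightarrow> real"
      using q by (simp add: sum.remove[of "{..<7}" q])
    then show ?thesis using eq[of p "E ! i" "E ! j" "E ! k"] by simp
  qed
  have lin: "linear (\<lambda>v. G2_torsion \<phi> x [u, v])" "linear (\<lambda>v. T [u, v])"
    using ml assms(1) multilinear_2 by blast+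
  have "v \<in> span (set E)" using A.frame_span by blast
  from linear_eq_on_span[OF lin _ this] show "G2_torsion \<phi> x [u, v] = T [u, v]"
    using on_frame A.length_frame by (metis in_set_conv_nth)
qed

end

section \<open>Derivatives in a chart\<close>

abbreviation D where "D f x p \<equiv> frechet_derivative f (at x) p"

lemma D_eqI: "(f has_derivative f') (at x) \<Longrightarrow> D f x p = f' p"
  using frechet_derivative_at by metis

text \<open>This is what allows chosen objects, such as the induced metric or the torsion, to be
  replaced by explicit formulas on an open set before they are differentiated.\<close>

lemma D_cong:
  assumes "open U" "x \<in> U" "\<And>y. y \<in> U \<Longrightarrow> f y = g y"
  shows "frechet_derivative f (at x) = frechet_derivative g (at x)"
proof -
  have "(f has_derivative f') (at x) \<longleftrightarrow> (g has_derivative f') (at x)" for f'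
    using has_derivative_transform_within_open[of f f' x UNIV U g]
      has_derivative_transform_within_open[of g f' x UNIV U f] assms by auto
  then show ?thesis unfolding frechet_derivative_def by simp
qed

lemma differentiable_cong:
  assumes "open U" "x \<in> U" "\<And>y. y \<in> U \<Longrightarrow> f y = g y"
  shows "f differentiable (at x) \<longleftrightarrow> g differentiable (at x)"
  unfolding differentiable_def
    using has_derivative_transform_within_open[of f _ x UNIV U g]
      has_derivative_transform_within_open[of g _ x UNIV U f] assms by metis

lemma D_has_derivative: "f differentiable (at x) \<Longrightarrow> (f has_derivative frechet_derivative f (at x)) (at x)"
  using frechet_derivative_works by blast

lemma D_linear: "f differentiable (at x) \<Longrightarrow> linear (frechet_derivative f (at x))"
  using linear_frechet_derivative by blast

text \<open>A Leibniz rule. Differentiability of \<open>t\<close> is available only for each fixed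
  vector, so the argument is expanded in the standard basis, where the claim is the product rule for
  finitely many terms.\<close>

lemma has_derivative_slot:
  fixes t :: "'d::real_normed_vector \<Rightarrow> 'e::euclidean_space \<Rightarrow> 'b::real_normed_vector"
  assumes "open U" "x \<in> U" "\<And>y. y \<in> U \<Longrightarrow> linear (t y)"
    and "\<And>v. (\<lambda>y. t y v) differentiable (at x)" "X differentiable (at x)"
  shows "((\<lambda>y. t y (X y)) has_derivative (\<lambda>p. D (\<lambda>y. t y (X x)) x p + t x (D X x p))) (at x)"
proof -
  have ex: "t y v = (\<Sum>b\<in>Basis. (v \<bullet> b) *\<^sub>R t y b)" if "y \<in> U" for y v
  proof -
    have "t y v = t y (\<Sum>b\<in>Basis. (v \<bullet> b) *\<^sub>R b)" by (simp add: euclidean_representation)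
    then show ?thesis using assms(3)[OF that] by (simp add: linear_sum linear_cmul)
  qed
  have d: "((\<lambda>y. t y v) has_derivative (\<lambda>p. \<Sum>b\<in>Basis. (v \<bullet> b) *\<^sub>R D (\<lambda>y. t y b) x p)) (at x)" for v
    by (rule has_derivative_transform_within_open[OF _ assms(1,2), rotated])
      (rule ex[symmetric], assumption, auto intro!: derivative_eq_intros D_has_derivative assms(4))
  have "((\<lambda>y. \<Sum>b\<in>Basis. (X y \<bullet> b) *\<^sub>R t y b) has_derivative
      (\<lambda>p. \<Sum>b\<in>Basis. (X x \<bullet> b) *\<^sub>R D (\<lambda>y. t y b) x p + (D X x p \<bullet> b) *\<^sub>R t x b)) (at x)"
    by (auto intro!: derivative_eq_intros D_has_derivative assms(4,5))
  then have "((\<lambda>y. t y (X y)) has_derivative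
      (\<lambda>p. \<Sum>b\<in>Basis. (X x \<bullet> b) *\<^sub>R D (\<lambda>y. t y b) x p + (D X x p \<bullet> b) *\<^sub>R t x b)) (at x)"
    by (rule has_derivative_transform_within_open[OF _ assms(1,2)]) (rule ex[symmetric])
  moreover have "(\<Sum>b\<in>Basis. (X x \<bullet> b) *\<^sub>R D (\<lambda>y. t y b) x p + (D X x p \<bullet> b) *\<^sub>R t x b) =
      D (\<lambda>y. t y (X x)) x p + t x (D X x p)" for p
    using D_eqI[OF d, of "X x" p] ex[OF assms(2), of "D X x p"] by (simp add: sum.distrib)
  ultimately show ?thesis by simp
qed

lemma D_slot_linear:
  assumes "open U" "x \<in> U" "\<And>y. y \<in> U \<Longrightarrow> linear (t y)" "\<And>v. (\<lambda>y. t y v) differentiable (at x)"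
  shows "linear (\<lambda>v. D (\<lambda>y. t y v) x p)"
proof (rule linearI)
  fix u v :: 'b and c
  have "((\<lambda>y. t y u + t y v) has_derivative (\<lambda>p. D (\<lambda>y. t y u) x p + D (\<lambda>y. t y v) x p)) (at x)"
    by (intro has_derivative_add D_has_derivative assms)
  then have "((\<lambda>y. t y (u + v)) has_derivative (\<lambda>p. D (\<lambda>y. t y u) x p + D (\<lambda>y. t y v) x p)) (at x)"
    by (rule has_derivative_transform_within_open[OF _ assms(1,2)]) (simp add: linear_add[OF assms(3)])
  then show "D (\<lambda>y. t y (u + v)) x p = D (\<lambda>y. t y u) x p + D (\<lambda>y. t y v) x p" by (rule D_eqI)
  have "((\<lambda>y. c *\<^sub>R t y u) has_derivative (\<lambda>p. c *\<^sub>R D (\<lambda>y. t y u) x p)) (at x)"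
    by (intro has_derivative_scaleR_right D_has_derivative assms)
  then have "((\<lambda>y. t y (c *\<^sub>R u)) has_derivative (\<lambda>p. c *\<^sub>R D (\<lambda>y. t y u) x p)) (at x)"
    by (rule has_derivative_transform_within_open[OF _ assms(1,2)]) (simp add: linear_cmul[OF assms(3)])
  then show "D (\<lambda>y. t y (c *\<^sub>R u)) x p = c *\<^sub>R D (\<lambda>y. t y u) x p" by (rule D_eqI)
qed

subsection \<open>Smooth functions\<close>

lemma Ck_on_cong:
  assumes "open S" "\<And>x. x \<in> S \<Longrightarrow> f x = g x"
  shows "Ck_on k S f \<longleftrightarrow> Ck_on k S g"
  using assms(2)
proof (induction k arbitrary: f g)
  case 0
  then show ?case by (simp cong: continuous_on_cong)
next
  case (Suc k)
  have "f differentiable_on S \<longleftrightarrow> g differentiable_on S"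
    using differentiable_cong[OF assms(1), of _ f g] Suc.prems
    by (auto simp: differentiable_on_eq_differentiable_at[OF assms(1)])
  moreover have "Ck_on k S (\<lambda>x. D f x v) \<longleftrightarrow> Ck_on k S (\<lambda>x. D g x v)" for v
  proof (rule Suc.IH)
    fix x assume "x \<in> S"
    then show "D f x v = D g x v" using D_cong[OF assms(1), of x f g] Suc.prems by simp
  qed
  ultimately show ?case by simp
qed

lemma Ck_on_Suc: "Ck_on (Suc k) S f \<Longrightarrow> Ck_on k S f"
proof (induction k arbitrary: f)
  case 0
  then show ?case by (simp add: differentiable_imp_continuous_on)
qed auto

lemma Ck_on_const: "Ck_on k S (\<lambda>x. c)"
  by (induction k arbitrary: c) auto

lemma Ck_on_bounded_linear:
  assumes "bounded_linear l" "open S" "Ck_on k S f"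
  shows "Ck_on k S (\<lambda>x. l (f x))"
  using assms(3)
proof (induction k arbitrary: f)
  case 0
  then show ?case by (simp add: bounded_linear.continuous_on[OF assms(1)])
next
  case (Suc k)
  have d: "f differentiable (at x)" if "x \<in> S" for x
    using Suc.prems that by (simp add: differentiable_on_eq_differentiable_at[OF assms(2)])
  have h: "((\<lambda>x. l (f x)) has_derivative (\<lambda>v. l (D f x v))) (at x)" if "x \<in> S" for x
    by (rule bounded_linear.has_derivative[OF assms(1) D_has_derivative[OF d[OF that]]])
  then have "(\<lambda>x. l (f x)) differentiable_on S"
    by (auto simp: differentiable_on_eq_differentiable_at[OF assms(2)] differentiable_def)
  moreover have "Ck_on k S (\<lambda>x. D (\<lambda>x. l (f x)) x v)" for v
    using Suc.IH[of "\<lambda>x. D f x v"] Suc.prems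
    by (subst Ck_on_cong[OF assms(2), of _ "\<lambda>x. l (D f x v)"]) (auto simp: D_eqI[OF h])
  ultimately show ?case by simp
qed

lemma Ck_on_add:
  assumes "open S" "Ck_on k S f" "Ck_on k S g"
  shows "Ck_on k S (\<lambda>x. f x + g x)"
  using assms(2,3)
proof (induction k arbitrary: f g)
  case 0
  then show ?case by (simp add: continuous_on_add)
next
  case (Suc k)
  have d: "f differentiable (at x)" "g differentiable (at x)" if "x \<in> S" for x
    using Suc.prems that by (simp_all add: differentiable_on_eq_differentiable_at[OF assms(1)])
  have h: "((\<lambda>x. f x + g x) has_derivative (\<lambda>v. D f x v + D g x v)) (at x)" if "x \<in> S" for x
    by (intro has_derivative_add D_has_derivative d that)
  then have "(\<lambda>x. f x + g x) differentiable_on S"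
    by (auto simp: differentiable_on_eq_differentiable_at[OF assms(1)] differentiable_def)
  moreover have "Ck_on k S (\<lambda>x. D (\<lambda>x. f x + g x) x v)" for v
    using Suc.IH[of "\<lambda>x. D f x v" "\<lambda>x. D g x v"] Suc.prems
    by (subst Ck_on_cong[OF assms(1), of _ "\<lambda>x. D f x v + D g x v"]) (auto simp: D_eqI[OF h])
  ultimately show ?case by simp
qed

lemma Ck_on_mult:
  fixes f g :: "'e::real_normed_vector \<Rightarrow> real"
  assumes "open S" "Ck_on k S f" "Ck_on k S g"
  shows "Ck_on k S (\<lambda>x. f x * g x)"
  using assms(2,3)
proof (induction k arbitrary: f g)
  case 0
  then show ?case by (simp add: continuous_on_mult)
next
  case (Suc k)
  have d: "f differentiable (at x)" "g differentiable (at x)" if "x \<in> S" for x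
    using Suc.prems that by (simp_all add: differentiable_on_eq_differentiable_at[OF assms(1)])
  have h: "((\<lambda>x. f x * g x) has_derivative (\<lambda>v. f x * D g x v + D f x v * g x)) (at x)" if "x \<in> S" for x
    by (intro has_derivative_mult D_has_derivative d that)
  then have "(\<lambda>x. f x * g x) differentiable_on S"
    by (auto simp: differentiable_on_eq_differentiable_at[OF assms(1)] differentiable_def)
  moreover have "Ck_on k S (\<lambda>x. D (\<lambda>x. f x * g x) x v)" for v
  proof -
    \<comment> \<open>The product rule pairs a derivative with an undifferentiated factor; the
      latter has one degree of smoothness more than the induction hypothesis asks for.\<close>
    have "Ck_on k S (\<lambda>x. f x * D g x v + D f x v * g x)"
      using Suc.prems Ck_on_Suc[OF Suc.prems(1)] Ck_on_Suc[OF Suc.prems(2)]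
      by (intro Ck_on_add[OF assms(1)] Suc.IH) auto
    then show ?thesis
      by (subst Ck_on_cong[OF assms(1), of _ "\<lambda>x. f x * D g x v + D f x v * g x"]) (auto simp: D_eqI[OF h])
  qed
  ultimately show ?case by simp
qed

lemma Ck_on_compose_linear:
  assumes "bounded_linear l" "open S" "open S'" "l ` S' \<subseteq> S" "Ck_on k S f"
  shows "Ck_on k S' (\<lambda>x. f (l x))"
  using assms(5)
proof (induction k arbitrary: f)
  case 0
  then have "continuous_on S f" by simp
  then have "continuous_on S' (f \<circ> l)"
    by (intro continuous_on_compose bounded_linear.continuous_on[OF assms(1)] continuous_on_id)
      (use assms(4) continuous_on_subset in blast)
  then show ?case by (simp add: o_def)
next
  case (Suc k)
  have d: "f differentiable (at (l x))" if "x \<in> S'" for x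
    using Suc.prems that assms(4) by (auto simp: differentiable_on_eq_differentiable_at[OF assms(2)])
  have h: "((\<lambda>x. f (l x)) has_derivative (\<lambda>v. D f (l x) (l v))) (at x)" if "x \<in> S'" for x
    using diff_chain_at[OF bounded_linear_imp_has_derivative[OF assms(1)] D_has_derivative[OF d[OF that]]]
    by (simp add: o_def)
  then have "(\<lambda>x. f (l x)) differentiable_on S'"
    by (auto simp: differentiable_on_eq_differentiable_at[OF assms(3)] differentiable_def)
  moreover have "Ck_on k S' (\<lambda>x. D (\<lambda>x. f (l x)) x v)" for v
    using Suc.IH[of "\<lambda>x. D f x (l v)"] Suc.prems
    by (subst Ck_on_cong[OF assms(3), of _ "\<lambda>x. D f (l x) (l v)"]) (auto simp: D_eqI[OF h])
  ultimately show ?case by simp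
qed

lemma smooth_on_const: "smooth_on S (\<lambda>x. c)"
  by (simp add: smooth_on_def Ck_on_const)

lemma smooth_on_bounded_linear: "bounded_linear l \<Longrightarrow> open S \<Longrightarrow> smooth_on S f \<Longrightarrow> smooth_on S (\<lambda>x. l (f x))"
  by (simp add: smooth_on_def Ck_on_bounded_linear)

lemma smooth_on_add: "open S \<Longrightarrow> smooth_on S f \<Longrightarrow> smooth_on S g \<Longrightarrow> smooth_on S (\<lambda>x. f x + g x)"
  by (simp add: smooth_on_def Ck_on_add)

lemma smooth_on_compose_linear:
  "bounded_linear l \<Longrightarrow> open S \<Longrightarrow> open S' \<Longrightarrow> l ` S' \<subseteq> S \<Longrightarrow> smooth_on S f \<Longrightarrow> smooth_on S' (\<lambda>x. f (l x))"
  by (simp add: smooth_on_def Ck_on_compose_linear)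

lemma smooth_on_mult:
  fixes f g :: "'e::real_normed_vector \<Rightarrow> real"
  shows "open S \<Longrightarrow> smooth_on S f \<Longrightarrow> smooth_on S g \<Longrightarrow> smooth_on S (\<lambda>x. f x * g x)"
  unfolding smooth_on_def using Ck_on_mult by blast

lemma smooth_on_linear: "bounded_linear l \<Longrightarrow> smooth_on S l"
  unfolding smooth_on_def
proof
  fix k assume l: "bounded_linear l"
  have "frechet_derivative l (at x) = l" for x
    using frechet_derivative_at[OF bounded_linear_imp_has_derivative[OF l]] by simp
  then show "Ck_on k S l"
    using l by (cases k) (auto simp: Ck_on_const linear_continuous_on bounded_linear_imp_differentiable_on)
qed

lemma smooth_on_differentiable: "open S \<Longrightarrow> smooth_on S f \<Longrightarrow> x \<in> S \<Longrightarrow> f differentiable (at x)"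
  unfolding smooth_on_def by (metis Ck_on.simps(2) differentiable_on_eq_differentiable_at)

lemma smooth_on_D: "smooth_on S f \<Longrightarrow> smooth_on S (\<lambda>x. D f x v)"
  unfolding smooth_on_def by (metis Ck_on.simps(2))

lemma smooth_on_continuous: "smooth_on S f \<Longrightarrow> continuous_on S f"
  unfolding smooth_on_def by (metis Ck_on.simps(1))

subsection \<open>Symmetry of second derivatives\<close>

lemma has_real_derivative_along:
  fixes f :: "'e::real_normed_vector \<Rightarrow> real"
  assumes "f differentiable (at (z + s *\<^sub>R u))"
  shows "((\<lambda>s. f (z + s *\<^sub>R u)) has_real_derivative D f (z + s *\<^sub>R u) u) (at s)"
proof -
  have "((\<lambda>s. z + s *\<^sub>R u) has_derivative (\<lambda>h. h *\<^sub>R u)) (at s)"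
    by (auto intro!: derivative_eq_intros)
  from diff_chain_at[OF this D_has_derivative[OF assms]]
  have "((\<lambda>s. f (z + s *\<^sub>R u)) has_derivative (\<lambda>h. D f (z + s *\<^sub>R u) (h *\<^sub>R u))) (at s)"
    by (simp add: o_def)
  then show ?thesis
    unfolding has_field_derivative_def
    by (simp add: linear_cmul[OF D_linear[OF assms]] mult.commute[of _ "D f _ _"])
qed

text \<open>The mean value theorem, applied once along \<open>u\<close> and once along
  \<open>v\<close>, turns the second difference over a parallelogram into a mixed derivative at an
  intermediate point.\<close>

lemma second_difference:
  fixes f :: "'e::real_normed_vector \<Rightarrow> real"
  assumes "open U" "smooth_on U f" "0 < t"
    and in_U: "\<And>r s. 0 \<le> r \<Longrightarrow> r \<le> t \<Longrightarrow> 0 \<le> s \<Longrightarrow> s \<le> t \<Longrightarrow> x + r *\<^sub>R u + s *\<^sub>R v \<in> U"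
  shows "\<exists>r s. 0 \<le> r \<and> r \<le> t \<and> 0 \<le> s \<and> s \<le> t \<and>
    f (x + t *\<^sub>R u + t *\<^sub>R v) - f (x + t *\<^sub>R u) - f (x + t *\<^sub>R v) + f x =
    t * t * D (\<lambda>y. D f y u) (x + r *\<^sub>R u + s *\<^sub>R v) v"
proof -
  note diff = smooth_on_differentiable[OF assms(1,2)]
    and diff2 = smooth_on_differentiable[OF assms(1) smooth_on_D[OF assms(2)]]
  define F where "F s = f ((x + t *\<^sub>R v) + s *\<^sub>R u) - f (x + s *\<^sub>R u)" for s
  have "(F has_real_derivative D f ((x + t *\<^sub>R v) + s *\<^sub>R u) u - D f (x + s *\<^sub>R u) u) (at s)"
    if "0 \<le> s" "s \<le> t" for s
    unfolding F_def
    by (intro DERIV_diff has_real_derivative_along diff)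
      (use in_U[of s t] in_U[of s 0] that assms(3) in \<open>auto simp: algebra_simps\<close>)
  from MVT2[OF assms(3) this] obtain r where r: "0 < r" "r < t"
    "F t - F 0 = (t - 0) * (D f ((x + t *\<^sub>R v) + r *\<^sub>R u) u - D f (x + r *\<^sub>R u) u)" by blast
  have "((\<lambda>s. D f ((x + r *\<^sub>R u) + s *\<^sub>R v) u) has_real_derivative
      D (\<lambda>y. D f y u) ((x + r *\<^sub>R u) + s *\<^sub>R v) v) (at s)" if "0 \<le> s" "s \<le> t" for s
    by (rule has_real_derivative_along[OF diff2]) (use in_U[of r s] that r in auto)
  from MVT2[OF assms(3) this] obtain s where s: "0 < s" "s < t"
    "D f ((x + r *\<^sub>R u) + t *\<^sub>R v) u - D f ((x + r *\<^sub>R u) + 0 *\<^sub>R v) u =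
      (t - 0) * D (\<lambda>y. D f y u) ((x + r *\<^sub>R u) + s *\<^sub>R v) v" by blast
  have "F t - F 0 = t * t * D (\<lambda>y. D f y u) (x + r *\<^sub>R u + s *\<^sub>R v) v"
    using r(3) s(3) by (simp add: algebra_simps)
  then show ?thesis
    using r s by (intro exI[of _ r] exI[of _ s]) (auto simp: F_def algebra_simps)
qed

text \<open>The second difference does not depend on the order of \<open>u\<close> and
  \<open>v\<close>, so the two mixed derivatives agree at suitable, possibly different, points
  arbitrarily near \<open>x\<close>. Continuity then excludes a gap at \<open>x\<close>.\<close>

lemma second_derivative_symmetric:
  fixes f :: "'e::real_normed_vector \<Rightarrow> real"
  assumes "open U" "smooth_on U f" "x \<in> U"
  shows "D (\<lambda>y. D f y u) x v = D (\<lambda>y. D f y v) x u"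
proof (rule ccontr)
  let ?A = "\<lambda>x. D (\<lambda>y. D f y u) x v" and ?B = "\<lambda>x. D (\<lambda>y. D f y v) x u"
  assume "?A x \<noteq> ?B x"
  define \<epsilon> where "\<epsilon> = \<bar>?A x - ?B x\<bar> / 2"
  have eps: "\<epsilon> > 0" using \<open>?A x \<noteq> ?B x\<close> by (simp add: \<epsilon>_def)
  have "isCont ?A x" "isCont ?B x"
    using smooth_on_continuous[OF smooth_on_D[OF smooth_on_D[OF assms(2)]]] assms(1,3)
    by (auto simp: continuous_on_eq_continuous_at)
  then obtain d1 d2 where d: "d1 > 0" "d2 > 0"
    "\<And>y. dist y x < d1 \<Longrightarrow> dist (?A y) (?A x) < \<epsilon>" "\<And>y. dist y x < d2 \<Longrightarrow> dist (?B y) (?B x) < \<epsilon>"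
    using eps unfolding continuous_at_eps_delta by metis
  obtain d3 where d3: "d3 > 0" "ball x d3 \<subseteq> U" using assms(1,3) openE by blast
  define \<delta> where "\<delta> = Min {d1, d2, d3}"
  have del: "\<delta> > 0" "\<delta> \<le> d1" "\<delta> \<le> d2" "\<delta> \<le> d3" using d d3 by (auto simp: \<delta>_def)
  \<comment> \<open>The summand 1 keeps N positive when both vectors vanish; with t = \<delta> / (2
    N) the parallelogram stays within distance \<delta> of \<open>x\<close>.\<close>
  define N where "N = norm u + norm v + 1"
  have N: "N > 0" by (simp add: N_def add_nonneg_pos)
  define t where "t = \<delta> / (2 * N)"
  have t: "t > 0" using del(1) N by (simp add: t_def)
  have near: "dist (x + r *\<^sub>R u + s *\<^sub>R v) x < \<delta>" if "0 \<le> r" "r \<le> t" "0 \<le> s" "s \<le> t" for r s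
  proof -
    have "dist (x + r *\<^sub>R u + s *\<^sub>R v) x = norm (r *\<^sub>R u + s *\<^sub>R v)" by (simp add: dist_norm algebra_simps)
    also have "\<dots> \<le> r * norm u + s * norm v" using norm_triangle_ineq[of "r *\<^sub>R u" "s *\<^sub>R v"] that by simp
    also have "\<dots> \<le> t * norm u + t * norm v" using that by (intro add_mono mult_right_mono) auto
    also have "\<dots> < 2 * (t * N)"
    proof -
      have "0 \<le> t * norm u" "0 \<le> t * norm v" using t by simp_all
      moreover have "2 * (t * N) = 2 * (t * norm u) + 2 * (t * norm v) + 2 * t"
        by (simp add: N_def algebra_simps)
      ultimately show ?thesis using t by linarith
    qed
    also have "\<dots> = \<delta>" using N by (simp add: t_def)
    finally show ?thesis .
  qed
  have in_U: "x + r *\<^sub>R u + s *\<^sub>R v \<in> U" if "0 \<le> r" "r \<le> t" "0 \<le> s" "s \<le> t" for r s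
    using near[OF that] del(4) d3(2) by (auto simp: mem_ball dist_commute)
  have in_U': "x + r *\<^sub>R v + s *\<^sub>R u \<in> U" if "0 \<le> r" "r \<le> t" "0 \<le> s" "s \<le> t" for r s
    using in_U[OF that(3,4,1,2)] by (simp add: add_ac)
  obtain r s where rs: "0 \<le> r" "r \<le> t" "0 \<le> s" "s \<le> t"
    "f (x + t *\<^sub>R u + t *\<^sub>R v) - f (x + t *\<^sub>R u) - f (x + t *\<^sub>R v) + f x = t * t * ?A (x + r *\<^sub>R u + s *\<^sub>R v)"
    using second_difference[OF assms(1,2) t in_U] by blast
  obtain r' s' where rs': "0 \<le> r'" "r' \<le> t" "0 \<le> s'" "s' \<le> t"
    "f (x + t *\<^sub>R v + t *\<^sub>R u) - f (x + t *\<^sub>R v) - f (x + t *\<^sub>R u) + f x = t * t * ?B (x + r' *\<^sub>R v + s' *\<^sub>R u)"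
    using second_difference[OF assms(1,2) t in_U'] by blast
  have "t * t * ?A (x + r *\<^sub>R u + s *\<^sub>R v) = t * t * ?B (x + r' *\<^sub>R v + s' *\<^sub>R u)"
    using rs(5) rs'(5) by (simp add: add_ac diff_diff_eq)
  then have "?A (x + r *\<^sub>R u + s *\<^sub>R v) = ?B (x + s' *\<^sub>R u + r' *\<^sub>R v)"
    using t by (simp add: add_ac)
  moreover have "dist (?A (x + r *\<^sub>R u + s *\<^sub>R v)) (?A x) < \<epsilon>"
    by (rule d(3)[OF order_less_le_trans[OF near[OF rs(1-4)] del(2)]])
  moreover have "dist (?B (x + s' *\<^sub>R u + r' *\<^sub>R v)) (?B x) < \<epsilon>"
    by (rule d(4)[OF order_less_le_trans[OF near[OF rs'(3,4,1,2)] del(3)]])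
  ultimately have "\<bar>?A x - ?B x\<bar> < 2 * \<epsilon>" unfolding dist_real_def by linarith
  then show False by (simp add: \<epsilon>_def)
qed

section \<open>The Levi-Civita connection\<close>

definition is_levi_civita where
  "is_levi_civita g x \<Gamma> \<longleftrightarrow> bilinear \<Gamma> \<and> (\<forall>u v. \<Gamma> u v = \<Gamma> v u) \<and>
        (\<forall>u v w. D (\<lambda>y. g y [u, v]) x w = g x [\<Gamma> w u, v] + g x [u, \<Gamma> w v])"

text \<open>The Koszul formula. Bracket terms are absent because coordinate-constant fields
  commute.\<close>

lemma koszul:
  assumes "is_levi_civita g x \<Gamma>" "inner_product (g x)"
  shows "2 * g x [\<Gamma> w u, v] = D (\<lambda>y. g y [u, v]) x w + D (\<lambda>y. g y [w, v]) x u - D (\<lambda>y. g y [w, u]) x v"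
proof -
  have sym: "\<Gamma> u v = \<Gamma> v u" for u v using assms(1) by (auto simp: is_levi_civita_def)
  have com: "D (\<lambda>y. g y [u, v]) x w = g x [\<Gamma> w u, v] + g x [u, \<Gamma> w v]" for u v w
    using assms(1) by (auto simp: is_levi_civita_def)
  show ?thesis
    unfolding com
    using sym[of u w] sym[of v w] sym[of u v] inner_product_sym[OF assms(2), of u "\<Gamma> w v"]
      inner_product_sym[OF assms(2), of w "\<Gamma> u v"] by simp
qed

lemma levi_civita_unique:
  assumes "is_levi_civita g x \<Gamma>" "inner_product (g x)"
  shows "levi_civita g x = \<Gamma>"
  unfolding levi_civita_def is_levi_civita_def[symmetric]
proof (rule the_equality, rule assms(1))
  fix \<Gamma>' assume *: "is_levi_civita g x \<Gamma>'"
  show "\<Gamma>' = \<Gamma>"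
  proof (intro ext)
    fix w u
    show "\<Gamma>' w u = \<Gamma> w u"
    proof (rule inner_product_eqI[OF assms(2)])
      show "g x [\<Gamma>' w u, v] = g x [\<Gamma> w u, v]" for v
        using koszul[OF assms, of w u v] koszul[OF * assms(2), of w u v] by simp
    qed
  qed
qed

lemma levi_civita_exists:
  fixes g :: "'e::euclidean_space \<Rightarrow> ('e, real) tensor"
  assumes "open U" "x \<in> U" "\<And>y. y \<in> U \<Longrightarrow> inner_product (g y)"
    and diff: "\<And>u v. (\<lambda>y. g y [u, v]) differentiable (at x)"
  shows "is_levi_civita g x (levi_civita g x)"
proof -
  note ip = assms(3)[OF assms(2)]
  obtain E where E: "orthonormal_frame (g x) E" using orthonormal_frame_exists[OF ip] by blast
  have ml: "multilinear 2 (g x)" using ip by (simp add: inner_product_def)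
  \<comment> \<open>Half the right-hand side of the Koszul formula; raising its last slot with an
    orthonormal frame gives the connection.\<close>
  define K where "K w u v = (D (\<lambda>y. g y [u, v]) x w + D (\<lambda>y. g y [w, v]) x u - D (\<lambda>y. g y [w, u]) x v) / 2" for w u v
  have L1: "linear (\<lambda>u. D (\<lambda>y. g y [u, v]) x w)" and L2: "linear (\<lambda>u. D (\<lambda>y. g y [v, u]) x w)" for v w
    by (rule D_slot_linear[OF assms(1,2) _ diff]; rule inner_product_linear, rule assms(3), assumption)+
  have L3: "linear (\<lambda>w. D (\<lambda>y. g y [u, v]) x w)" for u v using D_linear[OF diff] .
  have half: "linear (\<lambda>v. f v / 2)" if "linear f" for f :: "'e \<Rightarrow> real"
    using linear_compose_scale_right[OF that, of "1/2"] by simp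
  have K1: "linear (\<lambda>w. K w u v)" and K2: "linear (\<lambda>u. K w u v)" and K3: "linear (\<lambda>v. K w u v)" for u v w
    unfolding K_def by (intro half linear_compose_sub linear_compose_add L1 L2 L3)+
  define \<Gamma> where "\<Gamma> w u = (\<Sum>i<DIM('e). K w u (E ! i) *\<^sub>R E ! i)" for w u
  have \<Gamma>: "g x [\<Gamma> w u, v] = K w u v" for w u v
  proof -
    note lin = inner_product_linear[OF ip]
    have "g x [\<Gamma> w u, v] = (\<Sum>i<DIM('e). K w u (E ! i) * g x [E ! i, v])"
      unfolding \<Gamma>_def by (simp add: linear_sum[OF lin(1)] linear_cmul[OF lin(1)])
    also have "\<dots> = K w u (\<Sum>i<DIM('e). g x [E ! i, v] *\<^sub>R E ! i)"
      by (simp add: linear_sum[OF K3] linear_cmul[OF K3] mult.commute)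
    finally show ?thesis using orthonormal_frame_expand[OF ml E, of v] by simp
  qed
  have sym: "D (\<lambda>y. g y [u, v]) x w = D (\<lambda>y. g y [v, u]) x w" for u v w
    using D_cong[OF assms(1,2), of "\<lambda>y. g y [u, v]" "\<lambda>y. g y [v, u]"] assms(3) inner_product_sym by metis
  have "is_levi_civita g x \<Gamma>"
    unfolding is_levi_civita_def
  proof (intro conjI allI)
    show "bilinear \<Gamma>"
      unfolding bilinear_def \<Gamma>_def
      by (intro conjI allI linear_compose_sum ballI linear_scaleR_left K1 K2)
    show "\<Gamma> u v = \<Gamma> v u" for u v
      unfolding \<Gamma>_def K_def using sym[of u v] by (simp add: add.commute)
    show "D (\<lambda>y. g y [u, v]) x w = g x [\<Gamma> w u, v] + g x [u, \<Gamma> w v]" for u v w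
      unfolding inner_product_sym[OF ip, of u] \<Gamma> K_def using sym[of u v] sym[of v w] sym[of u w]
      by (simp add: field_simps)
  qed
  then show ?thesis using levi_civita_unique[of g x \<Gamma>] ip by simp
qed

lemma cov_deriv_2:
  "cov_deriv g t x [p, u, v] = D (\<lambda>y. t y [u, v]) x p - t x [levi_civita g x p u, v] - t x [u, levi_civita g x p v]"
  by (simp add: cov_deriv_def Let_def numeral_2_eq_2 lessThan_Suc)

lemma cov_deriv_3:
  "cov_deriv g t x [p, u, v, w] = D (\<lambda>y. t y [u, v, w]) x p - t x [levi_civita g x p u, v, w]
     - t x [u, levi_civita g x p v, w] - t x [u, v, levi_civita g x p w]"
  by (simp add: cov_deriv_def Let_def numeral_3_eq_3 lessThan_Suc)

lemma ext_d_2: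
  "ext_d 2 t x [u, v, w] = D (\<lambda>y. t y [v, w]) x u - D (\<lambda>y. t y [u, w]) x v + D (\<lambda>y. t y [u, v]) x w"
  by (simp add: ext_d_def numeral_2_eq_2 lessThan_Suc)

lemma ext_d_3:
  "ext_d 3 t x [u, v, w, z] = D (\<lambda>y. t y [v, w, z]) x u - D (\<lambda>y. t y [u, w, z]) x v
     + D (\<lambda>y. t y [u, v, z]) x w - D (\<lambda>y. t y [u, v, w]) x z"
  by (simp add: ext_d_def numeral_3_eq_3 lessThan_Suc)

section \<open>Pointwise \<open>SU(3)\<close>-geometry\<close>

lemma sum_lessThan_3: "(\<Sum>i<3. f i) = f 0 + f 1 + f (2 :: nat)"
  and sum_lessThan_6: "(\<Sum>i<DIM(real ^ 6). f i) = f 0 + f 1 + f 2 + f 3 + f 4 + f (5 :: nat)"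
  by (simp_all add: eval_nat_numeral add_ac)

locale hermitian_point =
  fixes g :: "(real ^ 6, real) tensor" and J :: "real ^ 6 \<Rightarrow> real ^ 6" and \<Omega> :: "(real ^ 6, complex) tensor"
  assumes ip: "inner_product g" and linear_J: "linear J" and JJ: "J (J v) = - v"
    and g_J_J: "g [J u, J v] = g [u, v]"
    and Om_multilinear: "multilinear 3 \<Omega>" and Om_alternating: "alternating 3 \<Omega>"
    and Om_J: "\<Omega> [J u, v, w] = \<i> * \<Omega> [u, v, w]"
begin

lemma g_linear: "linear (\<lambda>u. g [u, v])" "linear (\<lambda>v. g [u, v])"
  using inner_product_linear[OF ip] by blast+

lemma g_sym: "g [u, v] = g [v, u]" by (rule inner_product_sym[OF ip])

lemma g_multilinear: "multilinear 2 g" using ip by (simp add: inner_product_def)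

lemma g_J: "g [J u, v] = - g [u, J v]"
  using g_J_J[of "J u" v] linear_neg[OF g_linear(1)] by (simp add: JJ)

lemma g_J_self: "g [u, J u] = 0" "g [J u, u] = 0"
  using g_J[of u u] g_sym[of u "J u"] by auto

lemma Om_linear: "linear (\<lambda>u. \<Omega> [u, v, w])" "linear (\<lambda>u. \<Omega> [v, u, w])" "linear (\<lambda>u. \<Omega> [v, w, u])"
  using Om_multilinear multilinear_3 by blast+

lemma Om_skew: "skew 3 \<Omega>" by (rule alternating_skew[OF Om_multilinear Om_alternating])

lemma Om_swap12: "\<Omega> [v, u, w] = - \<Omega> [u, v, w]"
  using skewD[OF Om_skew, of "[]" v u "[w]"] by simp

lemma Om_swap23: "\<Omega> [u, w, v] = - \<Omega> [u, v, w]"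
  using skewD[OF Om_skew, of "[u]" w v "[]"] by simp

lemma Om_swap13: "\<Omega> [w, v, u] = - \<Omega> [u, v, w]"
  using Om_swap12[of w v u] Om_swap23[of v w u] Om_swap12[of v u w] by simp

lemma Om_rot: "\<Omega> [v, w, u] = \<Omega> [u, v, w]" "\<Omega> [w, u, v] = \<Omega> [u, v, w]"
  using Om_swap12 Om_swap23 by (metis add.inverse_inverse)+

lemma Om_same: "\<Omega> [u, u, w] = 0" "\<Omega> [u, w, u] = 0" "\<Omega> [w, u, u] = 0"
  using Om_swap12[of u u w] Om_swap13[of u w u] Om_swap23[of w u u] by simp_all

lemma Om_J2: "\<Omega> [u, J v, w] = \<i> * \<Omega> [u, v, w]" and Om_J3: "\<Omega> [u, v, J w] = \<i> * \<Omega> [u, v, w]"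
  using Om_J[of v u w] Om_swap12[of u "J v" w] Om_swap12[of u v w] Om_J[of w v u] Om_swap13[of u v "J w"] Om_swap13[of u v w]
  by simp_all

text \<open>The complex vector space structure that J puts on the tangent space. With respect to it
  \<Omega> is complex trilinear.\<close>

definition cscale :: "complex \<Rightarrow> real ^ 6 \<Rightarrow> real ^ 6" where
  "cscale z v = Re z *\<^sub>R v + Im z *\<^sub>R J v"

lemma Om_cscale:
  "\<Omega> [cscale z u, v, w] = z * \<Omega> [u, v, w]"
  "\<Omega> [u, cscale z v, w] = z * \<Omega> [u, v, w]"
  "\<Omega> [u, v, cscale z w] = z * \<Omega> [u, v, w]"
  unfolding cscale_def
  by (simp_all add: linear_add[OF Om_linear(1)] linear_cmul[OF Om_linear(1)] Om_J
      linear_add[OF Om_linear(2)] linear_cmul[OF Om_linear(2)] Om_J2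
      linear_add[OF Om_linear(3)] linear_cmul[OF Om_linear(3)] Om_J3 complex_eq_iff algebra_simps)

lemma g_cscale: "g [cscale z v, cscale z v] = (cmod z)\<^sup>2 * g [v, v]"
  unfolding cscale_def cmod_power2
  by (simp add: linear_add[OF g_linear(1)] linear_cmul[OF g_linear(1)]
      linear_add[OF g_linear(2)] linear_cmul[OF g_linear(2)] g_J_J g_J_self algebra_simps power2_eq_square)

definition unitary_frame :: "(real ^ 6) list \<Rightarrow> bool" where
  "unitary_frame E \<longleftrightarrow> orthonormal_frame g E \<and> E ! 1 = J (E ! 0) \<and> E ! 3 = J (E ! 2) \<and> E ! 5 = J (E ! 4)"

text \<open>Expresses that the orthogonal complement of \<open>L\<close> is preserved by J. This is
  the invariant of a Gram-Schmidt process that adds vectors in pairs v, J v, each v taken from the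
  complement.\<close>

definition J_closed :: "(real ^ 6) list \<Rightarrow> bool" where
  "J_closed L \<longleftrightarrow> (\<forall>v. (\<forall>e\<in>set L. g [e, v] = 0) \<longrightarrow> (\<forall>e\<in>set L. g [e, J v] = 0))"

lemma J_closed_extend:
  assumes "orthonormal_list g L" "J_closed L" "g [v, v] = 1" "\<And>e. e \<in> set L \<Longrightarrow> g [e, v] = 0"
  shows "orthonormal_list g (L @ [v, J v])" "J_closed (L @ [v, J v])"
proof -
  have 1: "orthonormal_list g (L @ [v])" by (rule orthonormal_snoc[OF ip assms(1,3,4)])
  have 2: "g [e, J v] = 0" if "e \<in> set (L @ [v])" for e
    using that assms(2,4) g_J_self unfolding J_closed_def by auto
  have "g [J v, J v] = 1" using assms(3) g_J_J by simp
  from orthonormal_snoc[OF ip 1 this 2] have "orthonormal_list g ((L @ [v]) @ [J v])" .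
  then show "orthonormal_list g (L @ [v, J v])" by simp
  show "J_closed (L @ [v, J v])"
    using assms(2) g_J[of v] g_J_J unfolding J_closed_def by auto
qed

text \<open>Multiplying the last complex basis vector by a unit complex number keeps the frame
  unitary and multiplies \<Omega> on the even vectors by that number. The second claim records this
  freedom for normalising \<Omega>.\<close>

lemma unitary_frame_exists:
  obtains E where "unitary_frame E"
    "\<And>z. cmod z = 1 \<Longrightarrow> \<exists>E'. unitary_frame E' \<and> \<Omega> [E' ! 0, E' ! 2, E' ! 4] = z * \<Omega> [E ! 0, E ! 2, E ! 4]"
proof -
  have "orthonormal_list g []" "J_closed []" by (auto simp: orthonormal_list_def J_closed_def)
  moreover obtain a where "g [a, a] = 1" using orthonormal_extend[OF ip, of "[]"] calculation(1) by auto
  ultimately have 1: "orthonormal_list g [a, J a]" "J_closed [a, J a]"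
    using J_closed_extend[of "[]" a] by auto
  then obtain b where "g [b, b] = 1" "\<And>e. e \<in> set [a, J a] \<Longrightarrow> g [e, b] = 0"
    using orthonormal_extend[OF ip 1(1)] by auto
  from J_closed_extend[OF 1 this] have 2: "orthonormal_list g [a, J a, b, J b]" "J_closed [a, J a, b, J b]" by auto
  then obtain c where c: "g [c, c] = 1" "\<And>e. e \<in> set [a, J a, b, J b] \<Longrightarrow> g [e, c] = 0"
    using orthonormal_extend[OF ip 2(1)] by auto
  have 3: "unitary_frame [a, J a, b, J b, cscale z c, J (cscale z c)]" if z: "cmod z = 1" for z
  proof -
    have "g [cscale z c, cscale z c] = 1" using g_cscale[of z c] z c by simp
    moreover have "g [e, cscale z c] = 0" if e: "e \<in> set [a, J a, b, J b]" for e
    proof -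
      have "g [e, J c] = 0" using 2(2) c(2) e unfolding J_closed_def by blast
      then show ?thesis
        unfolding cscale_def using c(2)[OF e] by (simp add: linear_add[OF g_linear(2)] linear_cmul[OF g_linear(2)])
    qed
    ultimately show ?thesis
      using J_closed_extend(1)[OF 2] unfolding unitary_frame_def orthonormal_frame_iff by simp
  qed
  show thesis
  proof (rule that[of "[a, J a, b, J b, cscale 1 c, J (cscale 1 c)]"])
    show "unitary_frame [a, J a, b, J b, cscale 1 c, J (cscale 1 c)]" by (rule 3) simp
    fix z :: complex assume "cmod z = 1"
    then show "\<exists>E'. unitary_frame E' \<and> \<Omega> [E' ! 0, E' ! 2, E' ! 4] =
        z * \<Omega> [[a, J a, b, J b, cscale 1 c, J (cscale 1 c)] ! 0, [a, J a, b, J b, cscale 1 c, J (cscale 1 c)] ! 2,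
          [a, J a, b, J b, cscale 1 c, J (cscale 1 c)] ! 4]"
      by (intro exI[of _ "[a, J a, b, J b, cscale z c, J (cscale z c)]"]) (simp add: 3 Om_cscale)
  qed
qed

end

section \<open>Unitary frames and \<Omega> as a complex determinant\<close>

locale unitary = hermitian_point +
  fixes E assumes unitary_frame: "unitary_frame E"
begin

lemma frame_g: "i < 6 \<Longrightarrow> j < 6 \<Longrightarrow> g [E ! i, E ! j] = (if i = j then 1 else 0)"
  using unitary_frame by (auto simp: unitary_frame_def orthonormal_frame_def)

lemma frame_J: "J (E ! 0) = E ! 1" "J (E ! 1) = - E ! 0" "J (E ! 2) = E ! 3" "J (E ! 3) = - E ! 2"
  "J (E ! 4) = E ! 5" "J (E ! 5) = - E ! 4"
  using unitary_frame JJ by (auto simp: unitary_frame_def)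

lemma length_frame: "length E = 6"
  using unitary_frame by (auto simp: unitary_frame_def orthonormal_frame_def)

lemma frame_orthonormal: "orthonormal_frame g E"
  using unitary_frame by (simp add: unitary_frame_def)

lemma frame_span: "span (set E) = UNIV"
  by (rule orthonormal_frame_span[OF g_multilinear frame_orthonormal])

lemma Om_even: "js \<in> index_lists 3 3 \<Longrightarrow>
  \<Omega> (map (\<lambda>j. E ! (2 * j)) js) = of_int (eps js) * \<Omega> [E ! 0, E ! 2, E ! 4]"
proof (rule skew_eqI[where A = "{..<3}" and k = 3])
  show "skew 3 (\<lambda>js. \<Omega> (map (\<lambda>j. E ! (2 * j)) js))" by (rule skew_map[OF Om_skew])
  show "skew 3 (\<lambda>js. complex_of_int (eps js) * \<Omega> [E ! 0, E ! 2, E ! 4])"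
    unfolding skew_def
  proof (intro allI impI)
    show "complex_of_int (eps (xs @ x # y # zs)) * \<Omega> [E ! 0, E ! 2, E ! 4] =
      - (complex_of_int (eps (xs @ y # x # zs)) * \<Omega> [E ! 0, E ! 2, E ! 4])" for xs x y zs
      by (simp add: eps_swap[of xs x y])
  qed
  fix vs :: "nat list" assume "length vs = 3" "set vs \<subseteq> {..<3}" "sorted vs" "distinct vs"
  then have "vs = [0..<3]" by (rule sorted_distinct_full)
  then have vs: "vs = [0, 1, 2]" by (simp add: upt_rec)
  show "\<Omega> (map (\<lambda>j. E ! (2 * j)) vs) = complex_of_int (eps vs) * \<Omega> [E ! 0, E ! 2, E ! 4]"
    unfolding vs by simp
qed (auto simp: index_lists_def)

lemma frame_even: assumes "a < 6" shows "E ! a = cscale (\<i> ^ (a mod 2)) (E ! (2 * (a div 2)))"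
proof -
  have "a = 0 \<or> a = 1 \<or> a = 2 \<or> a = 3 \<or> a = 4 \<or> a = 5" using assms by arith
  then show ?thesis by (elim disjE) (simp_all add: cscale_def frame_J)
qed

text \<open>The index \<open>a\<close> stands for the complex direction \<open>a div 2\<close>, with
  one application of J when \<open>a\<close> is odd; each J contributes a factor \<i>.\<close>

lemma Om_frame:
  assumes "a < 6" "b < 6" "c < 6"
  shows "\<Omega> [E ! a, E ! b, E ! c] =
    of_int (eps [a div 2, b div 2, c div 2]) * \<i> ^ (a mod 2 + b mod 2 + c mod 2) * \<Omega> [E ! 0, E ! 2, E ! 4]"
proof -
  have "[a div 2, b div 2, c div 2] \<in> index_lists 3 3" using assms by (auto simp: index_lists_def)
  from Om_even[OF this] show ?thesis
    by (simp only: frame_even[OF assms(1)] frame_even[OF assms(2)] frame_even[OF assms(3)] Om_cscale)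
      (simp add: power_add)
qed

definition coord_z :: "nat \<Rightarrow> real ^ 6 \<Rightarrow> complex" where
  "coord_z j u = Complex (g [E ! (2 * j), u]) (g [E ! (2 * j + 1), u])"

lemma coord_z_eq:
  "coord_z 0 u = Complex (g [E ! 0, u]) (g [E ! 1, u])"
  "coord_z 1 u = Complex (g [E ! 2, u]) (g [E ! 3, u])"
  "coord_z 2 u = Complex (g [E ! 4, u]) (g [E ! 5, u])"
  by (simp_all add: coord_z_def eval_nat_numeral)

lemma expand_complex:
  "u = cscale (coord_z 0 u) (E ! 0) + cscale (coord_z 1 u) (E ! 2) + cscale (coord_z 2 u) (E ! 4)"
  by (subst orthonormal_frame_expand[OF g_multilinear frame_orthonormal, of u])
    (unfold sum_lessThan_6 cscale_def coord_z_eq frame_J, simp add: add_ac)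

text \<open>A complex trilinear alternating form in three complex dimensions is a multiple of the
  determinant, here expanded along the coordinates of \<open>u\<close>.\<close>

lemma Om_det:
  "\<Omega> [u, v, w] = \<Omega> [E ! 0, E ! 2, E ! 4] *
    (coord_z 0 u * (coord_z 1 v * coord_z 2 w - coord_z 2 v * coord_z 1 w)
   - coord_z 1 u * (coord_z 0 v * coord_z 2 w - coord_z 2 v * coord_z 0 w)
   + coord_z 2 u * (coord_z 0 v * coord_z 1 w - coord_z 1 v * coord_z 0 w))"
proof -
  note [simp] = linear_add[OF Om_linear(1)] linear_add[OF Om_linear(2)] linear_add[OF Om_linear(3)] Om_cscale Om_same
  let ?e = "\<Omega> [E ! 0, E ! 2, E ! 4]"
  have o: "\<Omega> [E ! 2, E ! 4, E ! 0] = ?e" "\<Omega> [E ! 4, E ! 0, E ! 2] = ?e"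
    "\<Omega> [E ! 2, E ! 0, E ! 4] = - ?e" "\<Omega> [E ! 0, E ! 4, E ! 2] = - ?e" "\<Omega> [E ! 4, E ! 2, E ! 0] = - ?e"
    by (rule Om_rot Om_swap12 Om_swap23 Om_swap13)+
  show ?thesis
    apply (subst expand_complex[of u]) apply (subst expand_complex[of v]) apply (subst expand_complex[of w])
    apply (simp only: linear_add[OF Om_linear(1)] linear_add[OF Om_linear(2)] linear_add[OF Om_linear(3)] Om_cscale Om_same o)
    apply (simp add: algebra_simps)
    done
qed

lemma g_coord: "g [u, v] = (\<Sum>j<3. Re (coord_z j u) * Re (coord_z j v) + Im (coord_z j u) * Im (coord_z j v))"
  unfolding orthonormal_frame_inner_product(2)[OF g_multilinear frame_orthonormal, of u v] sum_lessThan_3 sum_lessThan_6 coord_z_eq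
  by (simp add: add_ac)

lemma coord_J: "j < 3 \<Longrightarrow> coord_z j (J u) = \<i> * coord_z j u"
proof -
  assume "j < 3"
  then have "j = 0 \<or> j = 1 \<or> j = 2" by arith
  then show ?thesis
    using g_J[of "E ! 0" u] g_J[of "E ! 1" u] g_J[of "E ! 2" u] g_J[of "E ! 3" u] g_J[of "E ! 4" u] g_J[of "E ! 5" u]
      linear_neg[OF g_linear(1)]
    by (elim disjE) (simp_all add: coord_z_def frame_J frame_J(2)[simplified] complex_eq_iff)
qed

lemma Re_Om_frame:
  assumes "\<Omega> [E ! 0, E ! 2, E ! 4] = 1"
  shows "Re (\<Omega> [u, E ! 2, E ! 4]) = g [u, E ! 0]" "Re (\<Omega> [E ! 0, u, E ! 4]) = g [u, E ! 2]"
    "Re (\<Omega> [E ! 0, E ! 2, u]) = g [u, E ! 4]"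
  unfolding Om_det[of u] Om_det[of _ u] Om_det[of _ _ u] assms
  by (simp_all add: coord_z_def frame_g g_sym[of u])

text \<open>The Gram determinant of the hermitian form \<open>g - \<i> \<omega>\<close>, written out in real terms.\<close>
lemma Om_norm_sq:
  defines "\<omega> \<equiv> \<lambda>u v. g [J u, v]"
  assumes "cmod (\<Omega> [E ! 0, E ! 2, E ! 4]) = 1"
  shows "(Re (\<Omega> [u, v, w]))\<^sup>2 + (Im (\<Omega> [u, v, w]))\<^sup>2 =
    g [u, u] * g [v, v] * g [w, w] - g [u, u] * ((g [v, w])\<^sup>2 + (\<omega> v w)\<^sup>2)
    - g [v, v] * ((g [w, u])\<^sup>2 + (\<omega> w u)\<^sup>2) - g [w, w] * ((g [u, v])\<^sup>2 + (\<omega> u v)\<^sup>2)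
    + 2 * (g [u, v] * g [v, w] * g [w, u] - g [u, v] * \<omega> v w * \<omega> w u
         - \<omega> u v * g [v, w] * \<omega> w u - \<omega> u v * \<omega> v w * g [w, u])"
proof -
  define h where "h u v = coord_z 0 u * cnj (coord_z 0 v) + coord_z 1 u * cnj (coord_z 1 v) + coord_z 2 u * cnj (coord_z 2 v)" for u v
  have h: "h u v = Complex (g [u, v]) (- \<omega> u v)" for u v
    unfolding h_def \<omega>_def g_coord sum_lessThan_3 by (simp add: complex_eq_iff coord_J coord_J[of 1, simplified] algebra_simps)
  have "complex_of_real ((Re (\<Omega> [u, v, w]))\<^sup>2 + (Im (\<Omega> [u, v, w]))\<^sup>2) = \<Omega> [u, v, w] * cnj (\<Omega> [u, v, w])"
    by (simp add: complex_mult_cnj)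
  also have "\<dots> = (\<Omega> [E ! 0, E ! 2, E ! 4] * cnj (\<Omega> [E ! 0, E ! 2, E ! 4])) *
    (h u u * h v v * h w w + h u v * h v w * h w u + h u w * h v u * h w v
     - h u u * h v w * h w v - h u w * h v v * h w u - h u v * h v u * h w w)"
    unfolding Om_det[of u v w] h_def complex_cnj_mult complex_cnj_add complex_cnj_diff by algebra
  also have "\<Omega> [E ! 0, E ! 2, E ! 4] * cnj (\<Omega> [E ! 0, E ! 2, E ! 4]) = 1"
    using assms(2) by (simp add: complex_norm_square[symmetric])
  finally have "complex_of_real ((Re (\<Omega> [u, v, w]))\<^sup>2 + (Im (\<Omega> [u, v, w]))\<^sup>2) =
    h u u * h v v * h w w + h u v * h v w * h w u + h u w * h v u * h w v
     - h u u * h v w * h w v - h u w * h v v * h w u - h u v * h v u * h w w" by simp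
  from arg_cong[OF this, of Re]
  have *: "(Re (\<Omega> [u, v, w]))\<^sup>2 + (Im (\<Omega> [u, v, w]))\<^sup>2 = Re (h u u * h v v * h w w + h u v * h v w * h w u + h u w * h v u * h w v
     - h u u * h v w * h w v - h u w * h v v * h w u - h u v * h v u * h w w)" by (simp only: Re_complex_of_real)
  have sw: "\<omega> v u = - \<omega> u v" "\<omega> u u = 0" for u v
    unfolding \<omega>_def using g_J[of v u] g_sym[of v "J u"] g_J_self by auto
  show ?thesis
    unfolding * h sw(2) sw(1)[of v u] sw(1)[of w v] sw(1)[of u w] g_sym[of v u] g_sym[of w v] g_sym[of u w]
    by (simp add: algebra_simps power2_eq_square)
qed

end

text \<open>The contribution of one permutation to the wedge of \<Omega> with its conjugate on a
  unitary frame, up to the common factor \<i> |\<Omega>(E0, E2, E4)|^2. The last factor is what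
  remains of the powers of \<i> from the odd indices.\<close>

definition volume_weight :: "nat list \<Rightarrow> int" where
  "volume_weight js = eps js * eps (map (\<lambda>j. j div 2) (take 3 js)) * eps (map (\<lambda>j. j div 2) (drop 3 js))
     * (- 1) ^ sum_list (map (\<lambda>j. j mod 2) (take 3 js))"

text \<open>-288 = -8 * 3! * 3!, so that the normalised wedge has the coefficient -8 that the factor
  \<i> / 8 in the volume condition turns into 1.\<close>

lemma volume_weight: "sum_list (map volume_weight (permutations_of_set_list [0..<6])) = - 288"
  by code_simp

lemma (in unitary) wedge_Om_cnj:
  "wedge 3 3 \<Omega> (\<lambda>us. cnj (\<Omega> us)) E = - 8 * \<i> * (complex_of_real (cmod (\<Omega> [E ! 0, E ! 2, E ! 4])))\<^sup>2"
proof -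
  let ?z = "\<Omega> [E ! 0, E ! 2, E ! 4]"
  have entry: "of_int (eps js) * (\<Omega> (map ((!) E) (take 3 js)) * cnj (\<Omega> (map ((!) E) (drop 3 js)))) =
      \<i> * (?z * cnj ?z) * of_int (volume_weight js)" if "js \<in> set (permutations_of_set_list [0..<6])" for js
  proof -
    have js: "js \<in> permutations_of_set {0..<6}"
      using that permutations_of_list[of "[0..<6]"] by (simp add: distinct_remdups_id)
    then have s: "set js = {0..<6}" "distinct js" by (auto simp: permutations_of_set_def)
    have "length js = 6" using length_finite_permutations_of_set[OF js] by simp
    then obtain a b c d e f where abc: "js = [a, b, c, d, e, f]"
      by (auto simp: length_Suc_conv eval_nat_numeral)
    have lt: "a < 6" "b < 6" "c < 6" "d < 6" "e < 6" "f < 6" using s(1) unfolding abc by auto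
    have "sum_list (map (\<lambda>j. j mod 2) js) = (\<Sum>j\<in>{0..<6}. j mod 2)"
      using s by (simp add: sum_list_distinct_conv_sum_set)
    also have "{0..<6::nat} = {0, 1, 2, 3, 4, 5}" by auto
    also have "(\<Sum>j\<in>{0, 1, 2, 3, 4, 5}. j mod 2) = (3 :: nat)" by simp
    finally have p: "(a mod 2 + b mod 2 + c mod 2) + (d mod 2 + e mod 2 + f mod 2) = 3" unfolding abc by simp
    \<comment> \<open>Three of the indices 0 to 5 are odd; s of them fall into \<Omega> and t = 3 -
      s into its conjugate.\<close>
    have q: "\<i> ^ s * cnj (\<i> ^ t) = \<i> * (- 1) ^ s" if "s + t = 3" for s t :: nat
    proof -
      have "s = 0 \<and> t = 3 \<or> s = 1 \<and> t = 2 \<or> s = 2 \<and> t = 1 \<or> s = 3 \<and> t = 0" using that by arith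
      then show ?thesis by (elim disjE) (auto simp: power3_eq_cube power2_eq_square)
    qed
    have "of_int (eps js) * (\<Omega> (map ((!) E) (take 3 js)) * cnj (\<Omega> (map ((!) E) (drop 3 js)))) =
        of_int (eps js) * of_int (eps [a div 2, b div 2, c div 2]) * of_int (eps [d div 2, e div 2, f div 2]) *
        (\<i> ^ (a mod 2 + b mod 2 + c mod 2) * cnj (\<i> ^ (d mod 2 + e mod 2 + f mod 2))) * (?z * cnj ?z)"
    proof -
      have "map ((!) E) (take 3 js) = [E ! a, E ! b, E ! c]" "map ((!) E) (drop 3 js) = [E ! d, E ! e, E ! f]"
        by (simp_all add: abc)
      then show ?thesis
        by (simp only: Om_frame[OF lt(1,2,3)] Om_frame[OF lt(4,5,6)] complex_cnj_mult complex_cnj_of_int mult_ac)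
    qed
    also have "\<dots> = \<i> * (?z * cnj ?z) * of_int (volume_weight js)"
      unfolding q[OF p] by (simp add: abc volume_weight_def add.assoc del: eps.simps)
    finally show ?thesis .
  qed
  have "wedge 3 3 \<Omega> (\<lambda>us. cnj (\<Omega> us)) E =
      sum_list (map (\<lambda>js. \<i> * (?z * cnj ?z) * of_int (volume_weight js)) (permutations_of_set_list [0..<6])) / (fact 3 * fact 3)"
    unfolding wedge_list using entry by (simp cong: map_cong)
  also have "\<dots> = \<i> * (?z * cnj ?z) * of_int (sum_list (map volume_weight (permutations_of_set_list [0..<6]))) / (fact 3 * fact 3)"
    by (simp add: sum_list_const_mult of_int_sum_list o_def)
  also have "\<dots> = - 8 * \<i> * (?z * cnj ?z)"
    unfolding volume_weight by (simp add: fact_numeral)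
  finally show ?thesis by (simp add: complex_norm_square[symmetric])
qed

locale SU3_point = hermitian_point +
  fixes \<omega> :: "(real ^ 6, real) tensor"
  assumes om: "\<omega> [u, v] = g [J u, v]"
    and volume: "orthonormal_frame g E \<Longrightarrow> \<bar>1 / 6 * omega_cubed \<omega> E\<bar> = 1"
    and volume_Om: "length vs = 6 \<Longrightarrow> complex_of_real (1 / 6 * omega_cubed \<omega> vs) =
           \<i> / 8 * wedge 3 3 \<Omega> (\<lambda>us. cnj (\<Omega> us)) vs"
begin

text \<open>The volume condition identifies the squared modulus with the value of \<omega>^3 / 6 on
  the frame. That value is 1 up to sign, and a square is not negative.\<close>

lemma unitary_norm: "unitary_frame E \<Longrightarrow> cmod (\<Omega> [E ! 0, E ! 2, E ! 4]) = 1"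
proof -
  assume "unitary_frame E"
  then interpret unitary g J \<Omega> E by unfold_locales
  let ?n = "cmod (\<Omega> [E ! 0, E ! 2, E ! 4])"
  have "complex_of_real (1 / 6 * omega_cubed \<omega> E) = complex_of_real (?n\<^sup>2)"
    using volume_Om[OF length_frame] unfolding wedge_Om_cnj by simp
  then have "1 / 6 * omega_cubed \<omega> E = ?n\<^sup>2" by (simp only: of_real_eq_iff)
  then have "?n\<^sup>2 = 1" using volume[OF frame_orthonormal] by simp
  then show ?thesis using norm_ge_zero[of "\<Omega> [E ! 0, E ! 2, E ! 4]"] by (auto simp: power2_eq_1_iff)
qed

lemma special_frame_exists:
  assumes "cmod z = 1"
  obtains E where "unitary_frame E" "z * \<Omega> [E ! 0, E ! 2, E ! 4] = 1"
proof -
  obtain E where E: "unitary_frame E"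
    "\<And>z. cmod z = 1 \<Longrightarrow> \<exists>E'. unitary_frame E' \<and> \<Omega> [E' ! 0, E' ! 2, E' ! 4] = z * \<Omega> [E ! 0, E ! 2, E ! 4]"
    using unitary_frame_exists by blast
  let ?z = "\<Omega> [E ! 0, E ! 2, E ! 4]"
  have n: "cmod (z * ?z) = 1" using assms unitary_norm[OF E(1)] by (simp add: norm_mult)
  \<comment> \<open>Turning by the conjugate of z \<Omega>(E0, E2, E4) replaces this unit number by
    its squared modulus, which is 1.\<close>
  then obtain E' where E': "unitary_frame E'" "\<Omega> [E' ! 0, E' ! 2, E' ! 4] = cnj (z * ?z) * ?z"
    using E(2)[of "cnj (z * ?z)"] complex_mod_cnj[of "z * ?z"] by metis
  have "z * \<Omega> [E' ! 0, E' ! 2, E' ! 4] = (z * ?z) * cnj (z * ?z)" unfolding E' by (simp only: mult_ac)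
  also have "\<dots> = 1" using n by (metis complex_norm_square of_real_1 power_one)
  finally show thesis using that E' by blast
qed

lemma om_skew: "\<omega> [v, u] = - \<omega> [u, v]" unfolding om using g_J[of v u] g_sym by simp

lemma om_self: "\<omega> [u, u] = 0" unfolding om by (rule g_J_self)

lemma om_J: "\<omega> [J u, v] = - g [u, v]" "\<omega> [u, J v] = g [u, v]"
  unfolding om using linear_neg[OF g_linear(1)] by (simp_all add: JJ g_J_J)

lemma om_multilinear: "multilinear 2 \<omega>"
  unfolding multilinear_2 om
  using linear_compose[OF linear_J g_linear(1), unfolded o_def] g_linear(2) by blast

end

section \<open>The structure equations of a nearly Kaehler manifold\<close>

definition triples :: "nat list list" where
  "triples = [[0, 1, 2], [0, 1, 3], [0, 1, 4], [0, 1, 5], [0, 2, 3], [0, 2, 4], [0, 2, 5], [0, 3, 4], [0, 3, 5], [0, 4, 5], [1, 2, 3], [1, 2, 4], [1, 2, 5], [1, 3, 4], [1, 3, 5], [1, 4, 5], [2, 3, 4], [2, 3, 5], [2, 4, 5], [3, 4, 5]]"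

lemma sorted_triple:
  assumes "length js = 3" "set js \<subseteq> {..<6}" "sorted js" "distinct js"
  shows "js \<in> set triples"
proof -
  obtain a b c where js: "js = [a, b, c]"
    using assms(1) by (auto simp: length_Suc_conv eval_nat_numeral)
  have "list_all (\<lambda>c. list_all (\<lambda>b. list_all (\<lambda>a. [a, b, c] \<in> set triples) [0..<b]) [0..<c]) [0..<6]"
    by code_simp
  moreover have "a < b" "b < c" "c < 6" using assms(2-4) unfolding js by auto
  ultimately show ?thesis unfolding js by (simp add: list_all_iff)
qed

text \<open>The derivative of a Gram determinant where the Gram matrix is the identity is the trace:
  every term with an off-diagonal entry contains at least two of them.\<close>

lemma gram_derivative:
  fixes a b c d1 d2 d3 e1 e2 e3 :: "'e::real_normed_vector \<Rightarrow> real"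
  assumes d: "(a has_derivative a') (at x)" "(b has_derivative b') (at x)" "(c has_derivative c') (at x)"
    "d1 differentiable (at x)" "d2 differentiable (at x)" "d3 differentiable (at x)"
    "e1 differentiable (at x)" "e2 differentiable (at x)" "e3 differentiable (at x)"
    and v: "a x = 1" "b x = 1" "c x = 1" "d1 x = 0" "d2 x = 0" "d3 x = 0" "e1 x = 0" "e2 x = 0" "e3 x = 0"
  shows "((\<lambda>y. a y * b y * c y - a y * ((d2 y)\<^sup>2 + (e2 y)\<^sup>2) - b y * ((d3 y)\<^sup>2 + (e3 y)\<^sup>2) - c y * ((d1 y)\<^sup>2 + (e1 y)\<^sup>2)
      + 2 * (d1 y * d2 y * d3 y - d1 y * e2 y * e3 y - e1 y * d2 y * e3 y - e1 y * e2 y * d3 y))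
    has_derivative (\<lambda>p. a' p + b' p + c' p)) (at x)"
  by (rule derivative_eq_intros d D_has_derivative refl)+ (simp add: v fun_eq_iff)

context SU3_point
begin

text \<open>Stated without a frame, because it is differentiated at a point: fixed vectors that are
  unitary there need not be unitary at neighbouring points.\<close>

lemma Om_norm_sq:
  "(Re (\<Omega> [u, v, w]))\<^sup>2 + (Im (\<Omega> [u, v, w]))\<^sup>2 =
    g [u, u] * g [v, v] * g [w, w] - g [u, u] * ((g [v, w])\<^sup>2 + (\<omega> [v, w])\<^sup>2)
    - g [v, v] * ((g [w, u])\<^sup>2 + (\<omega> [w, u])\<^sup>2) - g [w, w] * ((g [u, v])\<^sup>2 + (\<omega> [u, v])\<^sup>2)
    + 2 * (g [u, v] * g [v, w] * g [w, u] - g [u, v] * \<omega> [v, w] * \<omega> [w, u]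
         - \<omega> [u, v] * g [v, w] * \<omega> [w, u] - \<omega> [u, v] * \<omega> [v, w] * g [w, u])"
proof -
  obtain E where E: "unitary_frame E" using unitary_frame_exists by blast
  then interpret unitary g J \<Omega> E by unfold_locales
  show ?thesis unfolding om by (rule Om_norm_sq[OF unitary_norm[OF E]])
qed

end

locale NK_chart =
  fixes U :: "(real ^ 6) set" and g \<omega> :: "real ^ 6 \<Rightarrow> (real ^ 6, real) tensor"
    and J :: "real ^ 6 \<Rightarrow> real ^ 6 \<Rightarrow> real ^ 6" and \<Omega> :: "real ^ 6 \<Rightarrow> (real ^ 6, complex) tensor"
  assumes open_U: "open U"
    and SU3: "x \<in> U \<Longrightarrow> SU3_point (g x) (J x) (\<Omega> x) (\<omega> x)"
    and smooth_g: "smooth_on U (\<lambda>x. g x [u, v])" and smooth_J: "smooth_on U (\<lambda>x. J x v)"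
    and smooth_om: "smooth_on U (\<lambda>x. \<omega> x [u, v])" and smooth_Om: "smooth_on U (\<lambda>x. \<Omega> x [u, v, w])"
    and d_om: "x \<in> U \<Longrightarrow> ext_d 2 (\<omega>) x [u, v, w] = - 3 * Re (\<Omega> x [u, v, w])"
    and d_Im_Om: "x \<in> U \<Longrightarrow> ext_d 3 (\<lambda>y us. Im (\<Omega> y us)) x [u, v, w, z] = 2 * wedge 2 2 (\<omega> x) (\<omega> x) [u, v, w, z]"

locale NK_at = NK_chart +
  fixes x assumes x: "x \<in> U"
begin

sublocale SU3_point "g x" "J x" "\<Omega> x" "\<omega> x" by (rule SU3[OF x])

lemma diff_g: "(\<lambda>y. g y [u, v]) differentiable (at x)"
  and diff_J: "(\<lambda>y. J y v) differentiable (at x)"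
  and diff_om: "(\<lambda>y. \<omega> y [u, v]) differentiable (at x)"
  and diff_Om: "(\<lambda>y. \<Omega> y [u, v, w]) differentiable (at x)"
  by (rule smooth_on_differentiable[OF open_U _ x], rule smooth_g smooth_J smooth_om smooth_Om)+

lemma point_linear:
  assumes "y \<in> U"
  shows "linear (\<lambda>u. g y [u, v])" "linear (\<lambda>v. g y [u, v])" "linear (J y)"
    "linear (\<lambda>u. \<omega> y [u, v])" "linear (\<lambda>v. \<omega> y [u, v])"
    "linear (\<lambda>u. \<Omega> y [u, v, w])" "linear (\<lambda>v. \<Omega> y [u, v, w])" "linear (\<lambda>w. \<Omega> y [u, v, w])"
proof -
  interpret P: SU3_point "g y" "J y" "\<Omega> y" "\<omega> y" by (rule SU3[OF assms])
  show "linear (\<lambda>u. g y [u, v])" "linear (\<lambda>v. g y [u, v])" "linear (J y)" by (rule P.g_linear P.linear_J)+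
  show "linear (\<lambda>u. \<omega> y [u, v])" "linear (\<lambda>v. \<omega> y [u, v])" using P.om_multilinear multilinear_2 by blast+
  show "linear (\<lambda>u. \<Omega> y [u, v, w])" "linear (\<lambda>v. \<Omega> y [u, v, w])" "linear (\<lambda>w. \<Omega> y [u, v, w])"
    by (rule P.Om_linear)+
qed

section \<open>Covariant derivatives of \<omega>, J and \<Omega> and their symmetries\<close>

abbreviation "\<Gamma> \<equiv> levi_civita g x"

lemma is_levi_civita: "is_levi_civita g x \<Gamma>"
proof (rule levi_civita_exists[OF open_U x])
  show "inner_product (g y)" if "y \<in> U" for y
    using SU3[OF that] by (simp add: SU3_point_def hermitian_point_def)
qed (rule diff_g)

lemma Gam_sym: "\<Gamma> u v = \<Gamma> v u"
  using is_levi_civita unfolding is_levi_civita_def by blast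

lemma Gam_linear: "linear (\<Gamma> u)" "linear (\<lambda>u. \<Gamma> u v)"
  using is_levi_civita unfolding is_levi_civita_def bilinear_def by blast+

lemma metric_compat: "D (\<lambda>y. g y [u, v]) x w = g x [\<Gamma> w u, v] + g x [u, \<Gamma> w v]"
  using is_levi_civita unfolding is_levi_civita_def by blast

lemma om_linear: "linear (\<lambda>u. \<omega> x [u, v])" "linear (\<lambda>v. \<omega> x [u, v])"
  using point_linear[OF x] by blast+

text \<open>The covariant derivative of \<omega> in direction \<open>p\<close>; \<open>nOm\<close>
  and \<open>nJ\<close> are those of \<Omega> and J.\<close>

definition nom :: "real ^ 6 \<Rightarrow> real ^ 6 \<Rightarrow> real ^ 6 \<Rightarrow> real" where
  "nom p u v = D (\<lambda>y. \<omega> y [u, v]) x p - \<omega> x [\<Gamma> p u, v] - \<omega> x [u, \<Gamma> p v]"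

definition nOm :: "real ^ 6 \<Rightarrow> real ^ 6 \<Rightarrow> real ^ 6 \<Rightarrow> real ^ 6 \<Rightarrow> complex" where
  "nOm p u v w = D (\<lambda>y. \<Omega> y [u, v, w]) x p - \<Omega> x [\<Gamma> p u, v, w] - \<Omega> x [u, \<Gamma> p v, w] - \<Omega> x [u, v, \<Gamma> p w]"

definition nJ :: "real ^ 6 \<Rightarrow> real ^ 6 \<Rightarrow> real ^ 6" where
  "nJ p u = D (\<lambda>y. J y u) x p + \<Gamma> p (J x u) - J x (\<Gamma> p u)"

lemma nom_linear: "linear (\<lambda>p. nom p u v)" "linear (\<lambda>u. nom p u v)" "linear (\<lambda>v. nom p u v)"
proof -
  note l = linear_compose[unfolded o_def]
  show "linear (\<lambda>p. nom p u v)" unfolding nom_def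
    by (intro linear_compose_sub D_linear[OF diff_om] l[OF Gam_linear(2) om_linear(1)] l[OF Gam_linear(2) om_linear(2)])
  show "linear (\<lambda>u. nom p u v)" unfolding nom_def
    by (intro linear_compose_sub l[OF Gam_linear(1) om_linear(1)] om_linear(1) D_slot_linear[OF open_U x point_linear(4) diff_om])
  show "linear (\<lambda>v. nom p u v)" unfolding nom_def
    by (intro linear_compose_sub l[OF Gam_linear(1) om_linear(2)] om_linear(2) D_slot_linear[OF open_U x point_linear(5) diff_om])
qed

lemma nOm_linear: "linear (\<lambda>p. nOm p u v w)" "linear (\<lambda>u. nOm p u v w)" "linear (\<lambda>v. nOm p u v w)" "linear (\<lambda>w. nOm p u v w)"
proof -
  note l = linear_compose[unfolded o_def]
  show "linear (\<lambda>p. nOm p u v w)" unfolding nOm_def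
    by (intro linear_compose_sub D_linear[OF diff_Om] l[OF Gam_linear(2) Om_linear(1)] l[OF Gam_linear(2) Om_linear(2)] l[OF Gam_linear(2) Om_linear(3)])
  show "linear (\<lambda>u. nOm p u v w)" unfolding nOm_def
    by (intro linear_compose_sub l[OF Gam_linear(1) Om_linear(1)] Om_linear(1) D_slot_linear[OF open_U x point_linear(6) diff_Om])
  show "linear (\<lambda>v. nOm p u v w)" unfolding nOm_def
    by (intro linear_compose_sub l[OF Gam_linear(1) Om_linear(2)] Om_linear(2) D_slot_linear[OF open_U x point_linear(7) diff_Om])
  show "linear (\<lambda>w. nOm p u v w)" unfolding nOm_def
    by (intro linear_compose_sub l[OF Gam_linear(1) Om_linear(3)] Om_linear(3) D_slot_linear[OF open_U x point_linear(8) diff_Om])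
qed

lemma D_om_swap: "D (\<lambda>y. \<omega> y [v, u]) x p = - D (\<lambda>y. \<omega> y [u, v]) x p"
proof -
  have h: "((\<lambda>y. - \<omega> y [u, v]) has_derivative (\<lambda>p. - D (\<lambda>y. \<omega> y [u, v]) x p)) (at x)"
    by (intro has_derivative_minus D_has_derivative diff_om)
  have "- \<omega> y [u, v] = \<omega> y [v, u]" if "y \<in> U" for y
  proof -
    interpret P: SU3_point "g y" "J y" "\<Omega> y" "\<omega> y" by (rule SU3[OF that])
    show ?thesis using P.om_skew[of v u] by simp
  qed
  from D_eqI[OF has_derivative_transform_within_open[OF h open_U x this]] show ?thesis .
qed

lemma nom_skew: "nom p v u = - nom p u v"
  unfolding nom_def using D_om_swap[of v u p] om_skew[of "\<Gamma> p v" u] om_skew[of v "\<Gamma> p u"] by simp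

lemma D_Om_swap:
  "D (\<lambda>y. \<Omega> y [v, u, w]) x p = - D (\<lambda>y. \<Omega> y [u, v, w]) x p"
  "D (\<lambda>y. \<Omega> y [w, v, u]) x p = - D (\<lambda>y. \<Omega> y [u, v, w]) x p"
proof -
  have h: "((\<lambda>y. - \<Omega> y [u, v, w]) has_derivative (\<lambda>p. - D (\<lambda>y. \<Omega> y [u, v, w]) x p)) (at x)"
    by (intro has_derivative_minus D_has_derivative diff_Om)
  have *: "- \<Omega> y [u, v, w] = \<Omega> y [v, u, w]" "- \<Omega> y [u, v, w] = \<Omega> y [w, v, u]" if "y \<in> U" for y
  proof -
    interpret P: SU3_point "g y" "J y" "\<Omega> y" "\<omega> y" by (rule SU3[OF that])
    show "- \<Omega> y [u, v, w] = \<Omega> y [v, u, w]" "- \<Omega> y [u, v, w] = \<Omega> y [w, v, u]"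
      using P.Om_swap12[of v u w] P.Om_swap13[of w v u] by simp_all
  qed
  show "D (\<lambda>y. \<Omega> y [v, u, w]) x p = - D (\<lambda>y. \<Omega> y [u, v, w]) x p"
    "D (\<lambda>y. \<Omega> y [w, v, u]) x p = - D (\<lambda>y. \<Omega> y [u, v, w]) x p"
    by (rule D_eqI, rule has_derivative_transform_within_open[OF h open_U x], rule *, assumption)+
qed

lemma nOm_swap12: "nOm p v u w = - nOm p u v w"
  unfolding nOm_def using D_Om_swap(1)[of v u w p] Om_swap12[of "\<Gamma> p v" u w] Om_swap12[of v "\<Gamma> p u" w] Om_swap12[of v u "\<Gamma> p w"] by simp

lemma nOm_swap13: "nOm p w v u = - nOm p u v w"
  unfolding nOm_def using D_Om_swap(2)[of w v u p] Om_swap13[of "\<Gamma> p w" v u] Om_swap13[of w "\<Gamma> p v" u] Om_swap13[of w v "\<Gamma> p u"] by simp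

lemma nOm_same: "nOm p u u w = 0" "nOm p w u u = 0" "nOm p u w u = 0"
  using nOm_swap12[of p u u w] nOm_swap13[of p u w u] nOm_swap13[of p w u u] nOm_swap12[of p u u w] by simp_all

text \<open>Differentiates \<omega>(u, v) = g(J u, v); the metric itself is parallel.\<close>

lemma nom_nJ: "nom p u v = g x [nJ p u, v]"
proof -
  have "D (\<lambda>y. \<omega> y [u, v]) x p = D (\<lambda>y. g y [J y u, v]) x p"
    using D_cong[OF open_U x, of "\<lambda>y. \<omega> y [u, v]" "\<lambda>y. g y [J y u, v]"] SU3[unfolded SU3_point_def SU3_point_axioms_def] by auto
  also have "\<dots> = D (\<lambda>y. g y [J x u, v]) x p + g x [D (\<lambda>y. J y u) x p, v]"
    using D_eqI[OF has_derivative_slot[OF open_U x, of "\<lambda>y u. g y [u, v]" "\<lambda>y. J y u"]] point_linear(1) diff_g diff_J by simp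
  finally show ?thesis
    unfolding nom_def nJ_def metric_compat om
    by (simp add: linear_add[OF g_linear(1)] linear_diff[OF g_linear(1)])
qed

text \<open>Differentiates J J = -1.\<close>

lemma nJ_J: "nJ p (J x u) = - J x (nJ p u)"
proof -
  have "((\<lambda>y. J y (J y u)) has_derivative (\<lambda>p. D (\<lambda>y. J y (J x u)) x p + J x (D (\<lambda>y. J y u) x p))) (at x)"
    by (rule has_derivative_slot[OF open_U x point_linear(3) diff_J diff_J])
  moreover have "J y (J y u) = - u" if "y \<in> U" for y
  proof -
    interpret P: SU3_point "g y" "J y" "\<Omega> y" "\<omega> y" by (rule SU3[OF that])
    show ?thesis by (rule P.JJ)
  qed
  ultimately have "((\<lambda>y. - u) has_derivative (\<lambda>p. D (\<lambda>y. J y (J x u)) x p + J x (D (\<lambda>y. J y u) x p))) (at x)"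
    by (rule has_derivative_transform_within_open[OF _ open_U x])
  from D_eqI[OF this, of p] have "D (\<lambda>y. J y (J x u)) x p = - J x (D (\<lambda>y. J y u) x p)"
    by (simp add: eq_neg_iff_add_eq_0)
  then show ?thesis
    unfolding nJ_def by (simp add: JJ linear_add[OF linear_J] linear_diff[OF linear_J] linear_neg[OF Gam_linear(1)])
qed

text \<open>Says that the 2-form \<nabla>\<omega> in the last two slots has no part of type (1,1),
  which reduces its 15 components to 6.\<close>

lemma nom_J: "nom p (J x u) v = nom p u (J x v)"
  unfolding nom_nJ nJ_J using g_J linear_neg[OF g_linear(1)] by simp

text \<open>Differentiates the type condition on \<Omega>. The correction term shows that
  \<nabla>\<Omega> leaves type (3,0) only through \<nabla>J.\<close>

lemma nOm_J: "nOm p (J x u) v w = \<i> * nOm p u v w - \<Omega> x [nJ p u, v, w]"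
proof -
  have "((\<lambda>y. \<Omega> y [J y u, v, w]) has_derivative (\<lambda>p. D (\<lambda>y. \<Omega> y [J x u, v, w]) x p + \<Omega> x [D (\<lambda>y. J y u) x p, v, w])) (at x)"
    by (rule has_derivative_slot[OF open_U x point_linear(6) diff_Om diff_J])
  moreover have "\<Omega> y [J y u, v, w] = \<i> * \<Omega> y [u, v, w]" if "y \<in> U" for y
  proof -
    interpret P: SU3_point "g y" "J y" "\<Omega> y" "\<omega> y" by (rule SU3[OF that])
    show ?thesis by (rule P.Om_J)
  qed
  ultimately have "((\<lambda>y. \<i> * \<Omega> y [u, v, w]) has_derivative (\<lambda>p. D (\<lambda>y. \<Omega> y [J x u, v, w]) x p + \<Omega> x [D (\<lambda>y. J y u) x p, v, w])) (at x)"
    by (rule has_derivative_transform_within_open[OF _ open_U x])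
  from D_eqI[OF this, of p] D_eqI[OF has_derivative_mult_right[OF D_has_derivative[OF diff_Om[of u v w]], of \<i>], of p]
  have "D (\<lambda>y. \<Omega> y [J x u, v, w]) x p = \<i> * D (\<lambda>y. \<Omega> y [u, v, w]) x p - \<Omega> x [D (\<lambda>y. J y u) x p, v, w]"
    by (simp add: eq_diff_eq)
  then show ?thesis
    unfolding nOm_def nJ_def
    by (simp add: linear_add[OF Om_linear(1)] linear_diff[OF Om_linear(1)] Om_J algebra_simps)
qed

text \<open>The connection is symmetric, so d\<omega> is the cyclic sum of \<nabla>\<omega>.\<close>

lemma nom_cyc: "nom u v w + nom v w u + nom w u v = - 3 * Re (\<Omega> x [u, v, w])"
  unfolding d_om[OF x, symmetric] ext_d_2 nom_def
  using D_om_swap[of u w v] om_skew[of "\<Gamma> u v" w] om_skew[of w "\<Gamma> u v"] om_skew[of v "\<Gamma> u w"] om_skew[of u "\<Gamma> v w"]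
    Gam_sym[of v u] Gam_sym[of w u] Gam_sym[of w v] by simp

lemma d_Re_Om: "ext_d 3 (\<lambda>y us. Re (\<Omega> y us)) x [u, v, w, z] = 0"
proof -
  define H where "H a b p q = D (\<lambda>y. D (\<lambda>y. \<omega> y [a, b]) y p) x q" for a b p q
  have H: "H a b p q = H a b q p" for a b p q
    unfolding H_def by (rule second_derivative_symmetric[OF open_U smooth_om x])
  have d: "(\<lambda>y. D (\<lambda>y. \<omega> y [a, b]) y p) differentiable (at x)" for a b p
    by (rule smooth_on_differentiable[OF open_U smooth_on_D[OF smooth_om] x])
  have eq: "D (\<lambda>y. Re (\<Omega> y [a, b, c])) x p = - (1 / 3) * (H b c a p - H a c b p + H a b c p)" for a b c p
  proof -
    have "Re (\<Omega> y [a, b, c]) = - (1 / 3) * (D (\<lambda>y. \<omega> y [b, c]) y a - D (\<lambda>y. \<omega> y [a, c]) y b + D (\<lambda>y. \<omega> y [a, b]) y c)"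
      if "y \<in> U" for y
      using d_om[OF that, of a b c] unfolding ext_d_2 by simp
    then have "D (\<lambda>y. Re (\<Omega> y [a, b, c])) x p =
        D (\<lambda>y. - (1 / 3) * (D (\<lambda>y. \<omega> y [b, c]) y a - D (\<lambda>y. \<omega> y [a, c]) y b + D (\<lambda>y. \<omega> y [a, b]) y c)) x p"
      using D_cong[OF open_U x, of "\<lambda>y. Re (\<Omega> y [a, b, c])"] by simp
    also have "\<dots> = - (1 / 3) * (H b c a p - H a c b p + H a b c p)"
      unfolding H_def
      by (rule D_eqI) (intro has_derivative_mult_right has_derivative_add has_derivative_diff D_has_derivative d)
    finally show ?thesis .
  qed
  show ?thesis
    unfolding ext_d_3 eq
    \<comment> \<open>The twelve second derivatives in d d\<omega> cancel in six pairs.\<close>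
    using H[of w z v u] H[of v z w u] H[of v w z u] H[of u z w v] H[of u w z v] H[of u v z w] by (simp add: field_simps)
qed

lemma D_Re_Om: "D (\<lambda>y. Re (\<Omega> y [u, v, w])) x p = Re (D (\<lambda>y. \<Omega> y [u, v, w]) x p)"
  and D_Im_Om: "D (\<lambda>y. Im (\<Omega> y [u, v, w])) x p = Im (D (\<lambda>y. \<Omega> y [u, v, w]) x p)"
  by (rule D_eqI, rule bounded_linear.has_derivative[OF _ D_has_derivative[OF diff_Om]], rule bounded_linear_Re bounded_linear_Im)+

text \<open>d\<Omega> as the alternation of \<nabla>\<Omega>, by symmetry of the connection. The
  coefficient 4 is the 2 of the structure equation times the 2 of \<open>wedge_2_2\<close>.\<close>

lemma nOm_alt: "nOm u v w z - nOm v u w z + nOm w u v z - nOm z u v w =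
    4 * \<i> * (\<omega> x [u, v] * \<omega> x [w, z] - \<omega> x [u, w] * \<omega> x [v, z] + \<omega> x [u, z] * \<omega> x [v, w])"
proof -
  let ?S = "D (\<lambda>y. \<Omega> y [v, w, z]) x u - D (\<lambda>y. \<Omega> y [u, w, z]) x v + D (\<lambda>y. \<Omega> y [u, v, z]) x w - D (\<lambda>y. \<Omega> y [u, v, w]) x z"
  have "Re ?S = 0" using d_Re_Om[of u v w z] unfolding ext_d_3 D_Re_Om by simp
  moreover have "Im ?S = 4 * (\<omega> x [u, v] * \<omega> x [w, z] - \<omega> x [u, w] * \<omega> x [v, z] + \<omega> x [u, z] * \<omega> x [v, w])"
    using d_Im_Om[OF x, of u v w z] unfolding ext_d_3 D_Im_Om wedge_2_2[where \<omega> = "\<omega> x", OF om_skew] by simp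
  ultimately have "?S = 4 * \<i> * (\<omega> x [u, v] * \<omega> x [w, z] - \<omega> x [u, w] * \<omega> x [v, z] + \<omega> x [u, z] * \<omega> x [v, w])"
    unfolding complex_eq_iff by simp
  moreover have "nOm u v w z - nOm v u w z + nOm w u v z - nOm z u v w = ?S"
    unfolding nOm_def
    using Gam_sym[of v u] Gam_sym[of w u] Gam_sym[of z u] Gam_sym[of w v] Gam_sym[of z v] Gam_sym[of z w]
      Om_swap12[of v "\<Gamma> u w" z] Om_rot(1)[of v w "\<Gamma> u z"] Om_swap23[of u w "\<Gamma> v z"] by simp
  ultimately show ?thesis by simp
qed

end

locale NK_frame = NK_at +
  fixes E assumes E: "unitary_frame E" and Om_1: "\<Omega> x [E ! 0, E ! 2, E ! 4] = 1"
begin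

sublocale unitary "g x" "J x" "\<Omega> x" E using E by unfold_locales

lemma Om_val: "a < 6 \<Longrightarrow> b < 6 \<Longrightarrow> c < 6 \<Longrightarrow> \<Omega> x [E ! a, E ! b, E ! c] =
    of_int (eps [a div 2, b div 2, c div 2]) * \<i> ^ (a mod 2 + b mod 2 + c mod 2)"
  using Om_frame[of a b c] Om_1 by simp

lemma om_table:
  "\<omega> x [E ! 0, E ! 0] = 0" "\<omega> x [E ! 0, E ! 1] = 1" "\<omega> x [E ! 0, E ! 2] = 0"
  "\<omega> x [E ! 0, E ! 3] = 0" "\<omega> x [E ! 0, E ! 4] = 0" "\<omega> x [E ! 0, E ! 5] = 0"
  "\<omega> x [E ! 1, E ! 0] = - 1" "\<omega> x [E ! 1, E ! 1] = 0" "\<omega> x [E ! 1, E ! 2] = 0"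
  "\<omega> x [E ! 1, E ! 3] = 0" "\<omega> x [E ! 1, E ! 4] = 0" "\<omega> x [E ! 1, E ! 5] = 0"
  "\<omega> x [E ! 2, E ! 0] = 0" "\<omega> x [E ! 2, E ! 1] = 0" "\<omega> x [E ! 2, E ! 2] = 0"
  "\<omega> x [E ! 2, E ! 3] = 1" "\<omega> x [E ! 2, E ! 4] = 0" "\<omega> x [E ! 2, E ! 5] = 0"
  "\<omega> x [E ! 3, E ! 0] = 0" "\<omega> x [E ! 3, E ! 1] = 0" "\<omega> x [E ! 3, E ! 2] = - 1"
  "\<omega> x [E ! 3, E ! 3] = 0" "\<omega> x [E ! 3, E ! 4] = 0" "\<omega> x [E ! 3, E ! 5] = 0"
  "\<omega> x [E ! 4, E ! 0] = 0" "\<omega> x [E ! 4, E ! 1] = 0" "\<omega> x [E ! 4, E ! 2] = 0"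
  "\<omega> x [E ! 4, E ! 3] = 0" "\<omega> x [E ! 4, E ! 4] = 0" "\<omega> x [E ! 4, E ! 5] = 1"
  "\<omega> x [E ! 5, E ! 0] = 0" "\<omega> x [E ! 5, E ! 1] = 0" "\<omega> x [E ! 5, E ! 2] = 0"
  "\<omega> x [E ! 5, E ! 3] = 0" "\<omega> x [E ! 5, E ! 4] = - 1" "\<omega> x [E ! 5, E ! 5] = 0"
  unfolding om frame_J by (simp_all add: frame_g frame_g[of "Suc 0"] linear_neg[OF g_linear(1)])

text \<open>The components of \<open>\<nabla>\<omega>\<close> and \<open>\<nabla>\<Omega>\<close> that the algebraic symmetries leave free.\<close>
definition A where "A p = nom p (E ! 0) (E ! 2)"
definition B where "B p = nom p (E ! 0) (E ! 3)"
definition C where "C p = nom p (E ! 0) (E ! 4)"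
definition F where "F p = nom p (E ! 0) (E ! 5)"
definition G where "G p = nom p (E ! 2) (E ! 4)"
definition H where "H p = nom p (E ! 2) (E ! 5)"
definition L where "L p = Im (nOm p (E ! 0) (E ! 2) (E ! 4))"

text \<open>\<open>nom_J\<close> moves J from one slot to the other. On a pair e, J e this makes the
  component equal to its negative, and on two different complex directions it determines four
  components by two.\<close>

lemma nom_upper:
  "nom p u u = 0" "nom p (E ! 0) (E ! 1) = 0" "nom p (E ! 2) (E ! 3) = 0" "nom p (E ! 4) (E ! 5) = 0"
  "nom p (E ! 0) (E ! 2) = A p" "nom p (E ! 0) (E ! 3) = B p" "nom p (E ! 0) (E ! 4) = C p"
  "nom p (E ! 0) (E ! 5) = F p" "nom p (E ! 2) (E ! 4) = G p" "nom p (E ! 2) (E ! 5) = H p"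
  "nom p (E ! 1) (E ! 2) = B p" "nom p (E ! 1) (E ! 3) = - A p" "nom p (E ! 1) (E ! 4) = F p"
  "nom p (E ! 1) (E ! 5) = - C p" "nom p (E ! 3) (E ! 4) = H p" "nom p (E ! 3) (E ! 5) = - G p"
proof -
  have n: "nom p u (- v) = - nom p u v" "nom p (- u) v = - nom p u v" for u v
    using linear_neg[OF nom_linear(2)] linear_neg[OF nom_linear(3)] by auto
  note J = nom_J[of p "E ! i" "E ! j" for i j]
  note J = J[of 0 0] J[of 0 2] J[of 0 3] J[of 0 4] J[of 0 5] J[of 2 2] J[of 2 4] J[of 2 5] J[of 4 4]
  note J = J[unfolded frame_J n]
  show "nom p u u = 0" using nom_skew[of p u u] by simp
  show "nom p (E ! 0) (E ! 1) = 0" using J(1) nom_skew[of p "E ! 1" "E ! 0"] by simp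
  show "nom p (E ! 2) (E ! 3) = 0" using J(6) nom_skew[of p "E ! 3" "E ! 2"] by simp
  show "nom p (E ! 4) (E ! 5) = 0" using J(9) nom_skew[of p "E ! 5" "E ! 4"] by simp
  show "nom p (E ! 0) (E ! 2) = A p" "nom p (E ! 0) (E ! 3) = B p" "nom p (E ! 0) (E ! 4) = C p"
    "nom p (E ! 0) (E ! 5) = F p" "nom p (E ! 2) (E ! 4) = G p" "nom p (E ! 2) (E ! 5) = H p"
    "nom p (E ! 1) (E ! 2) = B p" "nom p (E ! 1) (E ! 3) = - A p" "nom p (E ! 1) (E ! 4) = F p"
    "nom p (E ! 1) (E ! 5) = - C p" "nom p (E ! 3) (E ! 4) = H p" "nom p (E ! 3) (E ! 5) = - G p"
    unfolding A_def B_def C_def F_def G_def H_def using J by (simp_all only:)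
qed

lemma nom_table:
  "nom p (E ! 0) (E ! 0) = 0" "nom p (E ! 0) (E ! 1) = 0" "nom p (E ! 0) (E ! 2) = A p"
  "nom p (E ! 0) (E ! 3) = B p" "nom p (E ! 0) (E ! 4) = C p" "nom p (E ! 0) (E ! 5) = F p"
  "nom p (E ! 1) (E ! 0) = 0" "nom p (E ! 1) (E ! 1) = 0" "nom p (E ! 1) (E ! 2) = B p"
  "nom p (E ! 1) (E ! 3) = - A p" "nom p (E ! 1) (E ! 4) = F p" "nom p (E ! 1) (E ! 5) = - C p"
  "nom p (E ! 2) (E ! 0) = - A p" "nom p (E ! 2) (E ! 1) = - B p" "nom p (E ! 2) (E ! 2) = 0"
  "nom p (E ! 2) (E ! 3) = 0" "nom p (E ! 2) (E ! 4) = G p" "nom p (E ! 2) (E ! 5) = H p"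
  "nom p (E ! 3) (E ! 0) = - B p" "nom p (E ! 3) (E ! 1) = A p" "nom p (E ! 3) (E ! 2) = 0"
  "nom p (E ! 3) (E ! 3) = 0" "nom p (E ! 3) (E ! 4) = H p" "nom p (E ! 3) (E ! 5) = - G p"
  "nom p (E ! 4) (E ! 0) = - C p" "nom p (E ! 4) (E ! 1) = - F p" "nom p (E ! 4) (E ! 2) = - G p"
  "nom p (E ! 4) (E ! 3) = - H p" "nom p (E ! 4) (E ! 4) = 0" "nom p (E ! 4) (E ! 5) = 0"
  "nom p (E ! 5) (E ! 0) = - F p" "nom p (E ! 5) (E ! 1) = C p" "nom p (E ! 5) (E ! 2) = - H p"
  "nom p (E ! 5) (E ! 3) = G p" "nom p (E ! 5) (E ! 4) = 0" "nom p (E ! 5) (E ! 5) = 0"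
  by (rule nom_upper | rule trans[OF nom_skew], simp only: nom_upper minus_minus minus_zero)+

lemma nJ_frame:
  "\<Omega> x [nJ p (E ! 0), v, w] = A p * \<Omega> x [E ! 2, v, w] + B p * \<Omega> x [E ! 3, v, w] + C p * \<Omega> x [E ! 4, v, w] + F p * \<Omega> x [E ! 5, v, w]"
  "\<Omega> x [nJ p (E ! 2), v, w] = - A p * \<Omega> x [E ! 0, v, w] - B p * \<Omega> x [E ! 1, v, w] + G p * \<Omega> x [E ! 4, v, w] + H p * \<Omega> x [E ! 5, v, w]"
  "\<Omega> x [nJ p (E ! 4), v, w] = - C p * \<Omega> x [E ! 0, v, w] - F p * \<Omega> x [E ! 1, v, w] - G p * \<Omega> x [E ! 2, v, w] - H p * \<Omega> x [E ! 3, v, w]"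
proof -
  have ex: "nJ p u = nom p u (E ! 0) *\<^sub>R E ! 0 + nom p u (E ! 1) *\<^sub>R E ! 1 + nom p u (E ! 2) *\<^sub>R E ! 2
      + nom p u (E ! 3) *\<^sub>R E ! 3 + nom p u (E ! 4) *\<^sub>R E ! 4 + nom p u (E ! 5) *\<^sub>R E ! 5" for u
    using orthonormal_frame_expand[OF g_multilinear frame_orthonormal, of "nJ p u", unfolded sum_lessThan_6]
    unfolding nom_nJ g_sym[of "nJ p u"] .
  show "\<Omega> x [nJ p (E ! 0), v, w] = A p * \<Omega> x [E ! 2, v, w] + B p * \<Omega> x [E ! 3, v, w] + C p * \<Omega> x [E ! 4, v, w] + F p * \<Omega> x [E ! 5, v, w]"
    "\<Omega> x [nJ p (E ! 2), v, w] = - A p * \<Omega> x [E ! 0, v, w] - B p * \<Omega> x [E ! 1, v, w] + G p * \<Omega> x [E ! 4, v, w] + H p * \<Omega> x [E ! 5, v, w]"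
    "\<Omega> x [nJ p (E ! 4), v, w] = - C p * \<Omega> x [E ! 0, v, w] - F p * \<Omega> x [E ! 1, v, w] - G p * \<Omega> x [E ! 2, v, w] - H p * \<Omega> x [E ! 3, v, w]"
    unfolding ex nom_table linear_add[OF Om_linear(1)] linear_cmul[OF Om_linear(1)]
    by (simp_all add: scaleR_conv_of_real)
qed

text \<open>The squared modulus of \<Omega> is a Gram determinant in g and \<omega>. At a unitary
  frame its derivative is that of the three squared lengths, and metric compatibility makes this
  exactly the connection terms that \<open>nOm\<close> subtracts.\<close>

lemma Re_nOm_024: "Re (nOm p (E ! 0) (E ! 2) (E ! 4)) = 0"
proof -
  let ?a = "E ! 0" and ?b = "E ! 2" and ?c = "E ! 4"
  let ?F = "\<lambda>y. (Re (\<Omega> y [?a, ?b, ?c]))\<^sup>2 + (Im (\<Omega> y [?a, ?b, ?c]))\<^sup>2"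
  have re: "((\<lambda>y. Re (\<Omega> y [u, v, w])) has_derivative (\<lambda>p. Re (D (\<lambda>y. \<Omega> y [u, v, w]) x p))) (at x)"
    and im: "((\<lambda>y. Im (\<Omega> y [u, v, w])) has_derivative (\<lambda>p. Im (D (\<lambda>y. \<Omega> y [u, v, w]) x p))) (at x)" for u v w
    by (rule bounded_linear.has_derivative[OF _ D_has_derivative[OF diff_Om]], rule bounded_linear_Re bounded_linear_Im)+
  have 1: "(?F has_derivative (\<lambda>p. 2 * Re (D (\<lambda>y. \<Omega> y [?a, ?b, ?c]) x p))) (at x)"
    by (rule derivative_eq_intros re im refl)+ (simp add: Om_1 fun_eq_iff)
  have 2: "(?F has_derivative (\<lambda>p. D (\<lambda>y. g y [?a, ?a]) x p + D (\<lambda>y. g y [?b, ?b]) x p + D (\<lambda>y. g y [?c, ?c]) x p)) (at x)"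
  proof (rule has_derivative_transform_within_open[OF _ open_U x])
    show "((\<lambda>y. g y [?a, ?a] * g y [?b, ?b] * g y [?c, ?c] - g y [?a, ?a] * ((g y [?b, ?c])\<^sup>2 + (\<omega> y [?b, ?c])\<^sup>2)
    - g y [?b, ?b] * ((g y [?c, ?a])\<^sup>2 + (\<omega> y [?c, ?a])\<^sup>2) - g y [?c, ?c] * ((g y [?a, ?b])\<^sup>2 + (\<omega> y [?a, ?b])\<^sup>2)
    + 2 * (g y [?a, ?b] * g y [?b, ?c] * g y [?c, ?a] - g y [?a, ?b] * \<omega> y [?b, ?c] * \<omega> y [?c, ?a]
         - \<omega> y [?a, ?b] * g y [?b, ?c] * \<omega> y [?c, ?a] - \<omega> y [?a, ?b] * \<omega> y [?b, ?c] * g y [?c, ?a]))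
      has_derivative (\<lambda>p. D (\<lambda>y. g y [?a, ?a]) x p + D (\<lambda>y. g y [?b, ?b]) x p + D (\<lambda>y. g y [?c, ?c]) x p)) (at x)"
      by (rule gram_derivative[OF D_has_derivative D_has_derivative D_has_derivative])
        (simp_all only: diff_g diff_om frame_g om_table, simp_all)
  next
    fix y assume "y \<in> U"
    then interpret P: SU3_point "g y" "J y" "\<Omega> y" "\<omega> y" by (rule SU3)
    show "g y [?a, ?a] * g y [?b, ?b] * g y [?c, ?c] - g y [?a, ?a] * ((g y [?b, ?c])\<^sup>2 + (\<omega> y [?b, ?c])\<^sup>2)
    - g y [?b, ?b] * ((g y [?c, ?a])\<^sup>2 + (\<omega> y [?c, ?a])\<^sup>2) - g y [?c, ?c] * ((g y [?a, ?b])\<^sup>2 + (\<omega> y [?a, ?b])\<^sup>2)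
    + 2 * (g y [?a, ?b] * g y [?b, ?c] * g y [?c, ?a] - g y [?a, ?b] * \<omega> y [?b, ?c] * \<omega> y [?c, ?a]
         - \<omega> y [?a, ?b] * g y [?b, ?c] * \<omega> y [?c, ?a] - \<omega> y [?a, ?b] * \<omega> y [?b, ?c] * g y [?c, ?a]) = ?F y"
      by (rule P.Om_norm_sq[symmetric])
  qed
  have "2 * Re (D (\<lambda>y. \<Omega> y [?a, ?b, ?c]) x p) =
      D (\<lambda>y. g y [?a, ?a]) x p + D (\<lambda>y. g y [?b, ?b]) x p + D (\<lambda>y. g y [?c, ?c]) x p"
    using D_eqI[OF 1, of p] D_eqI[OF 2, of p] by simp
  also have "\<dots> = 2 * (g x [\<Gamma> p ?a, ?a] + g x [\<Gamma> p ?b, ?b] + g x [\<Gamma> p ?c, ?c])"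
    unfolding metric_compat using g_sym[of ?a "\<Gamma> p ?a"] g_sym[of ?b "\<Gamma> p ?b"] g_sym[of ?c "\<Gamma> p ?c"] by simp
  finally show ?thesis unfolding nOm_def by (simp add: Re_Om_frame[OF Om_1])
qed

section \<open>Components of \<nabla>\<Omega> in a unitary frame and the linear system\<close>

context notes [simp del] = One_nat_def
begin

text \<open>Each instance trades an even index for its odd partner. Starting from
  \<open>nOm_024\<close>, the components with one, two and three odd indices follow in this order.
  The index 1 stays a literal so that the tables match.\<close>

lemmas nOm_rel = nOm_J[of p "E ! 0", unfolded frame_J nJ_frame] nOm_J[of p "E ! 2", unfolded frame_J nJ_frame]
  nOm_J[of p "E ! 4", unfolded frame_J nJ_frame] for p
lemmas frame_simps = complex_eq_iff Om_val nOm_same power3_eq_cube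

lemma nOm_024: "nOm p (E ! 0) (E ! 2) (E ! 4) = Complex 0 (L p)"
  using Re_nOm_024 by (simp add: complex_eq_iff L_def)

lemma nOm_012: "nOm p (E ! 0) (E ! 1) (E ! 2) = Complex (C p) (F p)"
  using nOm_rel(1)[of p "E ! 0" "E ! 2"] nOm_swap12[of p "E ! 0" "E ! 1" "E ! 2"] nOm_swap12[of p "E ! 0" "E ! 0" "E ! 2"]
  by (simp add: frame_simps nOm_024)

lemma nOm_014: "nOm p (E ! 0) (E ! 1) (E ! 4) = Complex (- A p) (- B p)"
  using nOm_rel(1)[of p "E ! 0" "E ! 4"] nOm_swap12[of p "E ! 0" "E ! 1" "E ! 4"] nOm_swap12[of p "E ! 0" "E ! 0" "E ! 4"]
  by (simp add: frame_simps nOm_024)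

lemma nOm_023: "nOm p (E ! 0) (E ! 2) (E ! 3) = Complex (- G p) (- H p)"
  using nOm_rel(2)[of p "E ! 2" "E ! 0"] nOm_swap13[of p "E ! 0" "E ! 2" "E ! 3"] nOm_swap13[of p "E ! 0" "E ! 2" "E ! 2"]
  by (simp add: frame_simps nOm_024)

lemma nOm_025: "nOm p (E ! 0) (E ! 2) (E ! 5) = Complex (- L p) 0"
  using nOm_rel(3)[of p "E ! 2" "E ! 0"] nOm_swap13[of p "E ! 0" "E ! 2" "E ! 5"] nOm_swap13[of p "E ! 0" "E ! 2" "E ! 4"]
  by (simp add: frame_simps nOm_024)

lemma nOm_034: "nOm p (E ! 0) (E ! 3) (E ! 4) = Complex (- L p) 0"
  using nOm_rel(2)[of p "E ! 0" "E ! 4"] nOm_swap12[of p "E ! 0" "E ! 3" "E ! 4"] nOm_swap12[of p "E ! 0" "E ! 2" "E ! 4"]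
  by (simp add: frame_simps nOm_024)

lemma nOm_045: "nOm p (E ! 0) (E ! 4) (E ! 5) = Complex (- G p) (- H p)"
  using nOm_rel(3)[of p "E ! 4" "E ! 0"] nOm_swap13[of p "E ! 0" "E ! 4" "E ! 5"] nOm_swap13[of p "E ! 0" "E ! 4" "E ! 4"]
  by (simp add: frame_simps nOm_024)

lemma nOm_124: "nOm p (E ! 1) (E ! 2) (E ! 4) = Complex (- L p) 0"
  using nOm_rel(1)[of p "E ! 2" "E ! 4"]
  by (simp add: frame_simps nOm_024)

lemma nOm_234: "nOm p (E ! 2) (E ! 3) (E ! 4) = Complex (- A p) (- B p)"
  using nOm_rel(2)[of p "E ! 2" "E ! 4"] nOm_swap12[of p "E ! 2" "E ! 3" "E ! 4"] nOm_swap12[of p "E ! 2" "E ! 2" "E ! 4"]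
  by (simp add: frame_simps nOm_024)

lemma nOm_245: "nOm p (E ! 2) (E ! 4) (E ! 5) = Complex (C p) (F p)"
  using nOm_rel(3)[of p "E ! 4" "E ! 2"] nOm_swap13[of p "E ! 2" "E ! 4" "E ! 5"] nOm_swap13[of p "E ! 2" "E ! 4" "E ! 4"]
  by (simp add: frame_simps nOm_024)

lemmas nOm_one_odd = nOm_024 nOm_012 nOm_014 nOm_023 nOm_025 nOm_034 nOm_045 nOm_124 nOm_234 nOm_245

lemma nOm_013: "nOm p (E ! 0) (E ! 1) (E ! 3) = Complex (- F p) (C p)"
  using nOm_rel(1)[of p "E ! 0" "E ! 3"] nOm_swap12[of p "E ! 0" "E ! 1" "E ! 3"] nOm_swap12[of p "E ! 0" "E ! 0" "E ! 3"]
  by (simp add: frame_simps nOm_one_odd)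

lemma nOm_015: "nOm p (E ! 0) (E ! 1) (E ! 5) = Complex (B p) (- A p)"
  using nOm_rel(1)[of p "E ! 0" "E ! 5"] nOm_swap12[of p "E ! 0" "E ! 1" "E ! 5"] nOm_swap12[of p "E ! 0" "E ! 0" "E ! 5"]
  by (simp add: frame_simps nOm_one_odd)

lemma nOm_035: "nOm p (E ! 0) (E ! 3) (E ! 5) = Complex 0 (- L p)"
  using nOm_rel(2)[of p "E ! 0" "E ! 5"] nOm_swap12[of p "E ! 0" "E ! 3" "E ! 5"] nOm_swap12[of p "E ! 0" "E ! 2" "E ! 5"]
  by (simp add: frame_simps nOm_one_odd)

lemma nOm_123: "nOm p (E ! 1) (E ! 2) (E ! 3) = Complex (H p) (- G p)"
  using nOm_rel(1)[of p "E ! 2" "E ! 3"]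
  by (simp add: frame_simps nOm_one_odd)

lemma nOm_125: "nOm p (E ! 1) (E ! 2) (E ! 5) = Complex 0 (- L p)"
  using nOm_rel(1)[of p "E ! 2" "E ! 5"]
  by (simp add: frame_simps nOm_one_odd)

lemma nOm_134: "nOm p (E ! 1) (E ! 3) (E ! 4) = Complex 0 (- L p)"
  using nOm_rel(1)[of p "E ! 3" "E ! 4"]
  by (simp add: frame_simps nOm_one_odd)

lemma nOm_145: "nOm p (E ! 1) (E ! 4) (E ! 5) = Complex (H p) (- G p)"
  using nOm_rel(1)[of p "E ! 4" "E ! 5"]
  by (simp add: frame_simps nOm_one_odd)

lemma nOm_235: "nOm p (E ! 2) (E ! 3) (E ! 5) = Complex (B p) (- A p)"
  using nOm_rel(2)[of p "E ! 2" "E ! 5"] nOm_swap12[of p "E ! 2" "E ! 3" "E ! 5"] nOm_swap12[of p "E ! 2" "E ! 2" "E ! 5"]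
  by (simp add: frame_simps nOm_one_odd)

lemma nOm_345: "nOm p (E ! 3) (E ! 4) (E ! 5) = Complex (- F p) (C p)"
  using nOm_rel(2)[of p "E ! 4" "E ! 5"]
  by (simp add: frame_simps nOm_one_odd)

lemmas nOm_two_odd = nOm_one_odd nOm_013 nOm_015 nOm_035 nOm_123 nOm_125 nOm_134 nOm_145 nOm_235 nOm_345

lemma nOm_135: "nOm p (E ! 1) (E ! 3) (E ! 5) = Complex (L p) 0"
  using nOm_rel(1)[of p "E ! 3" "E ! 5"]
  by (simp add: frame_simps nOm_two_odd)

lemmas nOm_table = nOm_two_odd nOm_135

lemmas nom_cyc_frame = nom_cyc[of "E ! i" "E ! j" "E ! k" for i j k]
lemmas nOm_alt_frame = nOm_alt[of "E ! i" "E ! j" "E ! k" "E ! l" for i j k l]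

lemmas nom_cyc_list = nom_cyc_frame[of 0 1 2] nom_cyc_frame[of 0 1 3] nom_cyc_frame[of 0 1 4] nom_cyc_frame[of 0 1 5]
  nom_cyc_frame[of 0 2 3] nom_cyc_frame[of 0 2 4] nom_cyc_frame[of 0 2 5] nom_cyc_frame[of 0 3 4]
  nom_cyc_frame[of 0 3 5] nom_cyc_frame[of 0 4 5] nom_cyc_frame[of 1 2 3] nom_cyc_frame[of 1 2 4]
  nom_cyc_frame[of 1 2 5] nom_cyc_frame[of 1 3 4] nom_cyc_frame[of 1 3 5] nom_cyc_frame[of 1 4 5]
  nom_cyc_frame[of 2 3 4] nom_cyc_frame[of 2 3 5] nom_cyc_frame[of 2 4 5] nom_cyc_frame[of 3 4 5]
lemmas nOm_alt_list = nOm_alt_frame[of 0 1 2 3] nOm_alt_frame[of 0 1 2 4] nOm_alt_frame[of 0 1 2 5]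
  nOm_alt_frame[of 0 1 3 4] nOm_alt_frame[of 0 1 3 5] nOm_alt_frame[of 0 1 4 5] nOm_alt_frame[of 0 2 3 4]
  nOm_alt_frame[of 0 2 3 5] nOm_alt_frame[of 0 2 4 5] nOm_alt_frame[of 0 3 4 5] nOm_alt_frame[of 1 2 3 4]
  nOm_alt_frame[of 1 2 3 5] nOm_alt_frame[of 1 2 4 5] nOm_alt_frame[of 1 3 4 5] nOm_alt_frame[of 2 3 4 5]

lemmas nearly_Kaehler_equations =
  nom_cyc_list[simplified nom_table Om_val power3_eq_cube, simplified]
  nOm_alt_list[THEN arg_cong[where f = Re], simplified nOm_table om_table, simplified]
  nOm_alt_list[THEN arg_cong[where f = Im], simplified nOm_table om_table, simplified]

text \<open>The 42 unknowns are the values of the seven free components on the six frame vectors;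
  d\<omega> supplies 20 real equations and d\<Omega> 15 complex ones. The nonzero values are those
  of - Re \<Omega>.\<close>

lemma nearly_Kaehler_system:
  "A (E ! 0) = 0" "A (E ! 1) = 0" "A (E ! 2) = 0" "A (E ! 3) = 0" "A (E ! 4) = - 1" "A (E ! 5) = 0"
  "B (E ! 0) = 0" "B (E ! 1) = 0" "B (E ! 2) = 0" "B (E ! 3) = 0" "B (E ! 4) = 0" "B (E ! 5) = 1"
  "C (E ! 0) = 0" "C (E ! 1) = 0" "C (E ! 2) = 1" "C (E ! 3) = 0" "C (E ! 4) = 0" "C (E ! 5) = 0"
  "F (E ! 0) = 0" "F (E ! 1) = 0" "F (E ! 2) = 0" "F (E ! 3) = - 1" "F (E ! 4) = 0" "F (E ! 5) = 0"
  "G (E ! 0) = - 1" "G (E ! 1) = 0" "G (E ! 2) = 0" "G (E ! 3) = 0" "G (E ! 4) = 0" "G (E ! 5) = 0"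
  "H (E ! 0) = 0" "H (E ! 1) = 1" "H (E ! 2) = 0" "H (E ! 3) = 0" "H (E ! 4) = 0" "H (E ! 5) = 0"
  "L (E ! 0) = 0" "L (E ! 1) = 0" "L (E ! 2) = 0" "L (E ! 3) = 0" "L (E ! 4) = 0" "L (E ! 5) = 0"
  using nearly_Kaehler_equations by linarith+

end

lemma nom_eq: "nom p u v = - Re (\<Omega> x [p, u, v])"
proof -
  have "(\<lambda>vs. nom (vs ! 0) (vs ! 1) (vs ! 2)) [p, u, v] = (\<lambda>vs. - Re (\<Omega> x vs)) [p, u, v]"
  proof (rule multilinear_eqI[where k = 3 and E = E])
    show "multilinear 3 (\<lambda>vs. nom (vs ! 0) (vs ! 1) (vs ! 2))"
      unfolding multilinear_3 using nom_linear by simp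
    have r: "linear (\<lambda>u. - Re (f u))" if "linear f" for f :: "real ^ 6 \<Rightarrow> complex"
      by (rule linearI) (simp_all add: linear_add[OF that] linear_cmul[OF that])
    show "multilinear 3 (\<lambda>vs. - Re (\<Omega> x vs))"
      unfolding multilinear_3 by (intro conjI allI r Om_linear)
    show "span (set E) = UNIV" by (rule frame_span)
    fix js :: "nat list" assume js: "length js = 3" "set js \<subseteq> {..<length E}"
    then obtain a b c where abc: "js = [a, b, c]" "a < 6" "b < 6" "c < 6"
      by (auto simp: length_Suc_conv eval_nat_numeral length_frame)
    then have "a = 0 \<or> a = 1 \<or> a = 2 \<or> a = 3 \<or> a = 4 \<or> a = 5" "b = 0 \<or> b = 1 \<or> b = 2 \<or> b = 3 \<or> b = 4 \<or> b = 5"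
      "c = 0 \<or> c = 1 \<or> c = 2 \<or> c = 3 \<or> c = 4 \<or> c = 5" by arith+
    then have "nom (E ! a) (E ! b) (E ! c) = - Re (\<Omega> x [E ! a, E ! b, E ! c])"
      by (elim disjE; simp del: One_nat_def add: nom_table nearly_Kaehler_system Om_val power3_eq_cube)
    then show "nom (map ((!) E) js ! 0) (map ((!) E) js ! 1) (map ((!) E) js ! 2) = - Re (\<Omega> x (map ((!) E) js))"
      using abc(1) by (simp add: numeral_2_eq_2)
  qed simp
  then show ?thesis by (simp add: numeral_2_eq_2)
qed

lemma nOm_eq: "nOm p u v w = (g x [p, u] + \<i> * \<omega> x [p, u]) * \<omega> x [v, w]
    + (g x [p, v] + \<i> * \<omega> x [p, v]) * \<omega> x [w, u] + (g x [p, w] + \<i> * \<omega> x [p, w]) * \<omega> x [u, v]"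
proof -
  define R where "R p u v w = (complex_of_real (g x [p, u]) + \<i> * \<omega> x [p, u]) * \<omega> x [v, w]
    + (g x [p, v] + \<i> * \<omega> x [p, v]) * \<omega> x [w, u] + (g x [p, w] + \<i> * \<omega> x [p, w]) * \<omega> x [u, v]" for p u v w
  note lin_simps = linear_add[OF g_linear(1)] linear_cmul[OF g_linear(1)] linear_add[OF g_linear(2)] linear_cmul[OF g_linear(2)]
    linear_add[OF om_linear(1)] linear_cmul[OF om_linear(1)] linear_add[OF om_linear(2)] linear_cmul[OF om_linear(2)]
  have R_linear: "linear (\<lambda>p. R p u v w)" "linear (\<lambda>u. R p u v w)" "linear (\<lambda>v. R p u v w)" "linear (\<lambda>w. R p u v w)" for p u v w
    unfolding R_def by (rule linearI; simp add: lin_simps complex_eq_iff algebra_simps)+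
  have R12: "R p v u w = - R p u v w" for p u v w
    unfolding R_def om_skew[of v u] om_skew[of u w] om_skew[of w v] by (simp add: algebra_simps)
  have R23: "R p u w v = - R p u v w" for p u v w
    unfolding R_def om_skew[of w v] om_skew[of v u] om_skew[of u w] by (simp add: algebra_simps)
  have nOm_swap23: "nOm p u w v = - nOm p u v w" for p u v w
    using nOm_swap13[of p v w u] nOm_swap13[of p w u v] nOm_swap12[of p v u w] nOm_swap12[of p v w u] nOm_swap13[of p w v u] nOm_swap12[of p w v u] by simp
  have skew3: "skew 3 (\<lambda>vs. S (vs ! 0) (vs ! 1) (vs ! 2))"
    if "\<And>u v w. S v u w = - S u v w" "\<And>u v w. S u w v = - S u v w" for S :: "real ^ 6 \<Rightarrow> real ^ 6 \<Rightarrow> real ^ 6 \<Rightarrow> complex"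
    unfolding skew_def
  proof (intro allI impI)
    fix xs zs :: "(real ^ 6) list" and a b assume "length (xs @ a # b # zs) = 3"
    then have "Suc (length xs + length zs) = 2" by simp
    then consider c where "xs = []" "zs = [c]" | c where "xs = [c]" "zs = []"
      by (cases xs; cases zs) auto
    then show "S ((xs @ a # b # zs) ! 0) ((xs @ a # b # zs) ! 1) ((xs @ a # b # zs) ! 2) =
       - S ((xs @ b # a # zs) ! 0) ((xs @ b # a # zs) ! 1) ((xs @ b # a # zs) ! 2)"
      by cases (simp_all add: that(1)[of b a] that(2)[of _ b a] numeral_2_eq_2)
  qed
  \<comment> \<open>The direction \<open>p\<close> has no symmetry with the other slots and runs
    through the whole frame, whereas the skew slots need only the 20 increasing triples.\<close>
  have on_frame: "nOm p u v w = R p u v w" if pE: "p \<in> set E" for p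
  proof -
    obtain a where a: "a < 6" "p = E ! a" using pE by (auto simp: in_set_conv_nth length_frame)
    then have a6: "a = 0 \<or> a = 1 \<or> a = 2 \<or> a = 3 \<or> a = 4 \<or> a = 5" by arith
    have "(\<lambda>vs. nOm p (vs ! 0) (vs ! 1) (vs ! 2)) [u, v, w] = (\<lambda>vs. R p (vs ! 0) (vs ! 1) (vs ! 2)) [u, v, w]"
    proof (rule alternating_eqI[where k = 3 and E = E])
      show "multilinear 3 (\<lambda>vs. nOm p (vs ! 0) (vs ! 1) (vs ! 2))" "multilinear 3 (\<lambda>vs. R p (vs ! 0) (vs ! 1) (vs ! 2))"
        unfolding multilinear_3 using nOm_linear R_linear by (simp_all add: numeral_2_eq_2)
      show "skew 3 (\<lambda>vs. nOm p (vs ! 0) (vs ! 1) (vs ! 2))" by (rule skew3[OF nOm_swap12 nOm_swap23])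
      show "skew 3 (\<lambda>vs. R p (vs ! 0) (vs ! 1) (vs ! 2))" by (rule skew3[OF R12 R23])
      show "span (set E) = UNIV" by (rule frame_span)
      fix js :: "nat list" assume js: "length js = 3" "set js \<subseteq> {..<length E}" "sorted js" "distinct js"
      have "js \<in> set triples" by (rule sorted_triple) (use js length_frame in auto)
      then have "nOm (E ! a) (E ! (js ! 0)) (E ! (js ! 1)) (E ! (js ! 2)) = R (E ! a) (E ! (js ! 0)) (E ! (js ! 1)) (E ! (js ! 2))"
        using a6 unfolding triples_def R_def
        by (simp only: set_simps insert_iff empty_iff)
          (elim disjE FalseE; simp del: One_nat_def add: nOm_table nearly_Kaehler_system om_table frame_g complex_eq_iff)
      then show "nOm p (map ((!) E) js ! 0) (map ((!) E) js ! 1) (map ((!) E) js ! 2) =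
          R p (map ((!) E) js ! 0) (map ((!) E) js ! 1) (map ((!) E) js ! 2)"
        using js(1) a(2) by simp
    qed simp
    then show ?thesis by (simp add: numeral_2_eq_2)
  qed
  have "p \<in> span (set E)" using frame_span by blast
  from linear_eq_on_span[OF nOm_linear(1) R_linear(1) on_frame this] show ?thesis unfolding R_def .
qed

end

section \<open>The cone in a chart\<close>

lemma (in NK_at) nom_formula: "nom p u v = - Re (\<Omega> x [p, u, v])"
  and nOm_formula: "nOm p u v w = (g x [p, u] + \<i> * \<omega> x [p, u]) * \<omega> x [v, w]
    + (g x [p, v] + \<i> * \<omega> x [p, v]) * \<omega> x [w, u] + (g x [p, w] + \<i> * \<omega> x [p, w]) * \<omega> x [u, v]"
proof -
  obtain E where "unitary_frame E" "1 * \<Omega> x [E ! 0, E ! 2, E ! 4] = 1"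
    using special_frame_exists[of 1] by auto
  then interpret NK_frame U g \<omega> J \<Omega> x E by unfold_locales auto
  show "nom p u v = - Re (\<Omega> x [p, u, v])" by (rule nom_eq)
  show "nOm p u v w = (g x [p, u] + \<i> * \<omega> x [p, u]) * \<omega> x [v, w]
    + (g x [p, v] + \<i> * \<omega> x [p, v]) * \<omega> x [w, u] + (g x [p, w] + \<i> * \<omega> x [p, w]) * \<omega> x [u, v]"
    by (rule nOm_eq)
qed

lemma multilinear_4I:
  assumes "\<And>v w z. linear (\<lambda>u. S u v w z)" "\<And>u w z. linear (\<lambda>v. S u v w z)"
    "\<And>u v z. linear (\<lambda>w. S u v w z)" "\<And>u v w. linear (\<lambda>z. S u v w z)"
  shows "multilinear 4 (\<lambda>vs. S (vs ! 0) (vs ! 1) (vs ! 2) (vs ! 3))"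
proof (rule multilinearI)
  fix xs ys :: "'a list" assume "Suc (length xs + length ys) = 4"
  then consider a b c where "xs = []" "ys = [a, b, c]" | a b c where "xs = [a]" "ys = [b, c]"
    | a b c where "xs = [a, b]" "ys = [c]" | a b c where "xs = [a, b, c]" "ys = []"
    by (cases xs; cases ys; cases "tl xs"; cases "tl ys"; cases "tl (tl xs)"; cases "tl (tl ys)") simp_all
  then show "linear (\<lambda>v. S ((xs @ v # ys) ! 0) ((xs @ v # ys) ! 1) ((xs @ v # ys) ! 2) ((xs @ v # ys) ! 3))"
    by cases (simp_all add: assms numeral_2_eq_2 numeral_3_eq_3)
qed

lemma skew_4I:
  assumes "\<And>u v w z. S v u w z = - S u v w z" "\<And>u v w z. S u w v z = - S u v w z" "\<And>u v w z. S u v z w = - S u v w z"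
  shows "skew 4 (\<lambda>vs. S (vs ! 0) (vs ! 1) (vs ! 2) (vs ! 3))"
  unfolding skew_def
proof (intro allI impI)
  fix xs zs :: "'a list" and a b assume "length (xs @ a # b # zs) = 4"
  then have "Suc (length xs + length zs) = 3" by simp
  then consider c d where "xs = []" "zs = [c, d]" | c d where "xs = [c]" "zs = [d]" | c d where "xs = [c, d]" "zs = []"
    by (cases xs; cases zs; cases "tl xs"; cases "tl zs") simp_all
  then show "S ((xs @ a # b # zs) ! 0) ((xs @ a # b # zs) ! 1) ((xs @ a # b # zs) ! 2) ((xs @ a # b # zs) ! 3) =
     - S ((xs @ b # a # zs) ! 0) ((xs @ b # a # zs) ! 1) ((xs @ b # a # zs) ! 2) ((xs @ b # a # zs) ! 3)"
    by cases (simp_all add: assms(1)[of b a] assms(2)[of _ b a] assms(3)[of _ _ b a] numeral_2_eq_2 numeral_3_eq_3)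
qed

lemma skew_3I:
  assumes "\<And>u v w. t [v, u, w] = - t [u, v, w]" "\<And>u v w. t [u, w, v] = - t [u, v, w]"
  shows "skew 3 t"
  unfolding skew_def
proof (intro allI impI)
  fix xs zs :: "'a list" and a b assume "length (xs @ a # b # zs) = 3"
  then have "Suc (length xs + length zs) = 2" by simp
  then consider c where "xs = []" "zs = [c]" | c where "xs = [c]" "zs = []"
    by (cases xs; cases zs) simp_all
  then show "t (xs @ a # b # zs) = - t (xs @ b # a # zs)"
    by cases (simp_all add: assms(1)[of b a] assms(2)[of _ b a])
qed

definition triples7 :: "nat list list" where
  "triples7 = [[0,1,2],[0,1,3],[0,1,4],[0,1,5],[0,1,6],[0,2,3],[0,2,4],[0,2,5],[0,2,6],[0,3,4],[0,3,5],[0,3,6],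
    [0,4,5],[0,4,6],[0,5,6],[1,2,3],[1,2,4],[1,2,5],[1,2,6],[1,3,4],[1,3,5],[1,3,6],[1,4,5],[1,4,6],[1,5,6],
    [2,3,4],[2,3,5],[2,3,6],[2,4,5],[2,4,6],[2,5,6],[3,4,5],[3,4,6],[3,5,6],[4,5,6]]"

lemma triples7: "a < b \<Longrightarrow> b < c \<Longrightarrow> c < 7 \<Longrightarrow> [a, b, c] \<in> set triples7"
proof -
  assume "a < b" "b < c" "c < 7"
  moreover have "list_all (\<lambda>c. list_all (\<lambda>b. list_all (\<lambda>a. [a, b, c] \<in> set triples7) [0..<b]) [0..<c]) [0..<7]"
    by code_simp
  ultimately show ?thesis by (simp add: list_all_iff)
qed

text \<open>The shape shared by both structures of the theorem. The last two assumptions are z' =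
  \<i> \<alpha> z in real terms; with this form no continuous argument of z has to be
  chosen.\<close>

locale cone_chart = NK_chart +
  fixes \<Phi> :: "real \<times> (real ^ 6) \<Rightarrow> (real \<times> (real ^ 6), real) tensor" and p q \<alpha> :: "real \<Rightarrow> real"
  assumes Phi: "(r::real) > 0 \<Longrightarrow> x \<in> U \<Longrightarrow> \<Phi> (r, x) [u, v, w] =
      - r\<^sup>2 * (fst u * \<omega> x [snd v, snd w] + fst v * \<omega> x [snd w, snd u] + fst w * \<omega> x [snd u, snd v])
      + r ^ 3 * (p r * Re (\<Omega> x [snd u, snd v, snd w]) - q r * Im (\<Omega> x [snd u, snd v, snd w]))"
    and unit: "(r::real) > 0 \<Longrightarrow> (p r)\<^sup>2 + (q r)\<^sup>2 = 1"
    and deriv_p: "(r::real) > 0 \<Longrightarrow> (p has_real_derivative - \<alpha> r * q r) (at r)"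
    and deriv_q: "(r::real) > 0 \<Longrightarrow> (q has_real_derivative \<alpha> r * p r) (at r)"
begin

abbreviation "W \<equiv> {0::real<..} \<times> U"

lemma open_W: "open W" using open_U by (intro open_Times) auto

text \<open>The phase \<open>z = p + \<i> q\<close> rotates \<open>\<Omega>\<close>; \<open>\<alpha>\<close> is the derivative of its argument.\<close>
definition cmetric :: "real \<times> (real ^ 6) \<Rightarrow> (real \<times> (real ^ 6), real) tensor" where
  "cmetric y vs = fst (vs ! 0) * fst (vs ! 1) + (fst y)\<^sup>2 * g (snd y) [snd (vs ! 0), snd (vs ! 1)]"

text \<open>The dual 4-form - r^4 \<omega>^2 / 2 - r^3 dr \<and> Im (z \<Omega>), written out on
  four vectors; confirmed by \<open>psi_eq\<close>.\<close>

definition cpsi :: "real \<times> (real ^ 6) \<Rightarrow> real \<times> (real ^ 6) \<Rightarrow> real \<times> (real ^ 6) \<Rightarrow> real \<times> (real ^ 6) \<Rightarrow> real \<times> (real ^ 6) \<Rightarrow> real" where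
  "cpsi y a b c d = (case y of (r, x) \<Rightarrow>
     - (r ^ 4) * (\<omega> x [snd a, snd b] * \<omega> x [snd c, snd d] - \<omega> x [snd a, snd c] * \<omega> x [snd b, snd d] + \<omega> x [snd a, snd d] * \<omega> x [snd b, snd c])
     - r ^ 3 * (fst a * (p r * Im (\<Omega> x [snd b, snd c, snd d]) + q r * Re (\<Omega> x [snd b, snd c, snd d]))
       - fst b * (p r * Im (\<Omega> x [snd a, snd c, snd d]) + q r * Re (\<Omega> x [snd a, snd c, snd d]))
       + fst c * (p r * Im (\<Omega> x [snd a, snd b, snd d]) + q r * Re (\<Omega> x [snd a, snd b, snd d]))
       - fst d * (p r * Im (\<Omega> x [snd a, snd b, snd c]) + q r * Re (\<Omega> x [snd a, snd b, snd c]))))"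

definition ctorsion :: "real \<times> (real ^ 6) \<Rightarrow> (real \<times> (real ^ 6), real) tensor" where
  "ctorsion y vs = (case y of (r, x) \<Rightarrow> \<alpha> r * fst (vs ! 0) * fst (vs ! 1) + q r * r * g x [snd (vs ! 0), snd (vs ! 1)]
     + (p r - 1) * r * \<omega> x [snd (vs ! 0), snd (vs ! 1)])"

end

locale cone_at = cone_chart +
  fixes r :: real and x :: "real ^ 6" assumes r: "r > 0" and x: "x \<in> U"
begin

sublocale NK_at U g \<omega> J \<Omega> x by unfold_locales (rule x)

lemma in_W: "(r, x) \<in> W" using r x by simp

lemmas lin_simps = linear_add[OF g_linear(1)] linear_cmul[OF g_linear(1)] linear_add[OF g_linear(2)] linear_cmul[OF g_linear(2)]
    linear_add[OF om_linear(1)] linear_cmul[OF om_linear(1)] linear_add[OF om_linear(2)] linear_cmul[OF om_linear(2)]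
    linear_add[OF Om_linear(1)] linear_cmul[OF Om_linear(1)] linear_add[OF Om_linear(2)] linear_cmul[OF Om_linear(2)]
    linear_add[OF Om_linear(3)] linear_cmul[OF Om_linear(3)]

lemma Phi_multilinear: "multilinear 3 (\<Phi> (r, x))"
  unfolding multilinear_3 Phi[OF r x]
  by (intro conjI allI linearI; simp add: lin_simps algebra_simps)

lemma Phi_skew: "skew 3 (\<Phi> (r, x))"
proof (rule skew_3I)
  show "\<Phi> (r, x) [v, u, w] = - \<Phi> (r, x) [u, v, w]" for u v w
    unfolding Phi[OF r x] Om_swap12[of "snd v" "snd u"] om_skew[of "snd v" "snd u"] om_skew[of "snd w" "snd v"] om_skew[of "snd u" "snd w"]
    by (simp add: algebra_simps)
  show "\<Phi> (r, x) [u, w, v] = - \<Phi> (r, x) [u, v, w]" for u v w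
    unfolding Phi[OF r x] Om_swap23[of "snd u" "snd w" "snd v"] om_skew[of "snd v" "snd u"] om_skew[of "snd w" "snd v"] om_skew[of "snd u" "snd w"]
    by (simp add: algebra_simps)
qed

lemma cmetric_multilinear: "multilinear 2 (cmetric (r, x))"
  unfolding multilinear_2 cmetric_def
  by (intro conjI allI linearI; simp add: lin_simps algebra_simps)

lemma cpsi_multilinear: "multilinear 4 (\<lambda>vs. cpsi (r, x) (vs ! 0) (vs ! 1) (vs ! 2) (vs ! 3))"
  by (rule multilinear_4I; rule linearI; simp add: cpsi_def lin_simps algebra_simps)

lemma cpsi_skew: "skew 4 (\<lambda>vs. cpsi (r, x) (vs ! 0) (vs ! 1) (vs ! 2) (vs ! 3))"
proof (rule skew_4I)
  fix a b c d
  note o = om_skew[of "snd b" "snd a"] om_skew[of "snd c" "snd b"] om_skew[of "snd d" "snd c"]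
  show "cpsi (r, x) b a c d = - cpsi (r, x) a b c d"
    unfolding cpsi_def prod.case Om_swap12[of "snd b" "snd a"] o by (simp add: algebra_simps)
  show "cpsi (r, x) a c b d = - cpsi (r, x) a b c d"
    unfolding cpsi_def prod.case Om_swap12[of "snd c" "snd b"] Om_swap23[of _ "snd c" "snd b"] o by (simp add: algebra_simps)
  show "cpsi (r, x) a b d c = - cpsi (r, x) a b c d"
    unfolding cpsi_def prod.case Om_swap23[of _ "snd d" "snd c"] o by (simp add: algebra_simps)
qed

lemma ctorsion_multilinear: "multilinear 2 (ctorsion (r, x))"
  unfolding multilinear_2 ctorsion_def prod.case
  by (intro conjI allI linearI; simp add: lin_simps algebra_simps)

end

text \<open>The normalisation is imposed on z \<Omega> at this radius, not on \<Omega>. Thus all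
  phases give the model components, with the radial vector in place 0 and the tangential ones scaled
  by 1 / r.\<close>

locale cone_frame = cone_at +
  fixes E :: "(real ^ 6) list" assumes E: "unitary_frame E" and Om_1: "(p r + \<i> * q r) * \<Omega> x [E ! 0, E ! 2, E ! 4] = 1"
begin

sublocale unitary "g x" "J x" "\<Omega> x" E using E by unfold_locales

lemma om_table:
    "\<omega> x [E ! 0, E ! 0] = 0"
    "\<omega> x [E ! 0, E ! 1] = 1"
    "\<omega> x [E ! 0, E ! 2] = 0"
    "\<omega> x [E ! 0, E ! 3] = 0"
    "\<omega> x [E ! 0, E ! 4] = 0"
    "\<omega> x [E ! 0, E ! 5] = 0"
    "\<omega> x [E ! 1, E ! 0] = - 1"
    "\<omega> x [E ! 1, E ! 1] = 0"
    "\<omega> x [E ! 1, E ! 2] = 0"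
    "\<omega> x [E ! 1, E ! 3] = 0"
    "\<omega> x [E ! 1, E ! 4] = 0"
    "\<omega> x [E ! 1, E ! 5] = 0"
    "\<omega> x [E ! 2, E ! 0] = 0"
    "\<omega> x [E ! 2, E ! 1] = 0"
    "\<omega> x [E ! 2, E ! 2] = 0"
    "\<omega> x [E ! 2, E ! 3] = 1"
    "\<omega> x [E ! 2, E ! 4] = 0"
    "\<omega> x [E ! 2, E ! 5] = 0"
    "\<omega> x [E ! 3, E ! 0] = 0"
    "\<omega> x [E ! 3, E ! 1] = 0"
    "\<omega> x [E ! 3, E ! 2] = - 1"
    "\<omega> x [E ! 3, E ! 3] = 0"
    "\<omega> x [E ! 3, E ! 4] = 0"
    "\<omega> x [E ! 3, E ! 5] = 0"
    "\<omega> x [E ! 4, E ! 0] = 0"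
    "\<omega> x [E ! 4, E ! 1] = 0"
    "\<omega> x [E ! 4, E ! 2] = 0"
    "\<omega> x [E ! 4, E ! 3] = 0"
    "\<omega> x [E ! 4, E ! 4] = 0"
    "\<omega> x [E ! 4, E ! 5] = 1"
    "\<omega> x [E ! 5, E ! 0] = 0"
    "\<omega> x [E ! 5, E ! 1] = 0"
    "\<omega> x [E ! 5, E ! 2] = 0"
    "\<omega> x [E ! 5, E ! 3] = 0"
    "\<omega> x [E ! 5, E ! 4] = - 1"
    "\<omega> x [E ! 5, E ! 5] = 0"
  unfolding om frame_J by (simp_all add: frame_g frame_g[of "Suc 0"] linear_neg[OF g_linear(1)])

lemma Om_rotated: "a < 6 \<Longrightarrow> b < 6 \<Longrightarrow> c < 6 \<Longrightarrow> (p r + \<i> * q r) * \<Omega> x [E ! a, E ! b, E ! c] =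
    of_int (eps [a div 2, b div 2, c div 2]) * \<i> ^ (a mod 2 + b mod 2 + c mod 2)"
  unfolding Om_frame[of a b c] using Om_1 by (simp add: mult_ac)

lemma Re_rotated: "a < 6 \<Longrightarrow> b < 6 \<Longrightarrow> c < 6 \<Longrightarrow> p r * Re (\<Omega> x [E ! a, E ! b, E ! c]) - q r * Im (\<Omega> x [E ! a, E ! b, E ! c]) =
    Re (of_int (eps [a div 2, b div 2, c div 2]) * \<i> ^ (a mod 2 + b mod 2 + c mod 2))"
  and Im_rotated: "a < 6 \<Longrightarrow> b < 6 \<Longrightarrow> c < 6 \<Longrightarrow> p r * Im (\<Omega> x [E ! a, E ! b, E ! c]) + q r * Re (\<Omega> x [E ! a, E ! b, E ! c]) =
    Im (of_int (eps [a div 2, b div 2, c div 2]) * \<i> ^ (a mod 2 + b mod 2 + c mod 2))"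
  by (simp_all only: Om_rotated[symmetric]) simp_all

definition cframe :: "(real \<times> (real ^ 6)) list" where
  "cframe = (1, 0) # map (\<lambda>e. (0, (1 / r) *\<^sub>R e)) E"

lemma length_cframe: "length cframe = 7" by (simp add: cframe_def length_frame)

lemma cframe_0: "cframe ! 0 = (1, 0)" by (simp add: cframe_def)

lemma cframe_Suc: "i < 6 \<Longrightarrow> cframe ! Suc i = (0, (1 / r) *\<^sub>R E ! i)"
  by (simp add: cframe_def length_frame)

lemma cframe_nth: "cframe ! 1 = (0, (1 / r) *\<^sub>R E ! 0)" "cframe ! 2 = (0, (1 / r) *\<^sub>R E ! 1)"
  "cframe ! 3 = (0, (1 / r) *\<^sub>R E ! 2)" "cframe ! 4 = (0, (1 / r) *\<^sub>R E ! 3)"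
  "cframe ! 5 = (0, (1 / r) *\<^sub>R E ! 4)" "cframe ! 6 = (0, (1 / r) *\<^sub>R E ! 5)"
  using cframe_Suc[of 0] cframe_Suc[of 1] cframe_Suc[of 2] cframe_Suc[of 3] cframe_Suc[of 4] cframe_Suc[of 5]
  by (simp_all add: eval_nat_numeral)

lemma zero_simps: "g x [0, u] = 0" "g x [u, 0] = 0" "\<omega> x [0, u] = 0" "\<omega> x [u, 0] = 0"
  "\<Omega> x [0, u, v] = 0" "\<Omega> x [u, 0, v] = 0" "\<Omega> x [u, v, 0] = 0"
  using linear_0[OF g_linear(1)] linear_0[OF g_linear(2)] linear_0[OF om_linear(1)] linear_0[OF om_linear(2)]
    linear_0[OF Om_linear(1)] linear_0[OF Om_linear(2)] linear_0[OF Om_linear(3)] by auto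

lemma cframe_orthonormal: "orthonormal_frame (cmetric (r, x)) cframe"
  unfolding orthonormal_frame_def
proof (intro conjI allI impI)
  show "length cframe = DIM(real \<times> (real ^ 6))" by (simp add: length_cframe)
  fix i j assume "i < DIM(real \<times> (real ^ 6))" "j < DIM(real \<times> (real ^ 6))"
  then have "i < 7" "j < 7" by simp_all
  then show "cmetric (r, x) [cframe ! i, cframe ! j] = (if i = j then 1 else 0)"
    by (cases i; cases j) (auto simp: cmetric_def cframe_0 cframe_Suc zero_simps lin_simps frame_g r[THEN less_imp_neq, symmetric] power2_eq_square)
qed

lemma Phi_cframe: "i < j \<Longrightarrow> j < k \<Longrightarrow> k < 7 \<Longrightarrow> \<Phi> (r, x) [cframe ! i, cframe ! j, cframe ! k] = phi0 i j k"
proof -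
  assume "i < j" "j < k" "k < 7"
  then have t: "[i, j, k] \<in> set triples7" by (rule triples7)
  have r0: "r \<noteq> 0" using r by simp
  have Re: "r ^ 3 * (p r * (Re z * (1 / r * (1 / r * (1 / r)))) - q r * (Im z * (1 / r * (1 / r * (1 / r))))) = p r * Re z - q r * Im z" for z
    using r0 by (simp add: field_simps power3_eq_cube)
  have o: "r\<^sup>2 * (1 / r * (1 / r * z)) = z" for z
    using r0 by (simp add: field_simps power2_eq_square)
  from t show ?thesis
    unfolding triples7_def Phi[OF r x]
    by (simp only: set_simps insert_iff empty_iff list.inject)
      (elim disjE FalseE conjE; simp del: One_nat_def add: cframe_0 cframe_nth zero_simps lin_simps om_table Re_rotated phi0_def power2_eq_square power3_eq_cube power4_eq_xxxx r0 field_simps)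
qed

lemma framed: "framed_G2 (\<Phi> (r, x)) (cmetric (r, x)) cframe"
proof
  show "multilinear 3 (\<Phi> (r, x))" by (rule Phi_multilinear)
  show "alternating 3 (\<Phi> (r, x))" by (rule skew_alternating[OF Phi_skew])
  show "multilinear 2 (cmetric (r, x))" by (rule cmetric_multilinear)
  show on: "orthonormal_frame (cmetric (r, x)) cframe" by (rule cframe_orthonormal)
  then have ol: "orthonormal_list (cmetric (r, x)) cframe" by (simp add: orthonormal_frame_iff)
  show "G2_frame (\<Phi> (r, x)) cframe"
    unfolding G2_frame_def
    using length_cframe orthonormal_independent[OF cmetric_multilinear ol] orthonormal_distinct[OF ol] Phi_cframe by auto
qed

lemma psi_eq: "G2_psi \<Phi> (r, x) [a, b, c, d] = cpsi (r, x) a b c d"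
proof -
  have "G2_psi \<Phi> (r, x) [a, b, c, d] = (\<lambda>vs. cpsi (r, x) (vs ! 0) (vs ! 1) (vs ! 2) (vs ! 3)) [a, b, c, d]"
  proof (rule G2_psi_eqI[where \<phi> = \<Phi> and x = "(r, x)", OF framed cpsi_multilinear cpsi_skew])
    have r0: "r \<noteq> 0" using r by simp
    fix js assume js: "js \<in> set quadruples"
    then show "cpsi (r, x) (map ((!) cframe) js ! 0) (map ((!) cframe) js ! 1) (map ((!) cframe) js ! 2) (map ((!) cframe) js ! 3) = of_int (psi_model js)"
      unfolding quadruples_def
      by (simp only: set_simps insert_iff empty_iff)
        (elim disjE FalseE conjE; simp del: One_nat_def add: cpsi_def cframe_0 cframe_nth zero_simps lin_simps om_table Im_rotated psi_model_def power2_eq_square power3_eq_cube power4_eq_xxxx r0 field_simps)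
  qed simp
  then show ?thesis by (simp add: numeral_2_eq_2 numeral_3_eq_3)
qed

end

context cone_at
begin

lemma cone_frame_exists: obtains E where "cone_frame U g \<omega> J \<Omega> \<Phi> p q \<alpha> r x E"
proof -
  have "(cmod (p r + \<i> * q r))\<^sup>2 = 1" unfolding cmod_power2 using unit[OF r] by simp
  then have "cmod (p r + \<i> * q r) = 1" using norm_ge_zero[of "p r + \<i> * q r"] by (auto simp: power2_eq_1_iff)
  from special_frame_exists[OF this] obtain E where "unitary_frame E" "(p r + \<i> * q r) * \<Omega> x [E ! 0, E ! 2, E ! 4] = 1"
    by blast
  then have "cone_frame U g \<omega> J \<Omega> \<Phi> p q \<alpha> r x E" by unfold_locales
  then show thesis by (rule that)
qed

lemma metric_eq: "G2_metric \<Phi> (r, x) [u, v] = cmetric (r, x) [u, v]"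
  and metric_inner_product: "inner_product (G2_metric \<Phi> (r, x))"
proof -
  obtain E where "cone_frame U g \<omega> J \<Omega> \<Phi> p q \<alpha> r x E" by (rule cone_frame_exists)
  then interpret cone_frame U g \<omega> J \<Omega> \<Phi> p q \<alpha> r x E .
  show "G2_metric \<Phi> (r, x) [u, v] = cmetric (r, x) [u, v]" "inner_product (G2_metric \<Phi> (r, x))"
    using G2_metric_framed(2,4)[where \<phi> = \<Phi> and x = "(r, x)", OF framed] by blast+
qed

lemma psi_cpsi: "G2_psi \<Phi> (r, x) [a, b, c, d] = cpsi (r, x) a b c d"
proof -
  obtain E where "cone_frame U g \<omega> J \<Omega> \<Phi> p q \<alpha> r x E" by (rule cone_frame_exists)
  then interpret cone_frame U g \<omega> J \<Omega> \<Phi> p q \<alpha> r x E .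
  show ?thesis by (rule psi_eq)
qed

section \<open>Levi-Civita connection and torsion of the cone\<close>

lemma snd_derivative:
  "F differentiable (at x) \<Longrightarrow> ((\<lambda>y. F (snd y)) has_derivative (\<lambda>w. D F x (snd w))) (at (r, x))"
  using diff_chain_at[OF bounded_linear_imp_has_derivative[OF bounded_linear_snd, of "at (r, x)"], of F "frechet_derivative F (at x)"]
    D_has_derivative[of F x] by (simp add: o_def)

lemma fst_derivative:
  "(h has_real_derivative h') (at r) \<Longrightarrow> ((\<lambda>y. h (fst y)) has_derivative (\<lambda>w. h' * fst w)) (at (r, x))"
  using diff_chain_at[OF bounded_linear_imp_has_derivative[OF bounded_linear_fst, of "at (r, x)"], of h "(*) h'"]
  by (simp add: o_def has_field_derivative_def)

text \<open>The classical connection of a cone, that is, of the warped product with warping function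
  r.\<close>

definition cGam :: "real \<times> (real ^ 6) \<Rightarrow> real \<times> (real ^ 6) \<Rightarrow> real \<times> (real ^ 6)" where
  "cGam a b = (- r * g x [snd a, snd b], \<Gamma> (snd a) (snd b) + (1 / r) *\<^sub>R (fst a *\<^sub>R snd b + fst b *\<^sub>R snd a))"

lemma D_cmetric: "D (\<lambda>y. cmetric y [u, v]) (r, x) w =
    2 * r * fst w * g x [snd u, snd v] + r\<^sup>2 * D (\<lambda>y. g y [snd u, snd v]) x (snd w)"
proof -
  have "((\<lambda>y. fst u * fst v + (fst y)\<^sup>2 * g (snd y) [snd u, snd v]) has_derivative
      (\<lambda>w. 2 * r * fst w * g x [snd u, snd v] + r\<^sup>2 * D (\<lambda>y. g y [snd u, snd v]) x (snd w))) (at (r, x))"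
    by (rule derivative_eq_intros snd_derivative[of "\<lambda>y. g y [snd u, snd v]", OF diff_g] refl)+
      (simp add: fun_eq_iff)
  then have "((\<lambda>y. cmetric y [u, v]) has_derivative
      (\<lambda>w. 2 * r * fst w * g x [snd u, snd v] + r\<^sup>2 * D (\<lambda>y. g y [snd u, snd v]) x (snd w))) (at (r, x))"
    by (simp add: cmetric_def)
  then show ?thesis by (rule D_eqI)
qed

lemma D_metric: "D (\<lambda>y. G2_metric \<Phi> y [u, v]) (r, x) w = D (\<lambda>y. cmetric y [u, v]) (r, x) w"
proof -
  have "G2_metric \<Phi> y [u, v] = cmetric y [u, v]" if "y \<in> W" for y
  proof -
    interpret Y: cone_at U g \<omega> J \<Omega> \<Phi> p q \<alpha> "fst y" "snd y"
      by unfold_locales (use that in auto)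
    show ?thesis using Y.metric_eq[of u v] by simp
  qed
  then show ?thesis using D_cong[OF open_W in_W, of "\<lambda>y. G2_metric \<Phi> y [u, v]" "\<lambda>y. cmetric y [u, v]"] by simp
qed

lemma levi_civita_cone: "levi_civita (G2_metric \<Phi>) (r, x) = cGam"
proof (rule levi_civita_unique[where g = "G2_metric \<Phi>" and x = "(r, x)", OF _ metric_inner_product])
  note Gl = linear_add[OF Gam_linear(1)] linear_cmul[OF Gam_linear(1)] linear_add[OF Gam_linear(2)] linear_cmul[OF Gam_linear(2)]
  have r0: "r \<noteq> 0" using r by simp
  show "is_levi_civita (G2_metric \<Phi>) (r, x) cGam"
    unfolding is_levi_civita_def
  proof (intro conjI allI)
    show "bilinear cGam"
      unfolding bilinear_def
      by (intro conjI allI linearI; simp add: cGam_def lin_simps Gl algebra_simps)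
    show "cGam u v = cGam v u" for u v
      by (simp add: cGam_def Gam_sym[of "snd u"] g_sym[of "snd u"] add.commute)
    show "D (\<lambda>y. G2_metric \<Phi> y [u, v]) (r, x) w =
        G2_metric \<Phi> (r, x) [cGam w u, v] + G2_metric \<Phi> (r, x) [u, cGam w v]" for u v w
      unfolding D_metric D_cmetric metric_eq metric_compat
      using r0 g_sym[of "snd w" "snd u"]
      by (simp add: cmetric_def cGam_def lin_simps field_simps power2_eq_square)
  qed
qed

lemma D_Phi: "D (\<lambda>y. \<Phi> y [a, b, c]) (r, x) P =
    - 2 * r * fst P * (fst a * \<omega> x [snd b, snd c] + fst b * \<omega> x [snd c, snd a] + fst c * \<omega> x [snd a, snd b])
    - r\<^sup>2 * (fst a * D (\<lambda>y. \<omega> y [snd b, snd c]) x (snd P) + fst b * D (\<lambda>y. \<omega> y [snd c, snd a]) x (snd P) + fst c * D (\<lambda>y. \<omega> y [snd a, snd b]) x (snd P))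
    + 3 * r\<^sup>2 * fst P * (p r * Re (\<Omega> x [snd a, snd b, snd c]) - q r * Im (\<Omega> x [snd a, snd b, snd c]))
    + r ^ 3 * (- \<alpha> r * q r * fst P * Re (\<Omega> x [snd a, snd b, snd c]) - \<alpha> r * p r * fst P * Im (\<Omega> x [snd a, snd b, snd c])
       + p r * Re (D (\<lambda>y. \<Omega> y [snd a, snd b, snd c]) x (snd P)) - q r * Im (D (\<lambda>y. \<Omega> y [snd a, snd b, snd c]) x (snd P)))"
  (is "_ = ?d P")
proof -
  have "\<Phi> y [a, b, c] = - (fst y)\<^sup>2 * (fst a * \<omega> (snd y) [snd b, snd c] + fst b * \<omega> (snd y) [snd c, snd a] + fst c * \<omega> (snd y) [snd a, snd b])
      + fst y ^ 3 * (p (fst y) * Re (\<Omega> (snd y) [snd a, snd b, snd c]) - q (fst y) * Im (\<Omega> (snd y) [snd a, snd b, snd c]))"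
    if "y \<in> W" for y
    using Phi[of "fst y" "snd y" a b c] that by (auto simp: mem_Times_iff)
  then have "D (\<lambda>y. \<Phi> y [a, b, c]) (r, x) P = D (\<lambda>y. - (fst y)\<^sup>2 * (fst a * \<omega> (snd y) [snd b, snd c] + fst b * \<omega> (snd y) [snd c, snd a] + fst c * \<omega> (snd y) [snd a, snd b])
      + fst y ^ 3 * (p (fst y) * Re (\<Omega> (snd y) [snd a, snd b, snd c]) - q (fst y) * Im (\<Omega> (snd y) [snd a, snd b, snd c]))) (r, x) P"
    using D_cong[OF open_W in_W, of "\<lambda>y. \<Phi> y [a, b, c]"] by simp
  also have "\<dots> = ?d P"
  proof (rule D_eqI)
    note s = snd_derivative[of "\<lambda>y. \<omega> y [_, _]", OF diff_om] snd_derivative[of "\<lambda>y. \<Omega> y [_, _, _]", OF diff_Om]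
      fst_derivative[OF deriv_p[OF r]] fst_derivative[OF deriv_q[OF r]]
      bounded_linear.has_derivative[OF bounded_linear_Re] bounded_linear.has_derivative[OF bounded_linear_Im]
    show "((\<lambda>y. - (fst y)\<^sup>2 * (fst a * \<omega> (snd y) [snd b, snd c] + fst b * \<omega> (snd y) [snd c, snd a] + fst c * \<omega> (snd y) [snd a, snd b])
      + fst y ^ 3 * (p (fst y) * Re (\<Omega> (snd y) [snd a, snd b, snd c]) - q (fst y) * Im (\<Omega> (snd y) [snd a, snd b, snd c]))) has_derivative ?d) (at (r, x))"
      by (rule derivative_eq_intros s refl)+ (simp add: fun_eq_iff algebra_simps power2_eq_square power3_eq_cube)
  qed
  finally show ?thesis .
qed

text \<open>The torsion with its second index raised, see \<open>ctorsion_tau\<close>. Contracting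
  the torsion with the dual 4-form then just inserts \<open>tau P\<close> into the first slot, so
  the torsion equation can be verified without a sum over a frame.\<close>

definition tau :: "real \<times> (real ^ 6) \<Rightarrow> real \<times> (real ^ 6)" where
  "tau P = (\<alpha> r * fst P, (1 / r) *\<^sub>R ((p r - 1) *\<^sub>R J x (snd P) + q r *\<^sub>R snd P))"

lemma om_tau: "\<omega> x [snd (tau P), u] = ((1 - p r) * g x [snd P, u] + q r * \<omega> x [snd P, u]) / r"
  unfolding tau_def snd_conv lin_simps om_J using r by (simp add: field_simps)

text \<open>On vectors tangent to N, \<open>tau\<close> is multiplication by \<i> (cnj z - 1) / r.
  Since |z| = 1, z times this factor is \<i> (1 - z) / r, whose effect on \<Omega> is read off
  here.\<close>

lemma Om_tau: "p r * Im (\<Omega> x [snd (tau P), u, v]) + q r * Re (\<Omega> x [snd (tau P), u, v]) =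
    (q r * Im (\<Omega> x [snd P, u, v]) + (1 - p r) * Re (\<Omega> x [snd P, u, v])) / r"
proof -
  have r0: "r \<noteq> 0" using r by simp
  let ?O = "\<Omega> x [snd P, u, v]"
  have O: "\<Omega> x [snd (tau P), u, v] = (1 / r) *\<^sub>R ((p r - 1) *\<^sub>R (\<i> * ?O) + q r *\<^sub>R ?O)"
    unfolding tau_def by (simp add: lin_simps Om_J)
  have "p r * Im (\<Omega> x [snd (tau P), u, v]) + q r * Re (\<Omega> x [snd (tau P), u, v]) =
      (q r * Im ?O + ((p r)\<^sup>2 + (q r)\<^sup>2 - p r) * Re ?O) / r"
    unfolding O using r0 by (simp add: field_simps power2_eq_square)
  then show ?thesis unfolding unit[OF r] by simp
qed

lemma D_om_eq: "D (\<lambda>y. \<omega> y [u, v]) x w = - Re (\<Omega> x [w, u, v]) + \<omega> x [\<Gamma> w u, v] + \<omega> x [u, \<Gamma> w v]"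
  using nom_formula[of w u v] unfolding nom_def by simp

lemma D_Om_eq: "D (\<lambda>y. \<Omega> y [u, v, z]) x w = (g x [w, u] + \<i> * \<omega> x [w, u]) * \<omega> x [v, z]
    + (g x [w, v] + \<i> * \<omega> x [w, v]) * \<omega> x [z, u] + (g x [w, z] + \<i> * \<omega> x [w, z]) * \<omega> x [u, v]
    + \<Omega> x [\<Gamma> w u, v, z] + \<Omega> x [u, \<Gamma> w v, z] + \<Omega> x [u, v, \<Gamma> w z]"
  using nOm_formula[of w u v z] unfolding nOm_def by (simp add: algebra_simps)

text \<open>The torsion equation in terms of \<open>tau\<close>. The formulas for \<nabla>\<omega>
  and \<nabla>\<Omega> remove all derivatives on N, the connection terms of N cancel, and pointwise
  algebra remains.\<close>

lemma cov_deriv_Phi: "cov_deriv (G2_metric \<Phi>) \<Phi> (r, x) [P, a, b, c] = cpsi (r, x) (tau P) a b c"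
proof -
  have r0: "r \<noteq> 0" using r by simp
  have t1: "fst (tau P) = \<alpha> r * fst P" by (simp add: tau_def)
  \<comment> \<open>Brings the arguments of \<Omega> and \<omega> into the order P, a, b, c, so that
    equal terms become syntactically equal and cancel.\<close>
  note sw = Om_swap12[of "snd a" "snd P" "snd c"] Om_swap12[of "snd a" "snd P" "snd b"] Om_rot(1)[of "snd a" "snd b" "snd P"]
    Om_swap12[of "snd b" "snd P" "snd a"] Om_swap12[of "snd b" "snd P" "snd c"] Om_swap23[of "snd P" "snd b" "snd a"]
    Om_swap23[of "snd P" "snd c" "snd a"] Om_swap23[of "snd P" "snd c" "snd b"]
    om_skew[of "snd a" "snd P"] om_skew[of "snd b" "snd P"] om_skew[of "snd c" "snd P"]
    om_skew[of "snd b" "snd a"] om_skew[of "snd c" "snd a"] om_skew[of "snd c" "snd b"]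
  show ?thesis
    unfolding cov_deriv_3 levi_civita_cone D_Phi D_om_eq D_Om_eq Phi[OF r x] cpsi_def prod.case om_tau Om_tau t1 cGam_def fst_conv snd_conv lin_simps
    unfolding sw
    using r0 by (simp add: field_simps power2_eq_square power3_eq_cube power4_eq_xxxx)
qed

lemma ctorsion_tau: "ctorsion (r, x) [P, v] = cmetric (r, x) [tau P, v]"
proof -
  have *: "g x [snd (tau P), snd v] = ((p r - 1) * \<omega> x [snd P, snd v] + q r * g x [snd P, snd v]) / r"
    unfolding tau_def snd_conv lin_simps om by simp
  have r2: "r\<^sup>2 * (z / r) = r * z" for z using r by (simp add: power2_eq_square)
  have "cmetric (r, x) [tau P, v] = \<alpha> r * fst P * fst v + r\<^sup>2 * g x [snd (tau P), snd v]"
    by (simp add: cmetric_def tau_def)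
  also have "\<dots> = ctorsion (r, x) [P, v]"
    unfolding * r2 by (simp add: ctorsion_def algebra_simps)
  finally show ?thesis ..
qed

lemma torsion_eq: "G2_torsion \<Phi> (r, x) [u, v] = ctorsion (r, x) [u, v]"
  and torsion_multilinear: "multilinear 2 (G2_torsion \<Phi> (r, x))"
proof -
  obtain E where "cone_frame U g \<omega> J \<Omega> \<Phi> p q \<alpha> r x E" by (rule cone_frame_exists)
  then interpret cone_frame U g \<omega> J \<Omega> \<Phi> p q \<alpha> r x E .
  have T: "cov_deriv (G2_metric \<Phi>) \<Phi> (r, x) [P, a, b, c] =
      (\<Sum>k<7. ctorsion (r, x) [P, cframe ! k] * G2_psi \<Phi> (r, x) [cframe ! k, a, b, c])" for P a b c
  proof -
    have lin: "linear (\<lambda>u. cpsi (r, x) u a b c)"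
      using multilinear_linear[OF cpsi_multilinear, of "[]" _ "[a, b, c]"] by (simp add: numeral_2_eq_2 numeral_3_eq_3)
    \<comment> \<open>Expanding \<open>tau P\<close> in the frame restores the contraction over q
      that the definition of the torsion demands.\<close>
    have "cpsi (r, x) (tau P) a b c = cpsi (r, x) (\<Sum>k<7. cmetric (r, x) [cframe ! k, tau P] *\<^sub>R cframe ! k) a b c"
      using orthonormal_frame_expand[OF cmetric_multilinear cframe_orthonormal, of "tau P"] by simp
    also have "\<dots> = (\<Sum>k<7. cmetric (r, x) [cframe ! k, tau P] * cpsi (r, x) (cframe ! k) a b c)"
      by (simp add: linear_sum[OF lin] linear_cmul[OF lin])
    also have "\<dots> = (\<Sum>k<7. ctorsion (r, x) [P, cframe ! k] * G2_psi \<Phi> (r, x) [cframe ! k, a, b, c])"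
      unfolding psi_cpsi ctorsion_tau
      by (rule sum.cong) (simp_all add: cmetric_def g_sym[of _ "snd (tau P)"] mult.commute)
    finally show ?thesis unfolding cov_deriv_Phi .
  qed
  show "G2_torsion \<Phi> (r, x) [u, v] = ctorsion (r, x) [u, v]" "multilinear 2 (G2_torsion \<Phi> (r, x))"
    by (rule G2_torsion_eqI[where \<phi> = \<Phi> and x = "(r, x)", OF framed ctorsion_multilinear T])+
qed

section \<open>Divergence and norm of the torsion, radial vector fields\<close>

lemma D_torsion: "D (\<lambda>y. G2_torsion \<Phi> y [u, v]) (r, x) w = D (\<lambda>y. ctorsion y [u, v]) (r, x) w"
proof -
  have "G2_torsion \<Phi> y [u, v] = ctorsion y [u, v]" if "y \<in> W" for y
  proof -
    interpret Y: cone_at U g \<omega> J \<Omega> \<Phi> p q \<alpha> "fst y" "snd y"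
      by unfold_locales (use that in auto)
    show ?thesis using Y.torsion_eq[of u v] by simp
  qed
  then show ?thesis
    using D_cong[OF open_W in_W, of "\<lambda>y. G2_torsion \<Phi> y [u, v]" "\<lambda>y. ctorsion y [u, v]"] by simp
qed

text \<open>With a radial second argument the torsion is \<alpha> dr, which yields \<alpha>'. Each
  of the six tangential directions adds \<alpha> / r - q / r^2 through the connection terms of the
  cone.\<close>

lemma div_torsion_radial:
  assumes "(\<alpha> has_real_derivative \<alpha>') (at r)"
  shows "div_torsion \<Phi> (r, x) (1, 0) = \<alpha>' + 6 * \<alpha> r / r - 6 * q r / r\<^sup>2"
proof -
  obtain E where "cone_frame U g \<omega> J \<Omega> \<Phi> p q \<alpha> r x E" by (rule cone_frame_exists)
  then interpret cone_frame U g \<omega> J \<Omega> \<Phi> p q \<alpha> r x E .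
  have r0: "r \<noteq> 0" using r by simp
  define Q where "Q a b = \<alpha>' * fst a * fst b + \<alpha> r * r * g x [snd a, snd b] - q r * g x [snd b, snd a]
      - (p r - 1) * \<omega> x [snd b, snd a]" for a b :: "real \<times> (real ^ 6)"
  have cov: "cov_deriv (G2_metric \<Phi>) (G2_torsion \<Phi>) (r, x) [a, b, (1, 0)] = Q a b" for a b
  proof -
    have h: "((\<lambda>y. \<alpha> (fst y) * fst b) has_derivative (\<lambda>w. \<alpha>' * fst w * fst b)) (at (r, x))"
      by (rule derivative_eq_intros fst_derivative[OF assms] refl)+ simp
    have "ctorsion y [b, (1, 0)] = \<alpha> (fst y) * fst b" if "y \<in> W" for y
    proof -
      interpret Y: NK_at U g \<omega> J \<Omega> "snd y" by unfold_locales (use that in auto)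
      show ?thesis
        by (simp add: ctorsion_def case_prod_unfold linear_0[OF Y.g_linear(2)] linear_0[OF Y.om_linear(2)])
    qed
    then have "D (\<lambda>y. ctorsion y [b, (1, 0)]) (r, x) a = D (\<lambda>y. \<alpha> (fst y) * fst b) (r, x) a"
      using D_cong[OF open_W in_W, of "\<lambda>y. ctorsion y [b, (1, 0)]" "\<lambda>y. \<alpha> (fst y) * fst b"] by simp
    also have "\<dots> = \<alpha>' * fst a * fst b" by (rule D_eqI[OF h])
    finally have "D (\<lambda>y. ctorsion y [b, (1, 0)]) (r, x) a = \<alpha>' * fst a * fst b" .
    then show ?thesis
      unfolding cov_deriv_2 D_torsion torsion_eq levi_civita_cone
      using r0 by (simp add: Q_def ctorsion_def cGam_def zero_simps lin_simps linear_0[OF Gam_linear(1)] field_simps)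
  qed
  have "div_torsion \<Phi> (r, x) (1, 0) = (\<Sum>i<DIM(real \<times> (real ^ 6)). Q (cframe ! i) (cframe ! i))"
    unfolding div_torsion_def
  proof (rule contract_1[where Q = Q and E = cframe])
    show "multilinear 2 (G2_metric \<Phi> (r, x))" "orthonormal_frame (G2_metric \<Phi> (r, x)) cframe"
      using G2_metric_framed(1,3)[where \<phi> = \<Phi> and x = "(r, x)", OF framed] by blast+
    show "linear (\<lambda>u. Q u v)" "linear (\<lambda>v. Q u v)" for u v
      unfolding Q_def by (rule linearI; simp add: lin_simps algebra_simps)+
    show "cov_deriv (G2_metric \<Phi>) (G2_torsion \<Phi>) (r, x) ([e] @ [e] @ [(1, 0)]) = Q e e" for e
      using cov[of e e] by simp
  qed
  also have "\<dots> = Q (cframe ! 0) (cframe ! 0) + (\<Sum>i<6. Q (cframe ! Suc i) (cframe ! Suc i))"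
    by (simp add: sum.lessThan_Suc_shift[of _ 6, simplified] flip: sum.lessThan_Suc_shift)
  also have "(\<Sum>i<6. Q (cframe ! Suc i) (cframe ! Suc i)) = (\<Sum>i<6::nat. \<alpha> r / r - q r / r\<^sup>2)"
    by (rule sum.cong) (simp_all add: Q_def cframe_Suc lin_simps frame_g om_self r0 field_simps power2_eq_square)
  also have "Q (cframe ! 0) (cframe ! 0) = \<alpha>'"
    by (simp add: Q_def cframe_0 zero_simps)
  finally show ?thesis by (simp add: field_simps)
qed

text \<open>In the frame there are \<alpha> once, q / r six times on the diagonal and, up to sign,
  (p - 1) / r six times from \<omega>. On the unit circle q^2 + (p - 1)^2 = 2 (1 - p), whence the
  12.\<close>

lemma torsion_norm_sq_cone:
  "torsion_norm_sq \<Phi> (r, x) = (\<alpha> r)\<^sup>2 + 12 * (1 - p r) / r\<^sup>2"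
proof -
  obtain E where "cone_frame U g \<omega> J \<Omega> \<Phi> p q \<alpha> r x E" by (rule cone_frame_exists)
  then interpret cone_frame U g \<omega> J \<Omega> \<Phi> p q \<alpha> r x E .
  have r0: "r \<noteq> 0" using r by simp
  let ?T = "\<lambda>i j. G2_torsion \<Phi> (r, x) [cframe ! i, cframe ! j]"
  have s7: "(\<Sum>i<7. f i) = f 0 + (\<Sum>i<6. f (Suc i))" for f :: "nat \<Rightarrow> real"
    using sum.lessThan_Suc_shift[of f 6] by simp
  have s6: "(\<Sum>i<6. f i) = f 0 + f 1 + f 2 + f 3 + f 4 + f (5 :: nat)" for f :: "nat \<Rightarrow> real"
    using sum_lessThan_6[of f] by simp
  have t00: "?T 0 0 = \<alpha> r" by (simp add: torsion_eq ctorsion_def cframe_0 zero_simps)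
  have t0: "?T 0 (Suc i) = 0" "?T (Suc i) 0 = 0" if "i < 6" for i
    using that by (simp_all add: torsion_eq ctorsion_def cframe_0 cframe_Suc zero_simps)
  have t1: "?T (Suc i) (Suc j) = (q r * g x [E ! i, E ! j] + (p r - 1) * \<omega> x [E ! i, E ! j]) / r" if "i < 6" "j < 6" for i j
    using that r0 by (simp add: torsion_eq ctorsion_def cframe_Suc lin_simps field_simps)
  have "torsion_norm_sq \<Phi> (r, x) = (\<Sum>i<DIM(real \<times> (real ^ 6)). \<Sum>j<DIM(real \<times> (real ^ 6)). ?T i j * ?T i j)"
    unfolding torsion_norm_sq_def
    by (rule contract_2[OF G2_metric_framed(1,3)[where \<phi> = \<Phi> and x = "(r, x)", OF framed] torsion_multilinear torsion_multilinear]) simp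
  also have "\<dots> = (\<Sum>i<7. \<Sum>j<7. ?T i j * ?T i j)" by simp
  also have "\<dots> = (\<alpha> r)\<^sup>2 + (\<Sum>i<6. \<Sum>j<6. ((q r * g x [E ! i, E ! j] + (p r - 1) * \<omega> x [E ! i, E ! j]) / r)\<^sup>2)"
    unfolding s7 by (simp add: t00 t0 t1 power2_eq_square)
  also have "(\<Sum>i<6. \<Sum>j<6. ((q r * g x [E ! i, E ! j] + (p r - 1) * \<omega> x [E ! i, E ! j]) / r)\<^sup>2) = 6 * ((q r)\<^sup>2 + (p r - 1)\<^sup>2) / r\<^sup>2"
    unfolding s6 using r0 by (simp del: One_nat_def add: frame_g om_table field_simps power2_eq_square)
  also have "(q r)\<^sup>2 + (p r - 1)\<^sup>2 = 2 * (1 - p r)"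
    using unit[OF r] by (simp add: power2_eq_square algebra_simps)
  finally show ?thesis by simp
qed

text \<open>A radial field is a gradient, so its covariant derivative is symmetric, and contraction
  with the skew \<phi> gives the negative of itself.\<close>

lemma curl_radial:
  assumes "\<And>y. y \<in> W \<Longrightarrow> Y y = (b (fst y), 0)" "(b has_real_derivative b') (at r)"
  shows "curl \<Phi> Y (r, x) v = 0"
proof -
  obtain E where "cone_frame U g \<omega> J \<Omega> \<Phi> p q \<alpha> r x E" by (rule cone_frame_exists)
  then interpret cone_frame U g \<omega> J \<Omega> \<Phi> p q \<alpha> r x E .
  let ?S = "cov_deriv (G2_metric \<Phi>) (\<lambda>y. flat (G2_metric \<Phi> y) (Y y)) (r, x)"
  have fl: "flat (G2_metric \<Phi> y) (Y y) [u] = b (fst y) * fst u" if "y \<in> W" for y u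
  proof -
    interpret Y: cone_at U g \<omega> J \<Omega> \<Phi> p q \<alpha> "fst y" "snd y"
      by unfold_locales (use that in auto)
    show ?thesis
      using Y.metric_eq[of "Y y" u] by (simp add: flat_def assms(1)[OF that] cmetric_def linear_0[OF Y.g_linear(1)])
  qed
  have S: "?S [a, c] = b' * fst a * fst c + b r * r * g x [snd a, snd c]" for a c
  proof -
    have h: "((\<lambda>y. b (fst y) * fst c) has_derivative (\<lambda>w. b' * fst w * fst c)) (at (r, x))"
      by (rule derivative_eq_intros fst_derivative[OF assms(2)] refl)+ simp
    have "D (\<lambda>y. flat (G2_metric \<Phi> y) (Y y) [c]) (r, x) a = D (\<lambda>y. b (fst y) * fst c) (r, x) a"
      using D_cong[OF open_W in_W, of "\<lambda>y. flat (G2_metric \<Phi> y) (Y y) [c]" "\<lambda>y. b (fst y) * fst c"] fl by simp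
    also have "\<dots> = b' * fst a * fst c" by (rule D_eqI[OF h])
    finally have "D (\<lambda>y. flat (G2_metric \<Phi> y) (Y y) [c]) (r, x) a = b' * fst a * fst c" .
    then show ?thesis
      using fl[OF in_W] by (simp add: cov_deriv_def Let_def levi_civita_cone cGam_def)
  qed
  have sym: "?S [a, c] = ?S [c, a]" for a c unfolding S by (simp add: g_sym[of "snd a"])
  have alt: "\<Phi> (r, x) [a, c, v] = - \<Phi> (r, x) [c, a, v]" for a c
    using skewD[OF Phi_skew, of "[]" a c "[v]"] by simp
  let ?B = "\<lambda>i j. ?S [cframe ! i, cframe ! j] * \<Phi> (r, x) [cframe ! i, cframe ! j, v]"
  have "curl \<Phi> Y (r, x) v = (\<Sum>i<DIM(real \<times> (real ^ 6)). \<Sum>j<DIM(real \<times> (real ^ 6)). ?S [cframe ! i, cframe ! j] * (\<lambda>ij. \<Phi> (r, x) (ij @ [v])) [cframe ! i, cframe ! j])"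
    unfolding curl_def
  proof (rule contract_2[OF G2_metric_framed(1,3)[where \<phi> = \<Phi> and x = "(r, x)", OF framed]])
    show "multilinear 2 ?S"
      unfolding multilinear_2 S by (intro conjI allI linearI; simp add: lin_simps algebra_simps)
    show "multilinear 2 (\<lambda>ij. \<Phi> (r, x) (ij @ [v]))"
      using Phi_multilinear[unfolded multilinear_3] unfolding multilinear_2 by (simp del: split_paired_All)
  qed simp
  then have 1: "curl \<Phi> Y (r, x) v = (\<Sum>i<7. \<Sum>j<7. ?B i j)" by simp
  also have "\<dots> = (\<Sum>j<7. \<Sum>i<7. ?B i j)" by (rule sum.swap)
  also have "\<dots> = (\<Sum>j<7. \<Sum>i<7. - ?B j i)"
    by (intro sum.cong refl) (subst sym, subst alt, simp)
  also have "\<dots> = - curl \<Phi> Y (r, x) v" unfolding 1 by (simp add: sum_negf)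
  finally show ?thesis by simp
qed

text \<open>In a tangential direction Y has no derivative, and along Y the metric varies only
  through r^2. The equation therefore reads 2 r b g(w, w) = 2 c r^2 g(w, w).\<close>

lemma lie_radial:
  assumes "\<And>y. y \<in> W \<Longrightarrow> Y y = (b (fst y), 0)" "(b has_real_derivative b') (at r)"
    and "lie_derivative 2 Y (G2_metric \<Phi>) (r, x) [(0, w), (0, w)] = 2 * c * G2_metric \<Phi> (r, x) [(0, w), (0, w)]"
    and "w \<noteq> 0"
  shows "b r = c * r"
proof -
  have "((\<lambda>y. (b (fst y), 0 :: real ^ 6)) has_derivative (\<lambda>w. (b' * fst w, 0))) (at (r, x))"
    by (intro has_derivative_Pair fst_derivative[OF assms(2)] has_derivative_const)
  from has_derivative_transform_within_open[OF this open_W in_W] assms(1)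
  have "(Y has_derivative (\<lambda>w. (b' * fst w, 0))) (at (r, x))" by simp
  then have Y: "D Y (r, x) (0, w) = 0" by (simp add: D_eqI zero_prod_def)
  have z: "G2_metric \<Phi> (r, x) [0, u] = 0" "G2_metric \<Phi> (r, x) [u, 0] = 0" for u
    using linear_0[OF inner_product_linear(1)[OF metric_inner_product]] linear_0[OF inner_product_linear(2)[OF metric_inner_product]] by auto
  have Yx: "Y (r, x) = (b r, 0)" using assms(1)[OF in_W] by simp
  let ?u = "(0, w)"
  have "lie_derivative 2 Y (G2_metric \<Phi>) (r, x) [?u, ?u] = D (\<lambda>y. G2_metric \<Phi> y [?u, ?u]) (r, x) (Y (r, x))
      + (G2_metric \<Phi> (r, x) [D Y (r, x) ?u, ?u] + G2_metric \<Phi> (r, x) [?u, D Y (r, x) ?u])"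
    by (simp add: lie_derivative_def numeral_2_eq_2)
  also have "\<dots> = 2 * r * b r * g x [w, w] + r\<^sup>2 * D (\<lambda>y. g y [w, w]) x 0"
    unfolding Y z D_metric D_cmetric Yx by simp
  finally have "2 * r * b r * g x [w, w] + r\<^sup>2 * D (\<lambda>y. g y [w, w]) x 0 = 2 * c * (r\<^sup>2 * g x [w, w])"
    unfolding assms(3) metric_eq by (simp add: cmetric_def)
  moreover have "D (\<lambda>y. g y [w, w]) x 0 = 0" by (rule linear_0[OF D_linear[OF diff_g]])
  moreover have "g x [w, w] > 0" using ip assms(4) by (simp add: inner_product_def)
  ultimately show ?thesis using r by (simp add: power2_eq_square)
qed

end

section \<open>The cone over a nearly Kaehler manifold\<close>

lemma nearly_Kaehler_chart:
  assumes "nearly_Kaehler N g J \<omega> \<Omega>" "i \<in> index N"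
  shows "NK_chart (chart_image N i) (g i) (\<omega> i) (J i) (\<Omega> i)"
proof (rule NK_chart.intro)
  have su: "SU3_structure N g J \<omega> \<Omega>" using assms(1) by (simp add: nearly_Kaehler_def)
  have t: "tensor_field N 2 g" "endo_field N J" "tensor_field N 2 \<omega>" "tensor_field N 3 \<Omega>" "form_field N 3 \<Omega>"
    using su by (simp_all add: SU3_structure_def riemannian_metric_def form_field_def)
  show "open (chart_image N i)" using assms by (simp add: nearly_Kaehler_def smooth_manifold_def)
  show "smooth_on (chart_image N i) (\<lambda>x. g i x [u, v])" "smooth_on (chart_image N i) (\<lambda>x. \<omega> i x [u, v])" for u v
    using t(1,3) assms(2) by (simp_all add: tensor_field_def)
  show "smooth_on (chart_image N i) (\<lambda>x. \<Omega> i x [u, v, w])" for u v w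
    using t(4) assms(2) by (simp add: tensor_field_def)
  show "smooth_on (chart_image N i) (\<lambda>x. J i x v)" for v
    using t(2) assms(2) by (simp add: endo_field_def)
  fix x assume x: "x \<in> chart_image N i"
  show "ext_d 2 (\<omega> i) x [u, v, w] = - 3 * Re (\<Omega> i x [u, v, w])" for u v w
    using assms x by (simp add: nearly_Kaehler_def)
  show "ext_d 3 (\<lambda>y us. Im (\<Omega> i y us)) x [u, v, w, z] = 2 * wedge 2 2 (\<omega> i x) (\<omega> i x) [u, v, w, z]" for u v w z
    using assms x by (simp add: nearly_Kaehler_def)
  have "hermitian_point (g i x) (J i x) (\<Omega> i x)"
  proof (rule hermitian_point.intro)
    show "inner_product (g i x)" using su assms(2) x by (simp add: SU3_structure_def riemannian_metric_def)
    show "linear (J i x)" using t(2) assms(2) x by (simp add: endo_field_def)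
    show "multilinear 3 (\<Omega> i x)" using t(4) assms(2) x by (simp add: tensor_field_def)
    show "alternating 3 (\<Omega> i x)" using t(5) assms(2) x by (simp add: form_field_def)
  qed (use su assms(2) x in \<open>simp_all add: SU3_structure_def\<close>)
  then show "SU3_point (g i x) (J i x) (\<Omega> i x) (\<omega> i x)"
    using su assms(2) x by (simp add: SU3_point_def SU3_point_axioms_def SU3_structure_def)
qed

lemma cone_atlas_simps:
  "index (cone_atlas N) = index N" "dom (cone_atlas N) i = {0<..} \<times> dom N i"
  "coord (cone_atlas N) i (r, n) = (r, coord N i n)"
  by (simp_all add: cone_atlas_def)

lemma chart_image_cone: "chart_image (cone_atlas N) i = {0<..} \<times> chart_image N i"
  unfolding chart_image_def cone_atlas_simps(2) by (force simp: cone_atlas_simps(3))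

lemma (in NK_chart) skew_om: "x \<in> U \<Longrightarrow> \<omega> x [v, u] = - \<omega> x [u, v]"
proof -
  assume "x \<in> U"
  then interpret SU3_point "g x" "J x" "\<Omega> x" "\<omega> x" by (rule SU3)
  show ?thesis by (rule om_skew)
qed

lemma cone_phi_eq:
  assumes "\<And>u v. \<omega> i x [v, u] = - \<omega> i x [u, v]"
  shows "cone_phi \<omega> \<Omega> i (r, x) [u, v, w] =
      - r\<^sup>2 * (fst u * \<omega> i x [snd v, snd w] + fst v * \<omega> i x [snd w, snd u] + fst w * \<omega> i x [snd u, snd v])
      + r ^ 3 * Re (\<Omega> i x [snd u, snd v, snd w])"
proof -
  have "wedge 1 2 dr (pullback \<omega> i (r, x)) [u, v, w] =
      dr [u] * pullback \<omega> i (r, x) [v, w] + dr [v] * pullback \<omega> i (r, x) [w, u] + dr [w] * pullback \<omega> i (r, x) [u, v]"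
  proof (rule wedge_1_2)
    show "pullback \<omega> i (r, x) [t, s] = - pullback \<omega> i (r, x) [s, t]" for s t
      unfolding pullback_def by (simp, rule assms)
  qed
  then have "cone_phi \<omega> \<Omega> i (r, x) [u, v, w] = Re (complex_of_real (r ^ 3) * \<Omega> i x [snd u, snd v, snd w])
      - r\<^sup>2 * (fst u * \<omega> i x [snd v, snd w] + fst v * \<omega> i x [snd w, snd u] + fst w * \<omega> i x [snd u, snd v])"
    unfolding cone_phi_def by (simp add: dr_def pullback_def)
  then show ?thesis by (simp del: of_real_power)
qed

lemma cone_chart_phi:
  assumes "nearly_Kaehler N g J \<omega> \<Omega>" "i \<in> index N"
  shows "cone_chart (chart_image N i) (g i) (\<omega> i) (J i) (\<Omega> i) (cone_phi \<omega> \<Omega> i) (\<lambda>r. 1) (\<lambda>r. 0) (\<lambda>r. 0)"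
proof -
  interpret NK_chart "chart_image N i" "g i" "\<omega> i" "J i" "\<Omega> i" by (rule nearly_Kaehler_chart[OF assms])
  show ?thesis
  proof
    fix r :: real and x u v w assume "r > 0" "x \<in> chart_image N i"
    show "cone_phi \<omega> \<Omega> i (r, x) [u, v, w] =
      - r\<^sup>2 * (fst u * \<omega> i x [snd v, snd w] + fst v * \<omega> i x [snd w, snd u] + fst w * \<omega> i x [snd u, snd v])
      + r ^ 3 * (1 * Re (\<Omega> i x [snd u, snd v, snd w]) - 0 * Im (\<Omega> i x [snd u, snd v, snd w]))"
      unfolding cone_phi_eq[where \<omega> = \<omega>, OF skew_om[OF \<open>x \<in> chart_image N i\<close>]] by simp
  qed auto
qed

text \<open>For radial X the third term of \<open>isometric_G2\<close> is 2 a^2 times the dr \<and>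
  \<omega> part of \<open>cone_phi\<close>, which restores its coefficient f^2 - a^2 to 1. The
  second term adds 2 f a r^3 Im \<Omega>, the missing half of the rotated 3-form. The last
  assumption is half the derivative of f^2 + a^2 = 1.\<close>

lemma cone_chart_isometric:
  assumes "nearly_Kaehler N g J \<omega> \<Omega>" "i \<in> index N"
    and f: "\<And>r. r > 0 \<Longrightarrow> (f has_real_derivative f' r) (at r)"
    and a: "\<And>r. r > 0 \<Longrightarrow> (a has_real_derivative a' r) (at r)"
    and unit: "\<And>r. r > 0 \<Longrightarrow> (f r)\<^sup>2 = 1 - (a r)\<^sup>2"
    and ff': "\<And>r. r > 0 \<Longrightarrow> f r * f' r + a r * a' r = 0"
  shows "cone_chart (chart_image N i) (g i) (\<omega> i) (J i) (\<Omega> i)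
    (isometric_G2 (radial_function f) (radial_field a) (cone_phi \<omega> \<Omega>) i)
    (\<lambda>r. (f r)\<^sup>2 - (a r)\<^sup>2) (\<lambda>r. - 2 * f r * a r) (\<lambda>r. - 2 * (f r * a' r - a r * f' r))"
proof -
  interpret B: cone_chart "chart_image N i" "g i" "\<omega> i" "J i" "\<Omega> i" "cone_phi \<omega> \<Omega> i" "\<lambda>r. 1" "\<lambda>r. 0" "\<lambda>r. 0"
    by (rule cone_chart_phi[OF assms(1,2)])
  show ?thesis
  proof
    fix r :: real assume r: "r > 0"
    show "((f r)\<^sup>2 - (a r)\<^sup>2)\<^sup>2 + (- 2 * f r * a r)\<^sup>2 = 1"
      unfolding power_mult_distrib unit[OF r] by (simp add: power2_eq_square algebra_simps)
    note e = unit[OF r] ff'[OF r]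
    \<comment> \<open>This is p' = - \<alpha> q; with \<open>q\<close> below it shows that the phase
      (f - \<i> a)^2 moves on the unit circle with angular speed \<alpha>.\<close>
    have p: "2 * f r * f' r - 2 * a r * a' r = - (- 2 * (f r * a' r - a r * f' r)) * (- 2 * f r * a r)"
      using e by algebra
    show "((\<lambda>r. (f r)\<^sup>2 - (a r)\<^sup>2) has_real_derivative - (- 2 * (f r * a' r - a r * f' r)) * (- 2 * f r * a r)) (at r)"
      unfolding p[symmetric] by (rule derivative_eq_intros f[OF r] a[OF r] refl)+ simp
    have q: "- 2 * (f' r * a r + f r * a' r) = - 2 * (f r * a' r - a r * f' r) * ((f r)\<^sup>2 - (a r)\<^sup>2)"
      using e by algebra
    show "((\<lambda>r. - 2 * f r * a r) has_real_derivative - 2 * (f r * a' r - a r * f' r) * ((f r)\<^sup>2 - (a r)\<^sup>2)) (at r)"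
      unfolding q[symmetric] by (rule derivative_eq_intros f[OF r] a[OF r] refl)+ (simp add: algebra_simps)
    fix x u v w assume x: "x \<in> chart_image N i"
    interpret cone_at "chart_image N i" "g i" "\<omega> i" "J i" "\<Omega> i" "cone_phi \<omega> \<Omega> i" "\<lambda>r. 1" "\<lambda>r. 0" "\<lambda>r. 0" r x
      by unfold_locales (rule r, rule x)
    let ?u = "(a r, 0) :: real \<times> (real ^ 6)" and ?m = "G2_metric (cone_phi \<omega> \<Omega> i) (r, x)"
    have z: "g i x [0, t] = 0" "\<omega> i x [0, t] = 0" "\<omega> i x [t, 0] = 0" "\<Omega> i x [0, t, s] = 0" for s t
      using linear_0[OF g_linear(1)] linear_0[OF om_linear(1)] linear_0[OF om_linear(2)] linear_0[OF Om_linear(1)] by auto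
    have m: "?m [?u, t] = a r * fst t" for t
      unfolding metric_eq by (simp add: B.cmetric_def z)
    have i2: "cone_phi \<omega> \<Omega> i (r, x) [?u, s, t] = - r\<^sup>2 * a r * \<omega> i x [snd s, snd t]" for s t
      using B.Phi[OF r x, of ?u s t] by (simp add: z)
    have i3: "G2_psi (cone_phi \<omega> \<Omega> i) (r, x) [?u, u, v, w] = - (r ^ 3) * a r * Im (\<Omega> i x [snd u, snd v, snd w])"
      unfolding psi_cpsi B.cpsi_def by (simp add: z)
    have "wedge 1 2 (flat ?m ?u) (interior ?u (cone_phi \<omega> \<Omega> i (r, x))) [u, v, w] =
      a r * fst u * (- r\<^sup>2 * a r * \<omega> i x [snd v, snd w]) + a r * fst v * (- r\<^sup>2 * a r * \<omega> i x [snd w, snd u]) + a r * fst w * (- r\<^sup>2 * a r * \<omega> i x [snd u, snd v])"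
    proof (subst wedge_1_2)
      show "interior ?u (cone_phi \<omega> \<Omega> i (r, x)) [t, s] = - interior ?u (cone_phi \<omega> \<Omega> i (r, x)) [s, t]" for s t
        unfolding interior_def i2 om_skew[of "snd t" "snd s"] by simp
    qed (simp add: interior_def flat_def i2 m)
    then have "isometric_G2 (radial_function f) (radial_field a) (cone_phi \<omega> \<Omega>) i (r, x) [u, v, w] =
      ((f r)\<^sup>2 - (a r)\<^sup>2) * cone_phi \<omega> \<Omega> i (r, x) [u, v, w] - 2 * f r * (- (r ^ 3) * a r * Im (\<Omega> i x [snd u, snd v, snd w]))
      + 2 * (a r * fst u * (- r\<^sup>2 * a r * \<omega> i x [snd v, snd w]) + a r * fst v * (- r\<^sup>2 * a r * \<omega> i x [snd w, snd u]) + a r * fst w * (- r\<^sup>2 * a r * \<omega> i x [snd u, snd v]))"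
      unfolding isometric_G2_def Let_def radial_field_def radial_function_def fst_conv
      by (simp add: m interior_def i3 power2_eq_square)
    also have "\<dots> = - r\<^sup>2 * (fst u * \<omega> i x [snd v, snd w] + fst v * \<omega> i x [snd w, snd u] + fst w * \<omega> i x [snd u, snd v])
      + r ^ 3 * (((f r)\<^sup>2 - (a r)\<^sup>2) * Re (\<Omega> i x [snd u, snd v, snd w]) - (- 2 * f r * a r) * Im (\<Omega> i x [snd u, snd v, snd w]))"
      unfolding B.Phi[OF r x] unit[OF r] by (simp add: power2_eq_square algebra_simps)
    finally show "isometric_G2 (radial_function f) (radial_field a) (cone_phi \<omega> \<Omega>) i (r, x) [u, v, w] =
      - r\<^sup>2 * (fst u * \<omega> i x [snd v, snd w] + fst v * \<omega> i x [snd w, snd u] + fst w * \<omega> i x [snd u, snd v])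
      + r ^ 3 * (((f r)\<^sup>2 - (a r)\<^sup>2) * Re (\<Omega> i x [snd u, snd v, snd w]) - (- 2 * f r * a r) * Im (\<Omega> i x [snd u, snd v, snd w]))" .
  qed
qed

lemma smooth_on_cong:
  "open S \<Longrightarrow> (\<And>x. x \<in> S \<Longrightarrow> f x = g x) \<Longrightarrow> smooth_on S f \<longleftrightarrow> smooth_on S g"
  unfolding smooth_on_def using Ck_on_cong by blast

text \<open>On an overlap the cone's change of chart is the identity in r times that of N. The
  overlap has to be recognised as open, through the homeomorphism of a chart, before
  differentiability can be used.\<close>

lemma cone_transition:
  assumes N: "smooth_manifold N" and ij: "i \<in> index N" "j \<in> index N" and n: "n \<in> dom N i \<inter> dom N j" and r: "r > 0"
  shows "frechet_derivative (transition (cone_atlas N) i j) (at (r, coord N i n)) (h, v) =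
    (h, frechet_derivative (transition N i j) (at (coord N i n)) v)"
proof -
  have op: "open (dom N i)" "open (dom N j)" "open (chart_image N i)"
    using N ij by (auto simp: smooth_manifold_def)
  have "\<exists>k. homeomorphism (dom N i) (chart_image N i) (coord N i) k"
    using N ij(1) by (simp add: smooth_manifold_def)
  then obtain k where k: "homeomorphism (dom N i) (chart_image N i) (coord N i) k" ..
  have inj: "inj_on (coord N i) (dom N i)"
    using k unfolding homeomorphism_def by (metis inj_on_inverseI)
  let ?V = "coord N i ` (dom N i \<inter> dom N j)"
  have "openin (top_of_set (chart_image N i)) ?V"
    by (rule homeomorphism_imp_open_map[OF k]) (simp add: op(2) openin_open_Int)
  then have V: "open ?V" using op(3) openin_open_trans by blast
  have "smooth_on ?V (transition N i j)" using N ij by (simp add: smooth_manifold_def)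
  then have d: "transition N i j differentiable (at (coord N i n))"
    by (rule smooth_on_differentiable[OF V]) (use n in blast)
  have eq: "transition (cone_atlas N) i j y = (fst y, transition N i j (snd y))"
    if yV: "y \<in> {0<..} \<times> ?V" for y
  proof -
    obtain s m where y: "y = (s, coord N i m)" "s > 0" "m \<in> dom N i" using yV by auto
    have inj': "inj_on (coord (cone_atlas N) i) (dom (cone_atlas N) i)"
      using inj by (auto simp: inj_on_def cone_atlas_simps)
    have "inv_into (dom (cone_atlas N) i) (coord (cone_atlas N) i) y = (s, m)"
      by (rule inv_into_f_eq[OF inj']) (use y in \<open>auto simp: cone_atlas_simps\<close>)
    moreover have "inv_into (dom N i) (coord N i) (coord N i m) = m"
      by (rule inv_into_f_f[OF inj y(3)])
    ultimately show ?thesis unfolding transition_def y(1) by (simp add: cone_atlas_simps)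
  qed
  have W: "open ({0::real<..} \<times> ?V)" "(r, coord N i n) \<in> {0<..} \<times> ?V" using V r n by (auto intro: open_Times)
  have "((\<lambda>y. transition N i j (snd y)) has_derivative
      (\<lambda>w. frechet_derivative (transition N i j) (at (coord N i n)) (snd w))) (at (r, coord N i n))"
    using diff_chain_at[OF bounded_linear_imp_has_derivative[OF bounded_linear_snd, of "at (r, coord N i n)"],
        of "transition N i j" "frechet_derivative (transition N i j) (at (coord N i n))"]
      D_has_derivative[OF d] by (simp add: o_def)
  then have "((\<lambda>y. (fst y, transition N i j (snd y))) has_derivative
      (\<lambda>w. (fst w, frechet_derivative (transition N i j) (at (coord N i n)) (snd w)))) (at (r, coord N i n))"
    by (intro has_derivative_Pair bounded_linear_imp_has_derivative[OF bounded_linear_fst])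
  then have "(transition (cone_atlas N) i j has_derivative
      (\<lambda>w. (fst w, frechet_derivative (transition N i j) (at (coord N i n)) (snd w)))) (at (r, coord N i n))"
    by (rule has_derivative_transform_within_open[OF _ W]) (simp add: eq)
  from D_eqI[OF this] show ?thesis by simp
qed

lemma tensor_field_transition:
  assumes "tensor_field A k t" "i \<in> index A" "j \<in> index A" "p \<in> dom A i \<inter> dom A j" "length vs = k"
  shows "t i (coord A i p) vs = t j (coord A j p) (map (frechet_derivative (transition A i j) (at (coord A i p))) vs)"
proof -
  note assms(1)[unfolded tensor_field_def, THEN conjunct2, THEN conjunct2, rule_format, OF assms(2-5)]
  then show ?thesis .
qed

text \<open>For \<open>\<phi>\<close> this property is contained in the soliton hypothesis; for
  \<open>\<phi>b\<close> smoothness and the transformation law are inherited from \<omega> and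
  \<Omega>.\<close>

lemma G2_structure_cone:
  assumes NK: "nearly_Kaehler N g J \<omega> \<Omega>"
  shows "G2_structure (cone_atlas N) (cone_phi \<omega> \<Omega>)"
proof -
  have su: "SU3_structure N g J \<omega> \<Omega>" and N: "smooth_manifold N" using NK by (simp_all add: nearly_Kaehler_def)
  have t: "tensor_field N 2 \<omega>" "tensor_field N 3 \<Omega>"
    using su by (simp_all add: SU3_structure_def form_field_def)
  have at: "cone_at (chart_image N i) (g i) (\<omega> i) (J i) (\<Omega> i) (cone_phi \<omega> \<Omega> i) (\<lambda>r. 1) (\<lambda>r. 0) (\<lambda>r. 0) (fst y) (snd y)"
    if "i \<in> index N" "y \<in> chart_image (cone_atlas N) i" for i y
    using cone_chart_phi[OF NK that(1)] that(2)
    by (auto simp: cone_at_def cone_at_axioms_def chart_image_cone)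
  have pointwise: "multilinear 3 (cone_phi \<omega> \<Omega> i y)" "alternating 3 (cone_phi \<omega> \<Omega> i y)" "\<exists>E. G2_frame (cone_phi \<omega> \<Omega> i y) E"
    if "i \<in> index N" "y \<in> chart_image (cone_atlas N) i" for i y
  proof -
    interpret cone_at "chart_image N i" "g i" "\<omega> i" "J i" "\<Omega> i" "cone_phi \<omega> \<Omega> i" "\<lambda>r. 1" "\<lambda>r. 0" "\<lambda>r. 0" "fst y" "snd y"
      by (rule at[OF that])
    show "multilinear 3 (cone_phi \<omega> \<Omega> i y)" using Phi_multilinear by simp
    show "alternating 3 (cone_phi \<omega> \<Omega> i y)" using skew_alternating[OF Phi_skew] by simp
    obtain E where "cone_frame (chart_image N i) (g i) (\<omega> i) (J i) (\<Omega> i) (cone_phi \<omega> \<Omega> i) (\<lambda>r. 1) (\<lambda>r. 0) (\<lambda>r. 0) (fst y) (snd y) E"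
      by (rule cone_frame_exists)
    then interpret cone_frame "chart_image N i" "g i" "\<omega> i" "J i" "\<Omega> i" "cone_phi \<omega> \<Omega> i" "\<lambda>r. 1" "\<lambda>r. 0" "\<lambda>r. 0" "fst y" "snd y" E .
    show "\<exists>E. G2_frame (cone_phi \<omega> \<Omega> i y) E" using framed by (auto simp: framed_G2_def)
  qed
  have smooth: "smooth_on (chart_image (cone_atlas N) i) (\<lambda>y. cone_phi \<omega> \<Omega> i y vs)"
    if i: "i \<in> index N" and vs: "length vs = 3" for i vs
  proof -
    interpret cone_chart "chart_image N i" "g i" "\<omega> i" "J i" "\<Omega> i" "cone_phi \<omega> \<Omega> i" "\<lambda>r. 1" "\<lambda>r. 0" "\<lambda>r. 0"
      by (rule cone_chart_phi[OF NK i])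
    let ?S = "{0::real<..} \<times> chart_image N i"
    obtain u v w where uvw: "vs = [u, v, w]" using vs by (auto simp: length_Suc_conv eval_nat_numeral)
    note c = smooth_on_compose_linear[OF bounded_linear_snd open_U open_W]
    have om: "smooth_on ?S (\<lambda>y. \<omega> i (snd y) [s, t])" for s t by (rule c[OF _ smooth_om]) auto
    have Om: "smooth_on ?S (\<lambda>y. Re (\<Omega> i (snd y) [s, t, z]))" for s t z
      by (rule c[OF _ smooth_on_bounded_linear[OF bounded_linear_Re open_U smooth_Om]]) auto
    \<comment> \<open>Powers are spelled out as products and the sign as a constant factor, so that
      closure under sums and products applies.\<close>
    have "smooth_on ?S (\<lambda>y. (- 1 * (fst y * fst y)) * (fst u * \<omega> i (snd y) [snd v, snd w] + fst v * \<omega> i (snd y) [snd w, snd u] + fst w * \<omega> i (snd y) [snd u, snd v])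
      + (fst y * (fst y * fst y)) * Re (\<Omega> i (snd y) [snd u, snd v, snd w]))"
      by (intro smooth_on_add[OF open_W] smooth_on_mult[OF open_W] smooth_on_const smooth_on_linear[OF bounded_linear_fst] om Om)
    then show ?thesis
      unfolding chart_image_cone uvw
      by (rule smooth_on_cong[OF open_W, THEN iffD1, rotated])
        (auto simp: Phi power2_eq_square power3_eq_cube)
  qed
  have law: "cone_phi \<omega> \<Omega> i (coord (cone_atlas N) i p) vs =
        cone_phi \<omega> \<Omega> j (coord (cone_atlas N) j p) (map (frechet_derivative (transition (cone_atlas N) i j) (at (coord (cone_atlas N) i p))) vs)"
    if ij: "i \<in> index N" "j \<in> index N" and p: "p \<in> dom (cone_atlas N) i \<inter> dom (cone_atlas N) j" and vs: "length vs = 3" for i j p vs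
  proof -
    obtain u v w where uvw: "vs = [u, v, w]" using vs by (auto simp: length_Suc_conv eval_nat_numeral)
    obtain r n where rn: "p = (r, n)" "r > 0" "n \<in> dom N i \<inter> dom N j" using p by (auto simp: cone_atlas_simps)
    interpret I: cone_chart "chart_image N i" "g i" "\<omega> i" "J i" "\<Omega> i" "cone_phi \<omega> \<Omega> i" "\<lambda>r. 1" "\<lambda>r. 0" "\<lambda>r. 0"
      by (rule cone_chart_phi[OF NK ij(1)])
    interpret J: cone_chart "chart_image N j" "g j" "\<omega> j" "J j" "\<Omega> j" "cone_phi \<omega> \<Omega> j" "\<lambda>r. 1" "\<lambda>r. 0" "\<lambda>r. 0"
      by (rule cone_chart_phi[OF NK ij(2)])
    have in_i: "coord N i n \<in> chart_image N i" "coord N j n \<in> chart_image N j"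
      using rn(3) by (auto simp: chart_image_def)
    let ?D = "frechet_derivative (transition N i j) (at (coord N i n))"
    have om: "\<omega> i (coord N i n) [s, t] = \<omega> j (coord N j n) [?D s, ?D t]" for s t
      using tensor_field_transition[OF t(1) ij rn(3), of "[s, t]"] by simp
    have Om: "\<Omega> i (coord N i n) [s, t, z] = \<Omega> j (coord N j n) [?D s, ?D t, ?D z]" for s t z
      using tensor_field_transition[OF t(2) ij rn(3), of "[s, t, z]"] by simp
    have D: "frechet_derivative (transition (cone_atlas N) i j) (at (r, coord N i n)) s = (fst s, ?D (snd s))" for s
      using cone_transition[OF N ij rn(3,2), of "fst s" "snd s"] by simp
    show ?thesis
      unfolding uvw rn(1) cone_atlas_simps list.map D I.Phi[OF rn(2) in_i(1)] J.Phi[OF rn(2) in_i(2)] om Om fst_conv snd_conv ..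
  qed
  show ?thesis
    unfolding G2_structure_def form_field_def tensor_field_def cone_atlas_simps(1)
  proof (intro conjI ballI allI impI)
    show "DIM(real \<times> (real ^ 6)) = 7" by simp
  qed (fact pointwise smooth law)+
qed

section \<open>The differential equation for a\<close>

lemma smooth_on_deriv:
  fixes f :: "real \<Rightarrow> real"
  assumes "smooth_on {0<..} f" "r > 0"
  shows "(f has_real_derivative deriv f r) (at r)"
    and "(deriv f has_real_derivative deriv (deriv f) r) (at r)"
proof -
  have 1: "(f has_real_derivative deriv f s) (at s)" if "s > 0" for s
  proof -
    have "f differentiable (at s)" using smooth_on_differentiable[OF open_greaterThan assms(1)] that by auto
    then show ?thesis using DERIV_deriv_iff_real_differentiable by blast
  qed
  then show "(f has_real_derivative deriv f r) (at r)" using assms(2) by blast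
  have "(\<lambda>s. D f s 1) differentiable (at r)"
    using smooth_on_differentiable[OF open_greaterThan smooth_on_D[OF assms(1)]] assms(2) by auto
  moreover have "D f s 1 = deriv f s" if "s \<in> {0<..}" for s
    using D_eqI[OF 1[unfolded has_field_derivative_def], of s 1] that by simp
  ultimately have "deriv f differentiable (at r)"
    using differentiable_cong[OF open_greaterThan, of r 0 "\<lambda>s. D f s 1" "deriv f"] assms(2) by auto
  then show "(deriv f has_real_derivative deriv (deriv f) r) (at r)"
    using DERIV_deriv_iff_real_differentiable by blast
qed

text \<open>Multiplication by f is the key. By f^2 + a^2 = 1 and its first two derivatives, f (f a'
  - a f') = a' and f (f a'' - a f'') = a'' + a (a')^2 / f^2. The last assumption is the radial
  soliton equation with \<alpha> and b = c r inserted.\<close>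

lemma soliton_ode_algebra:
  fixes f a f1 a1 f2 a2 r c :: real
  assumes "r > 0" "f \<noteq> 0" "f\<^sup>2 = 1 - a\<^sup>2" "f * f1 + a * a1 = 0" "f1\<^sup>2 + f * f2 + a1\<^sup>2 + a * a2 = 0"
    and "- 2 * (f * a2 - a * f2) + 6 * (- 2 * (f * a1 - a * f1)) / r - 6 * (- 2 * f * a) / r\<^sup>2 = - 2 * (f * a1 - a * f1) * (c * r)"
  shows "a2 + a / f\<^sup>2 * a1\<^sup>2 + (6 - c * r\<^sup>2) * (a1 / r) = 6 * (f\<^sup>2 / r\<^sup>2) * a"
    and "(f * a1 - a * f1)\<^sup>2 = a1\<^sup>2 / f\<^sup>2"
proof -
  have t: "f * (f * a1 - a * f1) = a1" using assms(3,4) by algebra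
  then show "(f * a1 - a * f1)\<^sup>2 = a1\<^sup>2 / f\<^sup>2"
    using assms(2) by (metis nonzero_mult_div_cancel_left power_divide)
  have "f\<^sup>2 * (f1\<^sup>2 + a1\<^sup>2) = a1\<^sup>2" using assms(3,4) by algebra
  then have s: "f1\<^sup>2 + a1\<^sup>2 = a1\<^sup>2 / f\<^sup>2" using assms(2) by (simp add: field_simps)
  have "f * (f * a2 - a * f2) = a2 + a * (f1\<^sup>2 + a1\<^sup>2)" using assms(3,5) by algebra
  then have u: "f * (f * a2 - a * f2) = a2 + a / f\<^sup>2 * a1\<^sup>2" unfolding s by simp
  define X Z where "X = f * a2 - a * f2" and "Z = f * a1 - a * f1"
  have "- 2 * X - 12 * (Z / r) + 12 * (f * a / r\<^sup>2) = - 2 * (Z * (c * r))"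
    using assms(6) unfolding X_def[symmetric] Z_def[symmetric] by simp
  then have "X + 6 * (Z / r) - 6 * (f * a / r\<^sup>2) = Z * (c * r)" by linarith
  from arg_cong[OF this, of "(*) f"]
  have "f * X + 6 * (f * Z) / r - 6 * f\<^sup>2 * a / r\<^sup>2 = f * Z * (c * r)"
    by (simp add: distrib_left right_diff_distrib power2_eq_square mult_ac)
  then have "a2 + a / f\<^sup>2 * a1\<^sup>2 + 6 * a1 / r - 6 * f\<^sup>2 * a / r\<^sup>2 = a1 * (c * r)" unfolding X_def Z_def u t .
  moreover have "c * r\<^sup>2 * (a1 / r) = a1 * (c * r)" using assms(1) by (simp add: power2_eq_square)
  ultimately show "a2 + a / f\<^sup>2 * a1\<^sup>2 + (6 - c * r\<^sup>2) * (a1 / r) = 6 * (f\<^sup>2 / r\<^sup>2) * a"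
    by (simp add: left_diff_distrib diff_divide_distrib)
qed

theorem proposition4p14:
  fixes N :: "('i, 'n::{t2_space,second_countable_topology}, real ^ 6) atlas"
    and g :: "('i, real ^ 6, real) field"
    and J :: "'i \<Rightarrow> real ^ 6 \<Rightarrow> real ^ 6 \<Rightarrow> real ^ 6"
    and \<omega> :: "('i, real ^ 6, real) field"
    and \<Omega> :: "('i, real ^ 6, complex) field"
    and M :: "('i, real \<times> 'n, real \<times> (real ^ 6)) atlas"
    and \<phi>b \<phi> :: "('i, real \<times> (real ^ 6), real) field"
    and X Y :: "'i \<Rightarrow> real \<times> (real ^ 6) \<Rightarrow> real \<times> (real ^ 6)"
    and f a b :: "real \<Rightarrow> real"
    and c :: real
  assumes "nearly_Kaehler N g J \<omega> \<Omega>"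
    and "M = cone_atlas N"
    and "\<phi>b = cone_phi \<omega> \<Omega>"
    and "smooth_on {0<..} f" and "smooth_on {0<..} a" and "smooth_on {0<..} b"
    and "\<forall>r>0. (f r)\<^sup>2 = 1 - (a r)\<^sup>2"
    and "X = radial_field a"
    and "Y = radial_field b"
    and "\<phi> = isometric_G2 (radial_function f) X \<phi>b"
    and "isometric_soliton M \<phi> Y c"
  shows "G2_structure M \<phi>b \<and> torsion_free M \<phi>b \<and> induces_metric M \<phi>b (cone_metric g) \<and>
    induces_metric M \<phi> (cone_metric g) \<and>
    (\<forall>r>0. b r = c * r) \<and>
    (\<forall>r>0. f r \<noteq> 0 \<longrightarrow>
       deriv (deriv a) r + a r / (f r)\<^sup>2 * (deriv a r)\<^sup>2 + (6 - c * r\<^sup>2) * (deriv a r / r) =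
       6 * ((f r)\<^sup>2 / r\<^sup>2) * a r) \<and>
    (\<forall>i\<in>index M. \<forall>y\<in>chart_image M i. f (fst y) \<noteq> 0 \<longrightarrow>
       1 / 4 * torsion_norm_sq (\<phi> i) y =
       (deriv a (fst y))\<^sup>2 / (f (fst y))\<^sup>2 + 6 * ((a (fst y))\<^sup>2 / (fst y)\<^sup>2))"
proof -
  note NK = assms(1) and M = assms(2) and phib = assms(3)
  let ?C = "cone_atlas N"
  define f1 a1 where "f1 = deriv f" and "a1 = deriv a"
  \<comment> \<open>Since f^2 + a^2 = 1, this is the derivative of the argument of (f - \<i>
    a)^2.\<close>
  define \<alpha> where "\<alpha> r = - 2 * (f r * a1 r - a r * f1 r)" for r
  have unit_fa: "(f r)\<^sup>2 = 1 - (a r)\<^sup>2" if "r > 0" for r using assms(7) that by blast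
  have df: "(f has_real_derivative f1 r) (at r)" "(a has_real_derivative a1 r) (at r)"
    and ddf: "(f1 has_real_derivative deriv f1 r) (at r)" "(a1 has_real_derivative deriv a1 r) (at r)"
    and db: "(b has_real_derivative deriv b r) (at r)" if "r > 0" for r
    unfolding f1_def a1_def
    using smooth_on_deriv[OF assms(4) that] smooth_on_deriv[OF assms(5) that] smooth_on_deriv[OF assms(6) that] by auto
  have ff': "f r * f1 r + a r * a1 r = 0" if r: "r > 0" for r
  proof -
    have "((\<lambda>r. (f r)\<^sup>2 + (a r)\<^sup>2) has_real_derivative 2 * f r * f1 r + 2 * a r * a1 r) (at r)"
      by (rule derivative_eq_intros df[OF r] refl)+ simp
    moreover have "((\<lambda>r. (f r)\<^sup>2 + (a r)\<^sup>2) has_real_derivative 0) (at r)"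
      by (rule has_field_derivative_transform_within_open[of "\<lambda>_. 1" _ _ "{0<..}"]) (use r unit_fa in auto)
    ultimately have "2 * f r * f1 r + 2 * a r * a1 r = 0" by (rule DERIV_unique)
    then show ?thesis by simp
  qed
  have ff'': "(f1 r)\<^sup>2 + f r * deriv f1 r + (a1 r)\<^sup>2 + a r * deriv a1 r = 0" if r: "r > 0" for r
  proof -
    have "((\<lambda>r. f r * f1 r + a r * a1 r) has_real_derivative (f1 r)\<^sup>2 + f r * deriv f1 r + (a1 r)\<^sup>2 + a r * deriv a1 r) (at r)"
      by (rule derivative_eq_intros df[OF r] ddf[OF r] refl)+ (simp add: power2_eq_square algebra_simps)
    moreover have "((\<lambda>r. f r * f1 r + a r * a1 r) has_real_derivative 0) (at r)"
      by (rule has_field_derivative_transform_within_open[of "\<lambda>_. 0" _ _ "{0<..}"]) (use r ff' in auto)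
    ultimately show ?thesis by (rule DERIV_unique)
  qed
  have d\<alpha>: "(\<alpha> has_real_derivative - 2 * (f r * deriv a1 r - a r * deriv f1 r)) (at r)" if r: "r > 0" for r
    unfolding \<alpha>_def by (rule derivative_eq_intros df[OF r] ddf[OF r] refl)+ (simp add: algebra_simps)
  have at_b: "cone_at (chart_image N i) (g i) (\<omega> i) (J i) (\<Omega> i) (\<phi>b i) (\<lambda>r. 1) (\<lambda>r. 0) (\<lambda>r. 0) (fst y) (snd y)"
    and at: "cone_at (chart_image N i) (g i) (\<omega> i) (J i) (\<Omega> i) (\<phi> i) (\<lambda>r. (f r)\<^sup>2 - (a r)\<^sup>2) (\<lambda>r. - 2 * f r * a r) \<alpha> (fst y) (snd y)"
    if "i \<in> index M" "y \<in> chart_image M i" for i y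
  proof -
    have i: "i \<in> index N" using that(1) by (simp add: M cone_atlas_simps)
    have y: "fst y > 0" "snd y \<in> chart_image N i" using that(2) by (auto simp: M chart_image_cone)
    show "cone_at (chart_image N i) (g i) (\<omega> i) (J i) (\<Omega> i) (\<phi>b i) (\<lambda>r. 1) (\<lambda>r. 0) (\<lambda>r. 0) (fst y) (snd y)"
      using cone_chart_phi[OF NK i] y by (simp add: phib cone_at_def cone_at_axioms_def)
    show "cone_at (chart_image N i) (g i) (\<omega> i) (J i) (\<Omega> i) (\<phi> i) (\<lambda>r. (f r)\<^sup>2 - (a r)\<^sup>2) (\<lambda>r. - 2 * f r * a r) \<alpha> (fst y) (snd y)"
      using cone_chart_isometric[OF NK i df unit_fa ff'] y
      by (simp add: assms(8,10) phib cone_at_def cone_at_axioms_def \<alpha>_def[abs_def])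
  qed
  have induced: "induces_metric M \<phi>b (cone_metric g)" "induces_metric M \<phi> (cone_metric g)"
    unfolding induces_metric_def
    by (intro ballI allI;
        use cone_at.metric_eq[OF at_b] cone_at.metric_eq[OF at] in
          \<open>simp add: cone_chart.cmetric_def[OF cone_at.axioms(1)[OF at_b]] cone_chart.cmetric_def[OF cone_at.axioms(1)[OF at]]
            cone_metric_def pullback_def\<close>)+
  have torsion: "torsion_free M \<phi>b"
    unfolding torsion_free_def
    by (intro ballI allI; use cone_at.torsion_eq[OF at_b] in
          \<open>simp add: cone_chart.ctorsion_def[OF cone_at.axioms(1)[OF at_b]] case_prod_unfold\<close>)
  \<comment> \<open>The statements about a and b concern r alone. As N is not empty, there is a
    point of the cone over every r > 0 at which the soliton equations can be evaluated.\<close>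
  obtain i0 n0 where i0: "i0 \<in> index N" "n0 \<in> dom N i0"
    using NK unfolding nearly_Kaehler_def smooth_manifold_def by auto
  define x0 where "x0 = coord N i0 n0"
  have x0: "i0 \<in> index M" "(r, x0) \<in> chart_image M i0" if "r > 0" for r
    using i0 that unfolding M chart_image_cone by (auto simp: cone_atlas_simps x0_def chart_image_def)
  have Y: "Y i y = (b (fst y), 0)" for i y by (simp add: assms(9) radial_field_def)
  have b: "b r = c * r" if r: "r > 0" for r
  proof -
    interpret cone_at "chart_image N i0" "g i0" "\<omega> i0" "J i0" "\<Omega> i0" "\<phi> i0" "\<lambda>r. (f r)\<^sup>2 - (a r)\<^sup>2" "\<lambda>r. - 2 * f r * a r" \<alpha> r x0
      using at[OF x0[OF r]] by simp
    \<comment> \<open>The first axis vector serves as a nonzero tangential direction.\<close>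
    have "lie_derivative 2 (Y i0) (G2_metric (\<phi> i0)) (r, x0) [(0, axis 1 1), (0, axis 1 1)] =
        2 * c * G2_metric (\<phi> i0) (r, x0) [(0, axis 1 1), (0, axis 1 1)]"
      using assms(11) x0[OF r] unfolding isometric_soliton_def by blast
    from lie_radial[OF Y db[OF r] this] show ?thesis by (simp add: axis_eq_0_iff)
  qed
  have ode: "deriv a1 r + a r / (f r)\<^sup>2 * (a1 r)\<^sup>2 + (6 - c * r\<^sup>2) * (a1 r / r) = 6 * ((f r)\<^sup>2 / r\<^sup>2) * a r"
    and square: "(f r * a1 r - a r * f1 r)\<^sup>2 = (a1 r)\<^sup>2 / (f r)\<^sup>2" if r: "r > 0" and f0: "f r \<noteq> 0" for r
  proof -
    interpret cone_at "chart_image N i0" "g i0" "\<omega> i0" "J i0" "\<Omega> i0" "\<phi> i0" "\<lambda>r. (f r)\<^sup>2 - (a r)\<^sup>2" "\<lambda>r. - 2 * f r * a r" \<alpha> r x0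
      using at[OF x0[OF r]] by simp
    \<comment> \<open>Only the radial component of the soliton equation is taken; the curl vanishes
      and the torsion term is \<alpha> b = \<alpha> c r.\<close>
    have "div_torsion (\<phi> i0) (r, x0) (1, 0) = - (1 / 2) * curl (\<phi> i0) (Y i0) (r, x0) (1, 0) + G2_torsion (\<phi> i0) (r, x0) [Y i0 (r, x0), (1, 0)]"
      using assms(11) x0[OF r] unfolding isometric_soliton_def by blast
    then have e: "- 2 * (f r * deriv a1 r - a r * deriv f1 r) + 6 * \<alpha> r / r - 6 * (- 2 * f r * a r) / r\<^sup>2 = \<alpha> r * (c * r)"
      unfolding div_torsion_radial[OF d\<alpha>[OF r]] curl_radial[OF Y db[OF r]] torsion_eq Y ctorsion_def prod.case
      by (simp add: b[OF r] linear_0[OF g_linear(1)] linear_0[OF om_linear(1)])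
    note alg = soliton_ode_algebra[OF r f0 unit_fa[OF r] ff'[OF r] ff''[OF r] e[unfolded \<alpha>_def]]
    show "deriv a1 r + a r / (f r)\<^sup>2 * (a1 r)\<^sup>2 + (6 - c * r\<^sup>2) * (a1 r / r) = 6 * ((f r)\<^sup>2 / r\<^sup>2) * a r"
      "(f r * a1 r - a r * f1 r)\<^sup>2 = (a1 r)\<^sup>2 / (f r)\<^sup>2" by (rule alg)+
  qed
  have norm: "1 / 4 * torsion_norm_sq (\<phi> i) y = (a1 (fst y))\<^sup>2 / (f (fst y))\<^sup>2 + 6 * ((a (fst y))\<^sup>2 / (fst y)\<^sup>2)"
    if "i \<in> index M" "y \<in> chart_image M i" "f (fst y) \<noteq> 0" for i y
  proof -
    interpret cone_at "chart_image N i" "g i" "\<omega> i" "J i" "\<Omega> i" "\<phi> i" "\<lambda>r. (f r)\<^sup>2 - (a r)\<^sup>2" "\<lambda>r. - 2 * f r * a r" \<alpha> "fst y" "snd y"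
      by (rule at[OF that(1,2)])
    \<comment> \<open>A quarter of this is the first term of the claim; the second is 12 (1 - p) /
      (4 r^2) with 1 - p = 2 a^2.\<close>
    have s: "(\<alpha> (fst y))\<^sup>2 = 4 * ((a1 (fst y))\<^sup>2 / (f (fst y))\<^sup>2)"
      unfolding \<alpha>_def power_mult_distrib square[OF r that(3)] by simp
    show ?thesis
      using torsion_norm_sq_cone unfolding s unit_fa[OF r] by (simp add: field_simps)
  qed
  show ?thesis
    using G2_structure_cone[OF NK] torsion induced b ode norm
    unfolding M[symmetric] phib[symmetric] f1_def a1_def by blast
qed

end
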